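(* Let $k$ be a field of characteristic zero, let $G$ be a reductive algebraic group over $k$, and let $V$ and $W$ be two finite-dimensional $k$-vector spaces, each equipped with an almost free linear $G$-action. Then the fields $k(V)^G$ and $k(W)^G$ are stably equivalent over $k$. If one of them is pure over $k$, then the other one is stably pure over $k$.
   Context: Reductive groups are not assumed connected. For a geometrically integral $k$-variety $X$, $k(X)$ is its function field; $\bar k$ is an algebraic closure of $k$, $\bar X=X\times_k\bar k$, and $\bar k(X)$ is the function field of $\bar X$. If a linear algebraic $k$-group $G$ acts on $X$, then $k(X)^G$ denotes the subfield of $\bar k(X)^{G(\bar k)}$ fixed by $\mathrm{Gal}(\bar k/k)$. A vector space is regarded as an affine space. An action of $G$ on $X$ is almost free if there is a non-empty open set $U\subset X$ such that for every $x\in U(\bar k)$ the stabilizer $G_x\subset G(\bar k)$ is trivial. A field extension is pure if it is purely transcendental; a field $K/k$ is stably pure over $k$ if $K(x_1,\dots,x_r)$ is purely transcendental over $k$ for some independent variables $x_1,\dots,x_r$. Fields $K,L$ over $k$ are stably equivalent if there are independent variables with $K(x_1,\dots,x_r)\cong L(y_1,\dots,y_s)$ over $k$. *)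

theory Defs
  imports
    "HOL-Library.Poly_Mapping"
    "HOL-Computational_Algebra.Fraction_Field"
    "HOL-Algebra.Algebraic_Closure_Type"
    "HOL-Algebra.Generated_Fields"
    "HOL-Algebra.QuotRing"
    "HOL-Algebra.Coset"
    "Jordan_Normal_Form.Determinant"
begin

section \<open>Polynomials and rational functions in several variables\<close>

text \<open>Exponent vectors are finitely supported maps from variables to \<^typ>\<open>nat\<close>, polynomials are
  finitely supported maps from exponent vectors to coefficients.\<close>

type_synonym ('x, 'c) mpoly = "('x \<Rightarrow>\<^sub>0 nat) \<Rightarrow>\<^sub>0 'c"

definition mconst :: "'c \<Rightarrow> ('x, 'c::zero) mpoly"
  where "mconst c = Poly_Mapping.single 0 c"

definition mvar :: "'x \<Rightarrow> ('x, 'c::zero_neq_one) mpoly"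
  where "mvar x = Poly_Mapping.single (Poly_Mapping.single x 1) 1"

definition polys :: "'c::zero set \<Rightarrow> 'x set \<Rightarrow> ('x, 'c) mpoly set"
  where "polys C Vs = {p. Poly_Mapping.range p \<subseteq> C \<and> (\<forall>t\<in>Poly_Mapping.keys p. Poly_Mapping.keys t \<subseteq> Vs)}"

definition eval_mpoly ::
  "('c::zero \<Rightarrow> 'r::comm_semiring_1) \<Rightarrow> ('x \<Rightarrow> 'r) \<Rightarrow> ('x, 'c) mpoly \<Rightarrow> 'r"
  where "eval_mpoly h \<alpha> p =
    (\<Sum>t\<in>Poly_Mapping.keys p. h (Poly_Mapping.lookup p t) *
       (\<Prod>x\<in>Poly_Mapping.keys t. \<alpha> x ^ Poly_Mapping.lookup t x))"

type_synonym 'c ratfun = "(nat, 'c) mpoly fract"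

definition rconst :: "'c::field \<Rightarrow> 'c ratfun"
  where "rconst c = Fract (mconst c) 1"

text \<open>For a subfield \<open>K\<close> of a field type, this is \<open>K(x\<^sub>0, \<dots>, x\<^sub>r\<^sub>-\<^sub>1)\<close> with \<open>x\<^sub>i\<close> independent over \<open>K\<close>,
  embedded in the rational functions in countably many variables.\<close>

definition ratfuns :: "'c::field set \<Rightarrow> nat \<Rightarrow> 'c ratfun set"
  where "ratfuns K r = {Fract p q | p q. p \<in> polys K {..<r} \<and> q \<in> polys K {..<r} \<and> q \<noteq> 0}"

text \<open>The map induced on fraction fields by an injective ring homomorphism \<open>h\<close>; it is
  well defined only because \<open>h\<close> is injective.\<close>

definition fract_map :: "('a::idom \<Rightarrow> 'b::idom) \<Rightarrow> 'a fract \<Rightarrow> 'b fract"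
  where "fract_map h f = (THE g. \<forall>p q. q \<noteq> 0 \<and> f = Fract p q \<longrightarrow> g = Fract (h p) (h q))"


section \<open>Field extensions\<close>

text \<open>An extension of the base field \<open>'k\<close> is a pair of an embedding \<open>\<iota>\<close> of \<open>'k\<close> into a field type and a
  subfield \<open>K\<close> of that type containing the image of \<open>\<iota>\<close>.\<close>

definition field_on :: "'f::field set \<Rightarrow> 'f ring"
  where "field_on K = ring_of_type_algebra\<lparr>carrier := K\<rparr>"

text \<open>In the next definition the elements of \<open>S\<close> serve as their own variables.\<close>

definition alg_independent :: "('k::field \<Rightarrow> 'f::field) \<Rightarrow> 'f set \<Rightarrow> bool"
  where "alg_independent \<iota> S \<longleftrightarrow> (\<forall>p \<in> polys UNIV S. eval_mpoly \<iota> (\<lambda>x. x) p = 0 \<longrightarrow> p = 0)"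

definition pure :: "('k::field \<Rightarrow> 'f::field) \<Rightarrow> 'f set \<Rightarrow> bool"
  where "pure \<iota> K \<longleftrightarrow>
    (\<exists>S. alg_independent \<iota> S \<and> K = generate_field ring_of_type_algebra (range \<iota> \<union> S))"

definition stably_pure :: "('k::field \<Rightarrow> 'f::field) \<Rightarrow> 'f set \<Rightarrow> bool"
  where "stably_pure \<iota> K \<longleftrightarrow> (\<exists>r. pure (\<lambda>c. rconst (\<iota> c)) (ratfuns K r))"

definition stably_equivalent ::
  "('k::field \<Rightarrow> 'f::field) \<Rightarrow> 'f set \<Rightarrow> ('k \<Rightarrow> 'g::field) \<Rightarrow> 'g set \<Rightarrow> bool"
  where "stably_equivalent \<iota> K \<kappa> L \<longleftrightarrow>
    (\<exists>r s. \<exists>\<phi> \<in> ring_iso (field_on (ratfuns K r)) (field_on (ratfuns L s)).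
       \<forall>c. \<phi> (rconst (\<iota> c)) = rconst (\<kappa> c))"


section \<open>Linear algebraic groups\<close>

definition GL :: "nat \<Rightarrow> 'c::field mat monoid"
  where "GL n = units_of (ring_mat TYPE('c) n ())"

definition eval_mat :: "(nat \<times> nat, 'c::field) mpoly \<Rightarrow> 'c mat \<Rightarrow> 'c"
  where "eval_mat p A = eval_mpoly (\<lambda>c. c) (\<lambda>ij. A $$ ij) p"

definition zariski_closed :: "'c::field set \<Rightarrow> nat \<Rightarrow> 'c mat set \<Rightarrow> bool"
  where "zariski_closed C n Z \<longleftrightarrow>
    (\<exists>P \<subseteq> polys C ({..<n} \<times> {..<n}). Z = {A \<in> carrier (GL n). \<forall>p\<in>P. eval_mat p A = 0})"

definition zariski_connected :: "nat \<Rightarrow> 'c::field mat set \<Rightarrow> bool"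
  where "zariski_connected n H \<longleftrightarrow>
    \<not> (\<exists>Y Z. zariski_closed UNIV n Y \<and> zariski_closed UNIV n Z \<and> H \<subseteq> Y \<union> Z \<and>
         H \<inter> Y \<inter> Z = {} \<and> H \<inter> Y \<noteq> {} \<and> H \<inter> Z \<noteq> {})"

definition unipotent :: "nat \<Rightarrow> 'c::field mat set \<Rightarrow> bool"
  where "unipotent n H \<longleftrightarrow> (\<forall>A\<in>H. \<exists>d. (A - 1\<^sub>m n) ^\<^sub>m d = 0\<^sub>m n n)"

text \<open>A linear algebraic group over \<open>'k\<close> is given by its group \<open>G\<close> of points over the algebraic
  closure, as a subgroup of some \<open>GL\<^sub>n\<close> cut out by polynomials over \<open>'k\<close>. Since \<open>'k\<close> has
  characteristic zero, \<open>G\<close> is automatically reduced, and being cut out by polynomials over \<open>'k\<close>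
  is the same as being defined over \<open>'k\<close>.\<close>

definition linear_algebraic_group :: "nat \<Rightarrow> 'k::field_char_0 alg_closure mat set \<Rightarrow> bool"
  where "linear_algebraic_group n G \<longleftrightarrow> subgroup G (GL n) \<and> zariski_closed (range to_ac) n G"

text \<open>Reductive means that the unipotent radical, i.e. the largest connected normal unipotent
  closed subgroup over the algebraic closure, is trivial; \<open>G\<close> itself need not be connected.\<close>

definition reductive_group :: "nat \<Rightarrow> 'k::field_char_0 alg_closure mat set \<Rightarrow> bool"
  where "reductive_group n G \<longleftrightarrow> linear_algebraic_group n G \<and>
    (\<forall>H. H \<lhd> (GL n)\<lparr>carrier := G\<rparr> \<and> zariski_closed UNIV n H \<and> zariski_connected n H \<and>
         unipotent n H \<longrightarrow> H = {1\<^sub>m n})"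


section \<open>Linear actions and invariants\<close>

text \<open>A linear action of \<open>G\<close> on \<open>'k\<^sup>m\<close>, i.e. a homomorphism from \<open>G\<close> to \<open>GL\<^sub>m\<close> that is a morphism over \<open>'k\<close>:
  the matrix entries are restrictions to \<open>G\<close> of regular functions on \<open>GL\<^sub>n\<close> over \<open>'k\<close>.\<close>

definition linear_action ::
  "nat \<Rightarrow> 'k::field_char_0 alg_closure mat set \<Rightarrow> nat \<Rightarrow>
   ('k alg_closure mat \<Rightarrow> 'k alg_closure mat) \<Rightarrow> bool"
  where "linear_action n G m \<rho> \<longleftrightarrow> \<rho> \<in> hom ((GL n)\<lparr>carrier := G\<rparr>) (GL m) \<and>
    (\<forall>i<m. \<forall>j<m. \<exists>p \<in> polys (range to_ac) ({..<n} \<times> {..<n}). \<exists>d.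
       \<forall>A\<in>G. \<rho> A $$ (i, j) = eval_mat p A / det A ^ d)"

text \<open>The open subset \<open>U\<close> of affine space is defined over \<open>'k\<close>; it is represented by its points over
  the algebraic closure.\<close>

definition almost_free ::
  "nat \<Rightarrow> 'k::field_char_0 alg_closure mat set \<Rightarrow> nat \<Rightarrow>
   ('k alg_closure mat \<Rightarrow> 'k alg_closure mat) \<Rightarrow> bool"
  where "almost_free n G m \<rho> \<longleftrightarrow>
    (\<exists>P \<subseteq> polys (range to_ac) {..<m}.
       let U = {v \<in> carrier_vec m. \<exists>p\<in>P. eval_mpoly (\<lambda>c. c) (\<lambda>i. v $ i) p \<noteq> 0}
       in U \<noteq> {} \<and> (\<forall>v\<in>U. {A \<in> G. \<rho> A *\<^sub>v v = v} = {1\<^sub>m n}))"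

text \<open>The substitution \<open>p(x) \<mapsto> p(Bx)\<close> in the first \<open>m\<close> variables; the other variables are fixed,
  which makes the substitution injective for invertible \<open>B\<close>.\<close>

definition lin_subst :: "nat \<Rightarrow> 'c::field mat \<Rightarrow> (nat, 'c) mpoly \<Rightarrow> (nat, 'c) mpoly"
  where "lin_subst m B =
    eval_mpoly mconst (\<lambda>i. if i < m then \<Sum>j<m. mconst (B $$ (i, j)) * mvar j else mvar i)"

definition galois_group :: "('k::field alg_closure \<Rightarrow> 'k alg_closure) set"
  where "galois_group = {\<sigma> \<in> ring_iso ring_of_type_algebra ring_of_type_algebra.
    \<forall>c. \<sigma> (to_ac c) = to_ac c}"

text \<open>With \<open>V = 'k\<^sup>m\<close> acted on through \<open>\<rho>\<close>: the subfield \<open>k(V)\<^sup>G\<close> of the function field of \<open>V\<close> over the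
  algebraic closure. The Galois group acts on coefficients. Invariance is expressed by
  \<open>f \<circ> \<rho>(A) = f\<close> for all \<open>A \<in> G\<close>; the left action uses the inverse of \<open>A\<close>, with the same fixed
  elements.\<close>

definition invariant_field ::
  "'k::field_char_0 alg_closure mat set \<Rightarrow> nat \<Rightarrow>
   ('k alg_closure mat \<Rightarrow> 'k alg_closure mat) \<Rightarrow> 'k alg_closure ratfun set"
  where "invariant_field G m \<rho> =
    {f \<in> ratfuns UNIV m.
       (\<forall>A\<in>G. fract_map (lin_subst m (\<rho> A)) f = f) \<and>
       (\<forall>\<sigma>\<in>galois_group. fract_map (Poly_Mapping.map \<sigma>) f = f)}"

definition base_embedding :: "'k::field_char_0 \<Rightarrow> 'k alg_closure ratfun"
  where "base_embedding c = rconst (to_ac c)"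

end

theory Submission
  imports Defs "HOL-Library.Function_Algebras"
begin

text \<open>
  Write \<open>L\<close> for the field of rational functions on \<open>V\<close> over the algebraic closure and \<open>K\<close> for its
  subfield \<open>k(V)\<^sup>G\<close>. Everything rests on the no-name lemma (\<open>no_name_lemma\<close>): if \<open>G\<close> acts almost freely
  on \<open>V\<close> and linearly on a space \<open>W\<close> of dimension \<open>d\<close>, then \<open>k(V \<oplus> W)\<^sup>G\<close> is isomorphic over \<open>k\<close> to
  \<open>K(x\<^sub>1, \<dots>, x\<^sub>d)\<close>. When both actions are almost free, this describes the invariant field of \<open>V \<oplus> W\<close>
  in two ways, as a rational function field over \<open>k(V)\<^sup>G\<close> and as one over \<open>k(W)\<^sup>G\<close>. That is the stable
  equivalence. A field that is pure over \<open>k\<close> stays pure after adjoining variables, and purity is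
  carried along isomorphisms over \<open>k\<close>, so the statement about purity follows.

  The no-name lemma needs a basis of \<open>L\<^sup>d\<close> consisting of vectors \<open>u\<close> that are equivariant, in the sense
  that \<open>u(gv) = \<sigma>(g) u(v)\<close>, and fixed by the Galois group (\<open>equivariant_frame\<close>). With such vectors as
  columns of a matrix \<open>U\<close> and with \<open>y\<close> the coordinates of \<open>W\<close>, the entries \<open>t\<close> of \<open>U\<^sup>-\<^sup>1 y\<close> are invariant,
  they are independent generators over \<open>L\<close> of the function field of \<open>V \<oplus> W\<close>, and the symmetries act on
  a rational function of \<open>t\<close> through its coefficients only. Writing an invariant as a quotient of two
  polynomials in \<open>t\<close>, one may then choose the coefficients in \<open>K\<close>.

  That choice, and two more below, are instances of one elementary descent argument
  (\<open>descent_to_fixed_vectors\<close>): a space of finitely supported vectors over a field that is stable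
  under a set of semilinear maps is spanned by the vectors fixed by these maps.

  The equivariant vectors come from the almost free action. For a general point \<open>v\<close> the group element
  \<open>g\<close> is determined by \<open>v\<close> and \<open>gv\<close>; in characteristic zero a function that is determined by the values
  of other functions is a rational function of these. Hence the entries of \<open>\<sigma>(g)\<close> are rational
  functions of \<open>v\<close> and \<open>gv\<close> (\<open>representation_entries_rational\<close>): after multiplication by a common
  denominator they become sums of terms \<open>c(v) r(gv)\<close>. The possible denominators form a vector space
  over \<open>L\<close> that is stable under the Galois group and under translation by \<open>G\<close>, acting semilinearly, so
  descent yields an invariant denominator \<open>q\<close>. In the same way the formal expressions for \<open>q \<sigma>(g) u\<close>,
  with \<open>u\<close> in \<open>L\<^sup>d\<close>, form a stable space, and its fixed elements belong to equivariant vectors \<open>u\<close>.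

  The fact on functions determined by other functions (\<open>separated_function_rational\<close>) is proved by
  extending homomorphisms from a subring to an algebraically closed field one generator at a time. A
  generator that is not a quotient of elements of the subring admits two different values: if it is
  transcendental nearly all values are possible, and if it is algebraic its minimal equation has degree
  at least two and, in characteristic zero, distinct roots. Since \<open>G\<close> may be reducible, the ring of
  functions in question may have zero divisors, and the argument is carried out modulo prime ideals.
\<close>

section \<open>Extending homomorphisms to an algebraically closed field\<close>

definition subring_set :: "'r::comm_ring_1 set \<Rightarrow> bool"
  where "subring_set A \<longleftrightarrow> 1 \<in> A \<and> (\<forall>a\<in>A. \<forall>b\<in>A. a + b \<in> A \<and> a * b \<in> A \<and> - a \<in> A)"

text \<open>A prime ideal of the whole ring: that it absorbs multiplication is one direction of the
  equivalence in the last clause.\<close>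
definition prime_set :: "'r::comm_ring_1 set \<Rightarrow> bool"
  where "prime_set P \<longleftrightarrow> 0 \<in> P \<and> 1 \<notin> P \<and> (\<forall>a\<in>P. \<forall>b\<in>P. a + b \<in> P) \<and>
    (\<forall>a b. a * b \<in> P \<longleftrightarrow> a \<in> P \<or> b \<in> P)"

definition polys_over :: "'r::comm_ring_1 set \<Rightarrow> 'r poly set"
  where "polys_over A = {p. \<forall>i. poly.coeff p i \<in> A}"

definition adjoin :: "'r::comm_ring_1 set \<Rightarrow> 'r \<Rightarrow> 'r set"
  where "adjoin A u = (\<lambda>p. poly p u) ` polys_over A"

text \<open>A homomorphism from \<open>A\<close> modulo \<open>A \<inter> P\<close> to a field, encoded as a total function of which only the
  values on \<open>A\<close> matter. This allows the subring and the ideal to vary without changing the type.\<close>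
definition specialisation :: "'r::comm_ring_1 set \<Rightarrow> 'r set \<Rightarrow> ('r \<Rightarrow> 'c::field) \<Rightarrow> bool"
  where "specialisation A P \<phi> \<longleftrightarrow> \<phi> 1 = 1 \<and>
    (\<forall>a\<in>A. \<forall>b\<in>A. \<phi> (a + b) = \<phi> a + \<phi> b \<and> \<phi> (a * b) = \<phi> a * \<phi> b) \<and> (\<forall>a\<in>A \<inter> P. \<phi> a = 0)"

lemma subring_setD:
  assumes "subring_set A"
  shows "1 \<in> A" "0 \<in> A" "a \<in> A \<Longrightarrow> b \<in> A \<Longrightarrow> a + b \<in> A" "a \<in> A \<Longrightarrow> b \<in> A \<Longrightarrow> a * b \<in> A"
    "a \<in> A \<Longrightarrow> - a \<in> A" "a \<in> A \<Longrightarrow> b \<in> A \<Longrightarrow> a - b \<in> A" "a \<in> A \<Longrightarrow> a ^ n \<in> A" "of_nat n \<in> A"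
proof -
  note * = assms[unfolded subring_set_def]
  show 1: "1 \<in> A" using * by auto
  have "1 + (- 1) \<in> A" using * by blast
  then show 0: "0 \<in> A" by simp
  show "a \<in> A \<Longrightarrow> b \<in> A \<Longrightarrow> a + b \<in> A" "a \<in> A \<Longrightarrow> b \<in> A \<Longrightarrow> a * b \<in> A" "a \<in> A \<Longrightarrow> - a \<in> A"
    using * by auto
  show "a \<in> A \<Longrightarrow> b \<in> A \<Longrightarrow> a - b \<in> A" using * by (metis diff_conv_add_uminus)
  show "a \<in> A \<Longrightarrow> a ^ n \<in> A" by (induction n) (use * in auto)
  show "of_nat n \<in> A" by (induction n) (use 0 * in auto)
qed

lemma subring_set_sum:
  assumes "subring_set A" "\<And>i. i \<in> I \<Longrightarrow> f i \<in> A"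
  shows "(\<Sum>i\<in>I. f i) \<in> A"
  using assms(2) by (induction I rule: infinite_finite_induct) (auto intro: subring_setD[OF assms(1)])

lemma subring_set_prod:
  assumes "subring_set A" "\<And>i. i \<in> I \<Longrightarrow> f i \<in> A"
  shows "(\<Prod>i\<in>I. f i) \<in> A"
  using assms(2) by (induction I rule: infinite_finite_induct) (auto intro: subring_setD[OF assms(1)])

lemma prime_setD:
  assumes "prime_set P"
  shows "0 \<in> P" "1 \<notin> P" "a \<in> P \<Longrightarrow> b \<in> P \<Longrightarrow> a + b \<in> P" "a * b \<in> P \<longleftrightarrow> a \<in> P \<or> b \<in> P"
    "- a \<in> P \<longleftrightarrow> a \<in> P" "a \<in> P \<Longrightarrow> b \<in> P \<Longrightarrow> a - b \<in> P"
proof -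
  note * = assms[unfolded prime_set_def]
  show "0 \<in> P" "1 \<notin> P" "a \<in> P \<Longrightarrow> b \<in> P \<Longrightarrow> a + b \<in> P" "a * b \<in> P \<longleftrightarrow> a \<in> P \<or> b \<in> P"
    using * by auto
  show m: "- x \<in> P \<longleftrightarrow> x \<in> P" for x
    using * by (metis minus_minus mult_minus1)
  show "a \<in> P \<Longrightarrow> b \<in> P \<Longrightarrow> a - b \<in> P" using * m by (metis diff_conv_add_uminus)
qed

lemma prime_set_power: "prime_set P \<Longrightarrow> a ^ n \<in> P \<Longrightarrow> a \<in> P"
  by (induction n) (auto simp: prime_set_def)

lemma prime_set_sum:
  assumes "prime_set P" "\<And>i. i \<in> I \<Longrightarrow> f i \<in> P"
  shows "(\<Sum>i\<in>I. f i) \<in> P"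
  using assms(2) by (induction I rule: infinite_finite_induct) (auto intro: prime_setD[OF assms(1)])

text \<open>The constant \<^const>\<open>pderiv\<close> is confined to coefficients without zero divisors, which the ring of
  functions on a group does not satisfy.\<close>
definition formal_deriv :: "'r::comm_ring_1 poly \<Rightarrow> 'r poly"
  where "formal_deriv p = (\<Sum>i\<le>Polynomial.degree p. monom (of_nat i * poly.coeff p i) (i - 1))"

lemma coeff_formal_deriv: "poly.coeff (formal_deriv p) i = of_nat (Suc i) * poly.coeff p (Suc i)"
proof -
  have "poly.coeff (formal_deriv p) i =
      (\<Sum>j\<le>Polynomial.degree p. if j = Suc i then of_nat j * poly.coeff p j else 0)"
    unfolding formal_deriv_def coeff_sum
  proof (rule sum.cong)
    fix j
    show "poly.coeff (monom (of_nat j * poly.coeff p j) (j - 1)) i =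
        (if j = Suc i then of_nat j * poly.coeff p j else 0)"
      by (cases j) auto
  qed simp
  also have "\<dots> = of_nat (Suc i) * poly.coeff p (Suc i)"
    by (auto simp: coeff_eq_0 simp del: of_nat_Suc)
  finally show ?thesis .
qed

lemma polys_over_closed:
  assumes "subring_set A"
  shows "p \<in> polys_over A \<Longrightarrow> q \<in> polys_over A \<Longrightarrow> p + q \<in> polys_over A"
    "p \<in> polys_over A \<Longrightarrow> q \<in> polys_over A \<Longrightarrow> p - q \<in> polys_over A"
    "p \<in> polys_over A \<Longrightarrow> q \<in> polys_over A \<Longrightarrow> p * q \<in> polys_over A"
    "p \<in> polys_over A \<Longrightarrow> - p \<in> polys_over A"
    "a \<in> A \<Longrightarrow> p \<in> polys_over A \<Longrightarrow> smult a p \<in> polys_over A"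
    "a \<in> A \<Longrightarrow> p \<in> polys_over A \<Longrightarrow> pCons a p \<in> polys_over A"
    "a \<in> A \<Longrightarrow> monom a n \<in> polys_over A"
    "0 \<in> polys_over A" "1 \<in> polys_over A"
    "p \<in> polys_over A \<Longrightarrow> formal_deriv p \<in> polys_over A"
  unfolding polys_over_def
  by (auto simp: coeff_mult coeff_pCons coeff_formal_deriv split: nat.splits
      simp del: of_nat_Suc intro!: subring_set_sum[OF assms] subring_setD[OF assms])

lemma subring_set_adjoin:
  assumes "subring_set A"
  shows "subring_set (adjoin A u)" "A \<subseteq> adjoin A u" "u \<in> adjoin A u"
proof -
  note c = polys_over_closed[OF assms]
  have eq: "x \<in> adjoin A u \<longleftrightarrow> (\<exists>p\<in>polys_over A. x = poly p u)" for x
    by (auto simp: adjoin_def)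
  show "subring_set (adjoin A u)"
    unfolding subring_set_def
  proof (intro conjI ballI)
    show "1 \<in> adjoin A u" unfolding eq by (intro bexI[OF _ c(9)]) simp
    fix x y assume "x \<in> adjoin A u" "y \<in> adjoin A u"
    then obtain p q where pq: "p \<in> polys_over A" "q \<in> polys_over A" "x = poly p u" "y = poly q u"
      unfolding eq by blast
    show "x + y \<in> adjoin A u" unfolding eq pq by (intro bexI[OF _ c(1)[OF pq(1,2)]]) simp
    show "x * y \<in> adjoin A u" unfolding eq pq by (intro bexI[OF _ c(3)[OF pq(1,2)]]) simp
    show "- x \<in> adjoin A u" unfolding eq pq by (intro bexI[OF _ c(4)[OF pq(1)]]) simp
  qed
  show "A \<subseteq> adjoin A u"
  proof
    fix a assume "a \<in> A"
    then have "[:a:] \<in> polys_over A" by (auto intro: c)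
    then show "a \<in> adjoin A u" unfolding eq by (intro bexI[of _ "[:a:]"]) auto
  qed
  have "[:0,1:] \<in> polys_over A" by (auto intro!: c subring_setD[OF assms])
  then show "u \<in> adjoin A u" unfolding eq by (intro bexI[of _ "[:0,1:]"]) auto
qed

lemma specialisationD:
  assumes "specialisation A P \<phi>" "subring_set A"
  shows "\<phi> 1 = 1" "\<phi> 0 = 0" "a \<in> A \<Longrightarrow> b \<in> A \<Longrightarrow> \<phi> (a + b) = \<phi> a + \<phi> b"
    "a \<in> A \<Longrightarrow> b \<in> A \<Longrightarrow> \<phi> (a * b) = \<phi> a * \<phi> b" "a \<in> A \<Longrightarrow> a \<in> P \<Longrightarrow> \<phi> a = 0"
    "a \<in> A \<Longrightarrow> \<phi> (- a) = - \<phi> a" "a \<in> A \<Longrightarrow> b \<in> A \<Longrightarrow> \<phi> (a - b) = \<phi> a - \<phi> b"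
    "a \<in> A \<Longrightarrow> \<phi> (a ^ n) = \<phi> a ^ n" "\<phi> (of_nat n) = of_nat n"
proof -
  note * = assms(1)[unfolded specialisation_def] and s = subring_setD[OF assms(2)]
  show 1: "\<phi> 1 = 1" "\<And>a b. a \<in> A \<Longrightarrow> b \<in> A \<Longrightarrow> \<phi> (a + b) = \<phi> a + \<phi> b"
    "a \<in> A \<Longrightarrow> b \<in> A \<Longrightarrow> \<phi> (a * b) = \<phi> a * \<phi> b" "a \<in> A \<Longrightarrow> a \<in> P \<Longrightarrow> \<phi> a = 0"
    using * by auto
  show 0: "\<phi> 0 = 0" using 1(2)[of 0 0] s(2) by (metis add.right_neutral add_left_cancel)
  show m: "\<And>a. a \<in> A \<Longrightarrow> \<phi> (- a) = - \<phi> a"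
    using 1(2) 0 s(5) by (metis add.right_inverse add_eq_0_iff)
  show "a \<in> A \<Longrightarrow> b \<in> A \<Longrightarrow> \<phi> (a - b) = \<phi> a - \<phi> b"
    using 1(2)[of a "- b"] m s(5) by simp
  show "a \<in> A \<Longrightarrow> \<phi> (a ^ n) = \<phi> a ^ n"
    by (induction n) (use * s in auto)
  show "\<phi> (of_nat n) = of_nat n"
    by (induction n) (use 0 * s in auto)
qed

lemma specialisation_sum:
  assumes "specialisation A P \<phi>" "subring_set A" "\<And>i. i \<in> I \<Longrightarrow> f i \<in> A"
  shows "\<phi> (\<Sum>i\<in>I. f i) = (\<Sum>i\<in>I. \<phi> (f i))"
  using assms(3)
proof (induction I rule: infinite_finite_induct)
  case (insert x F)
  then show ?case
    by (simp add: specialisationD[OF assms(1,2)] subring_set_sum[OF assms(2)])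
qed (auto simp: specialisationD[OF assms(1,2)])

lemma specialisation_prod:
  assumes "specialisation A P \<phi>" "subring_set A" "\<And>i. i \<in> I \<Longrightarrow> f i \<in> A"
  shows "\<phi> (\<Prod>i\<in>I. f i) = (\<Prod>i\<in>I. \<phi> (f i))"
  using assms(3)
proof (induction I rule: infinite_finite_induct)
  case (insert x F)
  then show ?case
    by (simp add: specialisationD[OF assms(1,2)] subring_set_prod[OF assms(2)])
qed (auto simp: specialisationD[OF assms(1,2)])

lemma map_poly_specialisation:
  assumes "specialisation A P \<phi>" "subring_set A" "p \<in> polys_over A" "q \<in> polys_over A"
  shows "map_poly \<phi> (p + q) = map_poly \<phi> p + map_poly \<phi> q"
    "map_poly \<phi> (p - q) = map_poly \<phi> p - map_poly \<phi> q"
    "map_poly \<phi> (p * q) = map_poly \<phi> p * map_poly \<phi> q"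
    "map_poly \<phi> (formal_deriv p) = pderiv (map_poly \<phi> p)"
proof -
  note sd = specialisationD[OF assms(1,2)]
  have c: "poly.coeff p i \<in> A" "poly.coeff q i \<in> A" for i
    using assms(3,4) by (auto simp: polys_over_def)
  have cm: "poly.coeff (map_poly \<phi> r) i = \<phi> (poly.coeff r i)" for r i
    by (simp add: coeff_map_poly sd)
  show "map_poly \<phi> (p + q) = map_poly \<phi> p + map_poly \<phi> q"
    "map_poly \<phi> (p - q) = map_poly \<phi> p - map_poly \<phi> q"
    "map_poly \<phi> (formal_deriv p) = pderiv (map_poly \<phi> p)"
    by (auto intro!: poly_eqI simp: cm sd c coeff_pderiv coeff_formal_deriv subring_setD[OF assms(2)] simp del: of_nat_Suc)
  show "map_poly \<phi> (p * q) = map_poly \<phi> p * map_poly \<phi> q"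
    by (auto intro!: poly_eqI simp: cm sd c coeff_mult subring_setD[OF assms(2)]
         specialisation_sum[OF assms(1,2)])
qed

text \<open>Modulo \<open>P\<close>, the ring \<open>A[u]\<close> is the polynomial ring over \<open>A\<close> modulo the polynomials that vanish at \<open>u\<close>,
  so \<open>u\<close> may be sent to any common root \<open>c\<close> of the images of these polynomials.\<close>
lemma extend_specialisation_to_value:
  assumes sp: "specialisation A P \<phi>" and A: "subring_set A"
    and c: "\<And>q. q \<in> polys_over A \<Longrightarrow> poly q u \<in> P \<Longrightarrow> poly (map_poly \<phi> q) c = 0" and P: "prime_set P"
  shows "\<exists>\<psi>. specialisation (adjoin A u) P \<psi> \<and>
    (\<forall>q\<in>polys_over A. \<psi> (poly q u) = poly (map_poly \<phi> q) c) \<and> (\<forall>a\<in>A. \<psi> a = \<phi> a) \<and> \<psi> u = c"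
proof -
  note sd = specialisationD[OF sp A] and m = map_poly_specialisation[OF sp A]
    and cl = polys_over_closed[OF A]
  define rep where "rep x = (SOME q. q \<in> polys_over A \<and> poly q u = x)" for x
  have rep: "rep (poly q u) \<in> polys_over A \<and> poly (rep (poly q u)) u = poly q u"
    if "q \<in> polys_over A" for q
    unfolding rep_def by (rule someI[where x = q]) (use that in auto)
  define \<psi> where "\<psi> x = poly (map_poly \<phi> (rep x)) c" for x
  have \<psi>: "\<psi> (poly q u) = poly (map_poly \<phi> q) c" if q: "q \<in> polys_over A" for q
  proof -
    have "poly (map_poly \<phi> (rep (poly q u) - q)) c = 0"
      by (rule c) (use rep[OF q] q prime_setD[OF P] in \<open>auto intro: cl\<close>)
    then show ?thesis using rep[OF q] q by (simp add: m \<psi>_def)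
  qed
  have const: "\<psi> a = \<phi> a" if "a \<in> A" for a
    using \<psi>[of "[:a:]"] that by (auto simp: cl map_poly_pCons sd)
  have "specialisation (adjoin A u) P \<psi>"
    unfolding specialisation_def
  proof (intro conjI ballI)
    show "\<psi> 1 = 1" using const[of 1] subring_setD[OF A] sd by simp
  next
    fix a b assume "a \<in> adjoin A u" "b \<in> adjoin A u"
    then obtain p q where pq: "p \<in> polys_over A" "q \<in> polys_over A" "a = poly p u" "b = poly q u"
      by (auto simp: adjoin_def)
    show "\<psi> (a + b) = \<psi> a + \<psi> b" "\<psi> (a * b) = \<psi> a * \<psi> b"
      using \<psi>[of "p + q"] \<psi>[of "p * q"] \<psi>[of p] \<psi>[of q] pq by (auto simp: cl m)
  next
    fix a assume "a \<in> adjoin A u \<inter> P"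
    then show "\<psi> a = 0" using \<psi> c by (auto simp: adjoin_def)
  qed
  moreover have "\<psi> u = c"
    using \<psi>[of "[:0,1:]"] by (auto simp: cl map_poly_pCons sd subring_setD[OF A])
  ultimately show ?thesis using \<psi> const by blast
qed

text \<open>Powers of the leading coefficient replace its inverse, since \<open>m\<close> need not be monic.\<close>
lemma pseudo_division:
  assumes A: "subring_set A" and m: "m \<in> polys_over A" "Polynomial.degree m > 0" and q: "q \<in> polys_over A"
  shows "\<exists>e s r. s \<in> polys_over A \<and> r \<in> polys_over A \<and> Polynomial.degree r < Polynomial.degree m \<and>
    smult (Polynomial.lead_coeff m ^ e) q = m * s + r"
  using q
proof (induction "Polynomial.degree q" arbitrary: q rule: less_induct)
  case less
  note cl = polys_over_closed[OF A]
  let ?l = "Polynomial.lead_coeff m" and ?dq = "Polynomial.degree q" and ?dm = "Polynomial.degree m"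
  have lA: "?l \<in> A" using m by (auto simp: polys_over_def)
  show ?case
  proof (cases "?dq < ?dm")
    case True
    then show ?thesis using less.prems cl by (intro exI[of _ 0] exI[of _ "0"] exI[of _ q]) auto
  next
    case False
    define t where "t = monom (Polynomial.lead_coeff q) (?dq - ?dm)"
    have t: "t \<in> polys_over A" unfolding t_def by (rule cl) (use less.prems in \<open>auto simp: polys_over_def\<close>)
    define q' where "q' = smult ?l q - m * t"
    have q': "q' \<in> polys_over A" unfolding q'_def using t less.prems m lA by (auto intro: cl)
    have "Polynomial.degree q' \<le> ?dq"
      unfolding q'_def t_def using False
      by (intro degree_diff_le order.trans[OF degree_smult_le] order.trans[OF degree_mult_le]) 
        (auto simp: degree_monom_le le_diff_conv2 intro: order.trans[OF add_left_mono[OF degree_monom_le]])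
    moreover have "poly.coeff q' ?dq = 0"
    proof -
      have "poly.coeff (m * t) ?dq = Polynomial.lead_coeff q * ?l"
        unfolding t_def using False by (subst mult.commute) (simp add: coeff_monom_mult)
      then show ?thesis by (simp add: q'_def mult.commute)
    qed
    ultimately have "Polynomial.degree q' < ?dq"
      using False m(2) eq_zero_or_degree_less[of q' ?dq] by (cases "q' = 0") auto
    from less.hyps[OF this q'] obtain e s r where
      *: "s \<in> polys_over A" "r \<in> polys_over A" "Polynomial.degree r < ?dm" "smult (?l ^ e) q' = m * s + r"
      by blast
    have "smult (?l ^ Suc e) q = smult (?l ^ e) q' + m * smult (?l ^ e) t"
      by (simp add: q'_def smult_diff_right mult.commute)
    also have "\<dots> = m * (s + smult (?l ^ e) t) + r"
      by (simp add: *(4) algebra_simps)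
    finally show ?thesis
      using * t lA by (intro exI[of _ "Suc e"] exI[of _ "s + smult (?l ^ e) t"] exI[of _ r])
        (auto intro!: cl subring_setD[OF A])
  qed
qed

text \<open>Leading terms with coefficients in \<open>P\<close> are removed one at a time.\<close>
lemma truncate_modulo_prime:
  assumes A: "subring_set A" and P: "prime_set P" and q: "q \<in> polys_over A" and nz: "poly.coeff q i \<notin> P"
  shows "\<exists>r\<in>polys_over A. Polynomial.lead_coeff r \<notin> P \<and> Polynomial.degree r \<le> Polynomial.degree q \<and>
    i \<le> Polynomial.degree r \<and> q - r \<in> polys_over P"
  using q nz
proof (induction "Polynomial.degree q" arbitrary: q rule: less_induct)
  case less
  note cl = polys_over_closed[OF A]
  note p0 = prime_setD[OF P]
  show ?case
  proof (cases "Polynomial.lead_coeff q \<in> P")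
    case False
    have "poly.coeff q i \<noteq> 0" using less.prems(2) p0(1) by metis
    then have "i \<le> Polynomial.degree q" by (rule le_degree)
    moreover have "q - q \<in> polys_over P" using p0(1) by (simp add: polys_over_def)
    ultimately show ?thesis by (intro bexI[OF _ less.prems(1)] conjI order.refl False)
  next
    case True
    define q' where "q' = q - monom (Polynomial.lead_coeff q) (Polynomial.degree q)"
    have q': "q' \<in> polys_over A"
      unfolding q'_def using less.prems by (intro cl) (auto simp: polys_over_def)
    have i: "i \<noteq> Polynomial.degree q" using True less.prems(2) by metis
    then have ci: "poly.coeff q' i \<notin> P" using less.prems(2) by (simp add: q'_def)
    have le: "Polynomial.degree q' \<le> Polynomial.degree q"
      unfolding q'_def by (intro degree_diff_le) (auto simp: degree_monom_le)
    have "poly.coeff q' (Polynomial.degree q) = 0" by (simp add: q'_def)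
    moreover have "q' \<noteq> 0" using ci p0(1) by auto
    ultimately have "Polynomial.degree q' < Polynomial.degree q"
      using le eq_zero_or_degree_less[of q'] by blast
    from less.hyps[OF this q' ci] obtain r where r: "r \<in> polys_over A" "Polynomial.lead_coeff r \<notin> P"
      "Polynomial.degree r \<le> Polynomial.degree q'" "i \<le> Polynomial.degree r" "q' - r \<in> polys_over P" by (elim bexE conjE)
    have "poly.coeff (q - r) i \<in> P" for i
    proof -
      have eq: "poly.coeff (q - r) i =
          poly.coeff (q' - r) i + poly.coeff (monom (Polynomial.lead_coeff q) (Polynomial.degree q)) i"
        by (simp add: q'_def)
      have "poly.coeff (q' - r) i \<in> P" using r(5) unfolding polys_over_def by blast
      moreover have "poly.coeff (monom (Polynomial.lead_coeff q) (Polynomial.degree q)) i \<in> P"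
        unfolding coeff_monom using True p0(1) by presburger
      ultimately show ?thesis unfolding eq by (rule p0(3))
    qed
    then have qr: "q - r \<in> polys_over P" by (simp add: polys_over_def)
    have dr: "Polynomial.degree r \<le> Polynomial.degree q" using r(3) le by (rule order.trans)
    show ?thesis
    proof (rule bexI)
      show "Polynomial.lead_coeff r \<notin> P \<and> Polynomial.degree r \<le> Polynomial.degree q \<and>
          i \<le> Polynomial.degree r \<and> q - r \<in> polys_over P"
        by (rule conjI[OF r(2) conjI[OF dr conjI[OF r(4) qr]]])
      show "r \<in> polys_over A" by (rule r(1))
    qed
  qed
qed

text \<open>If \<open>u\<close> satisfies no equation over \<open>A\<close> modulo \<open>P\<close>, then every value of \<open>u\<close> is possible, and all but
  finitely many of them keep \<open>f\<close> away from zero. Otherwise take an equation \<open>m\<close> of least degree: every root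
  of the image of \<open>m\<close> is a possible value as soon as the leading coefficient of \<open>m\<close> is not sent to zero.
  Characteristic zero makes \<open>m\<close> separable, which gives distinct roots if the degree is at least two; degree
  one means that \<open>u\<close> is a quotient of elements of \<open>A\<close>, the case excluded for the second conclusion.\<close>
lemma extend_specialisation:
  fixes A P :: "'r::comm_ring_1 set" and f u :: 'r
  assumes A: "subring_set A" and P: "prime_set P" and char0: "\<forall>n>0. of_nat n \<notin> P"
    and f: "f \<in> adjoin A u" "f \<notin> P"
  shows "\<exists>d\<in>A. d \<notin> P \<and>
    (\<forall>\<phi> :: 'r \<Rightarrow> 'c::{alg_closed_field,field_char_0}. specialisation A P \<phi> \<longrightarrow> \<phi> d \<noteq> 0 \<longrightarrow>
      (\<exists>\<psi>. specialisation (adjoin A u) P \<psi> \<and> (\<forall>a\<in>A. \<psi> a = \<phi> a) \<and> \<psi> f \<noteq> 0) \<and>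
      ((\<forall>q\<in>A. \<forall>b\<in>A. q \<notin> P \<longrightarrow> q * u - b \<notin> P) \<longrightarrow>
        (\<exists>\<psi> \<psi>'. specialisation (adjoin A u) P \<psi> \<and> (\<forall>a\<in>A. \<psi> a = \<phi> a) \<and> \<psi> f \<noteq> 0 \<and>
          specialisation (adjoin A u) P \<psi>' \<and> (\<forall>a\<in>A. \<psi>' a = \<phi> a) \<and> \<psi>' f \<noteq> 0 \<and> \<psi> u \<noteq> \<psi>' u)))"
proof -
  note cl = polys_over_closed[OF A] and s = subring_setD[OF A] and p = prime_setD[OF P]
  have coeffA: "poly.coeff q i \<in> A" if "q \<in> polys_over A" for q i using that by (auto simp: polys_over_def)
  have evP: "poly q u \<in> P" if "q \<in> polys_over P" for q
    using that unfolding polys_over_def poly_altdef by (auto intro!: prime_set_sum[OF P] simp: p)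
  have zero: "map_poly \<phi> q = 0" if "specialisation A P \<phi>" "q \<in> polys_over A" "q \<in> polys_over P"
    for \<phi> :: "'r \<Rightarrow> 'c" and q
    using that(2,3) by (auto intro!: poly_eqI simp: coeff_map_poly specialisationD[OF that(1) A] polys_over_def)
  obtain fq where fq: "fq \<in> polys_over A" "f = poly fq u" using f by (auto simp: adjoin_def)
  define Rel where "Rel m \<longleftrightarrow> m \<in> polys_over A \<and> poly m u \<in> P \<and> Polynomial.lead_coeff m \<notin> P" for m
  have strip: "\<exists>r. Rel r \<and> Polynomial.degree r \<le> Polynomial.degree q"
    if q: "q \<in> polys_over A" "poly q u \<in> P" "q \<notin> polys_over P" for q
  proof -
    obtain i where "poly.coeff q i \<notin> P" using q by (auto simp: polys_over_def)
    from truncate_modulo_prime[OF A P q(1) this] obtain r where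
      r: "r \<in> polys_over A" "Polynomial.lead_coeff r \<notin> P" "Polynomial.degree r \<le> Polynomial.degree q"
        "q - r \<in> polys_over P" by blast
    have "poly r u = poly q u - poly (q - r) u" by simp
    then have "poly r u \<in> P" using evP[OF r(4)] q(2) p(6) by presburger
    then show ?thesis using r by (auto simp: Rel_def)
  qed
  show ?thesis
  proof (cases "\<exists>m. Rel m")
    case False
    then have all: "q \<in> polys_over P" if "q \<in> polys_over A" "poly q u \<in> P" for q using strip that by blast
    from f(2) fq evP have "fq \<notin> polys_over P" by blast
    then obtain k where k: "poly.coeff fq k \<notin> P" by (auto simp: polys_over_def)
    show ?thesis
    proof (intro bexI[of _ "poly.coeff fq k"] conjI allI impI)
      fix \<phi> :: "'r \<Rightarrow> 'c" assume sp: "specialisation A P \<phi>" and nz: "\<phi> (poly.coeff fq k) \<noteq> 0"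
      have "map_poly \<phi> fq \<noteq> 0"
        using nz by (metis coeff_0 coeff_map_poly specialisationD(2)[OF sp A])
      then have fin: "finite {c. poly (map_poly \<phi> fq) c = 0}" by (rule poly_roots_finite)
      have ex: "\<exists>\<psi>. specialisation (adjoin A u) P \<psi> \<and> (\<forall>a\<in>A. \<psi> a = \<phi> a) \<and> \<psi> f \<noteq> 0 \<and> \<psi> u = c"
        if "poly (map_poly \<phi> fq) c \<noteq> 0" for c
        using extend_specialisation_to_value[OF sp A _ P, of u c] zero[OF sp] all that fq
        by (metis poly_0)
      obtain c where c: "poly (map_poly \<phi> fq) c \<noteq> 0"
        using ex_new_if_finite[OF infinite_UNIV_char_0 fin] by auto
      obtain c' where c': "poly (map_poly \<phi> fq) c' \<noteq> 0" "c' \<noteq> c"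
        using ex_new_if_finite[OF infinite_UNIV_char_0, of "insert c {c. poly (map_poly \<phi> fq) c = 0}"] fin
        by auto
      show "\<exists>\<psi>. specialisation (adjoin A u) P \<psi> \<and> (\<forall>a\<in>A. \<psi> a = \<phi> a) \<and> \<psi> f \<noteq> 0" using ex[OF c] by blast
      show "\<exists>\<psi> \<psi>'. specialisation (adjoin A u) P \<psi> \<and> (\<forall>a\<in>A. \<psi> a = \<phi> a) \<and> \<psi> f \<noteq> 0 \<and>
          specialisation (adjoin A u) P \<psi>' \<and> (\<forall>a\<in>A. \<psi>' a = \<phi> a) \<and> \<psi>' f \<noteq> 0 \<and> \<psi> u \<noteq> \<psi>' u"
        using ex[OF c] ex[OF c'(1)] c'(2) by metis
    qed (use k fq coeffA in auto)
  next
    case True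
    \<comment> \<open>Here \<open>u\<close> is algebraic, and \<open>m\<close> is its minimal equation over the fraction field, without denominators.\<close>
    define n where "n = (LEAST n. \<exists>m. Rel m \<and> Polynomial.degree m = n)"
    obtain m where m: "Rel m" "Polynomial.degree m = n"
      using LeastI_ex[of "\<lambda>n. \<exists>m. Rel m \<and> Polynomial.degree m = n"] True unfolding n_def by blast
    have least: "n \<le> Polynomial.degree q" if "Rel q" for q
      unfolding n_def using that by (intro Least_le) blast
    have small: "q \<in> polys_over P" if "q \<in> polys_over A" "poly q u \<in> P" "Polynomial.degree q < n" for q
      using strip[OF that(1,2)] least that(3) by fastforce
    define l where "l = Polynomial.lead_coeff m"
    have mA: "m \<in> polys_over A" and mu: "poly m u \<in> P" and lP: "l \<notin> P" and lA: "l \<in> A"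
      using m by (auto simp: Rel_def l_def polys_over_def)
    have n0: "n > 0"
    proof (rule ccontr)
      assume "\<not> n > 0"
      then obtain a where "m = [:a:]" using m(2) degree_eq_zeroE by blast
      then show False using mu lP by (simp add: l_def)
    qed
    \<comment> \<open>The first factor controls \<open>f\<close>; the second one makes the roots of the image of \<open>m\<close> simple.\<close>
    define F where "F = fq * formal_deriv m"
    have FA: "F \<in> polys_over A" unfolding F_def using fq mA by (auto intro: cl)
    have "poly (formal_deriv m) u \<notin> P"
    proof
      assume *: "poly (formal_deriv m) u \<in> P"
      have "Polynomial.degree (formal_deriv m) \<le> n - 1"
        by (rule degree_le) (auto simp: coeff_formal_deriv coeff_eq_0 m(2))
      then have "formal_deriv m \<in> polys_over P" using small[OF _ *] n0 cl mA by fastforce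
      then have "of_nat n * l \<in> P" using n0 coeff_formal_deriv[of m "n - 1"]
        by (auto simp: polys_over_def l_def m(2) dest: spec[of _ "n - 1"] simp del: of_nat_Suc)
      then show False using char0 n0 lP p(4) by blast
    qed
    then have FP: "poly F u \<notin> P" using f fq p by (auto simp: F_def)
    \<comment> \<open>A Bezout relation modulo \<open>P\<close>. The ideal \<open>J\<close> of the polynomials whose value at \<open>u\<close> is a multiple of \<open>F(u)\<close>
      contains \<open>m\<close> and \<open>F\<close>, so an element \<open>q\<close> of least degree divides both up to factors outside \<open>P\<close>. If \<open>q\<close> were not
      constant, then \<open>q(u)\<close>, and with it \<open>F(u)\<close>, would lie in \<open>P\<close> by the minimality of \<open>m\<close>.\<close>
    obtain d s where ds: "d \<in> A" "d \<notin> P" "s \<in> polys_over A" "d - poly s u * poly F u \<in> P"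
    proof -
      define J where "J q \<longleftrightarrow> q \<in> polys_over A \<and> (\<exists>s\<in>polys_over A. poly q u - poly s u * poly F u \<in> P)" for q
      define J' where "J' q \<longleftrightarrow> J q \<and> Polynomial.lead_coeff q \<notin> P" for q
      have Jm: "J' m" unfolding J'_def J_def using mA mu lP cl by (auto simp: l_def intro!: bexI[of _ 0])
      define k where "k = (LEAST n. \<exists>q. J' q \<and> Polynomial.degree q = n)"
      obtain q where q: "J' q" "Polynomial.degree q = k"
        using LeastI_ex[of "\<lambda>n. \<exists>q. J' q \<and> Polynomial.degree q = n"] Jm unfolding k_def by blast
      have leastJ: "k \<le> Polynomial.degree q" if "J' q" for q
        unfolding k_def using that by (intro Least_le) blast
      have smallJ: "r \<in> polys_over P" if r: "J r" "Polynomial.degree r < k" for r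
      proof (rule ccontr)
        assume "r \<notin> polys_over P"
        then obtain i where i: "poly.coeff r i \<notin> P" by (auto simp: polys_over_def)
        from r obtain s where rs: "r \<in> polys_over A" "s \<in> polys_over A" "poly r u - poly s u * poly F u \<in> P"
          by (auto simp: J_def)
        from truncate_modulo_prime[OF A P rs(1) i] obtain r' where
          r': "r' \<in> polys_over A" "Polynomial.lead_coeff r' \<notin> P" "Polynomial.degree r' \<le> Polynomial.degree r"
            "r - r' \<in> polys_over P" by blast
        have "poly r' u - poly s u * poly F u = (poly r u - poly s u * poly F u) - poly (r - r') u" by simp
        then have "J r'" unfolding J_def using r' rs evP[OF r'(4)] p(6) by (metis (no_types, lifting))
        then show False using leastJ[of r'] r' r by (simp add: J'_def)
      qed
      obtain t where t: "q \<in> polys_over A" "t \<in> polys_over A" "poly q u - poly t u * poly F u \<in> P"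
        "Polynomial.lead_coeff q \<notin> P" using q by (auto simp: J'_def J_def)
      show thesis
      proof (cases "k = 0")
        case True
        then obtain d where "q = [:d:]" using q(2) degree_eq_zeroE by blast
        then show thesis using that[of d t] t coeffA[of q 0] by auto
      next
        case False
        have dq: "Polynomial.degree q > 0" using False q by simp
        have lqA: "Polynomial.lead_coeff q \<in> A" using t coeffA by auto
        have J_div: "J r" if Jh: "J h" and sr: "s \<in> polys_over A" "r \<in> polys_over A"
          and eq: "smult (Polynomial.lead_coeff q ^ e) h = q * s + r" for h e s r
        proof -
          obtain w where w: "w \<in> polys_over A" "poly h u - poly w u * poly F u \<in> P" using Jh unfolding J_def by blast
          have ru: "poly r u = Polynomial.lead_coeff q ^ e * poly h u - poly q u * poly s u"
            using arg_cong[OF eq, of "\<lambda>x. poly x u"] by simp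
          have "poly r u - poly (smult (Polynomial.lead_coeff q ^ e) w - t * s) u * poly F u =
            Polynomial.lead_coeff q ^ e * (poly h u - poly w u * poly F u) - (poly q u - poly t u * poly F u) * poly s u"
            unfolding ru by (simp add: algebra_simps)
          also have "\<dots> \<in> P" using w t p by auto
          finally show ?thesis unfolding J_def using sr w t lqA
            by (intro conjI bexI[of _ "smult (Polynomial.lead_coeff q ^ e) w - t * s"]) (auto intro!: cl s)
        qed
        obtain e s r where div: "s \<in> polys_over A" "r \<in> polys_over A" "Polynomial.degree r < Polynomial.degree q"
          "smult (Polynomial.lead_coeff q ^ e) m = q * s + r"
          using pseudo_division[OF A t(1) dq mA] by blast
        have rP: "r \<in> polys_over P" using smallJ[of r] J_div[OF _ div(1,2,4)] Jm div q by (auto simp: J'_def)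
        have lqe: "Polynomial.lead_coeff q ^ i \<notin> P" for i using t prime_set_power[OF P] by blast
        have qs: "poly q u * poly s u \<in> P"
        proof -
          have "poly q u * poly s u = Polynomial.lead_coeff q ^ e * poly m u - poly r u"
            using arg_cong[OF div(4), of "\<lambda>x. poly x u"] by simp
          then show ?thesis using mu evP[OF rP] p by auto
        qed
        have "poly s u \<notin> P"
        proof
          assume su: "poly s u \<in> P"
          have coq: "Polynomial.lead_coeff q ^ e * poly.coeff m i - poly.coeff (q * s) i \<in> P" for i
            using arg_cong[OF div(4), of "\<lambda>x. poly.coeff x i"] rP by (simp add: polys_over_def)
          have "s \<notin> polys_over P"
          proof
            assume "s \<in> polys_over P"
            then have "poly.coeff (q * s) n \<in> P"
              unfolding coeff_mult by (intro prime_set_sum[OF P]) (auto simp: polys_over_def p)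
            then have "Polynomial.lead_coeff q ^ e * l \<in> P"
              using coq[of n] p(3)[of "Polynomial.lead_coeff q ^ e * l - poly.coeff (q * s) n" "poly.coeff (q * s) n"]
              by (simp add: l_def m)
            then show False using lqe lP p by auto
          qed
          then obtain i where i: "poly.coeff s i \<notin> P" by (auto simp: polys_over_def)
          from truncate_modulo_prime[OF A P div(1) i] obtain s' where
            s': "s' \<in> polys_over A" "Polynomial.lead_coeff s' \<notin> P" "s - s' \<in> polys_over P" by blast
          have "poly s' u = poly s u - poly (s - s') u" by simp
          then have "poly s' u \<in> P" using su evP[OF s'(3)] p(6) by presburger
          then have "Rel s'" using s' by (simp add: Rel_def)
          then have ge: "Polynomial.degree s' \<ge> n" by (rule least)
          let ?N = "Polynomial.degree q + Polynomial.degree s'"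
          have "poly.coeff m ?N = 0" using ge dq m by (simp add: coeff_eq_0)
          then have "poly.coeff (q * s) ?N \<in> P" using coq[of ?N] p(5) by simp
          moreover have "poly.coeff (q * (s - s')) ?N \<in> P"
            unfolding coeff_mult[of q] using s'(3) by (intro prime_set_sum[OF P]) (auto simp: polys_over_def p)
          ultimately have "poly.coeff (q * s) ?N - poly.coeff (q * (s - s')) ?N \<in> P" by (rule p)
          then have "poly.coeff (q * s') ?N \<in> P" by (simp add: algebra_simps)
          then have "Polynomial.lead_coeff q * Polynomial.lead_coeff s' \<in> P" by (simp add: coeff_mult_degree_sum)
          then show False using t s' p by auto
        qed
        then have qu: "poly q u \<in> P" using qs p by auto
        have JF: "J F" unfolding J_def using FA cl p by (auto intro!: bexI[of _ 1])
        obtain e s r where div: "s \<in> polys_over A" "r \<in> polys_over A" "Polynomial.degree r < Polynomial.degree q"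
          "smult (Polynomial.lead_coeff q ^ e) F = q * s + r"
          using pseudo_division[OF A t(1) dq FA] by blast
        have rP: "r \<in> polys_over P" using smallJ[of r] J_div[OF JF div(1,2,4)] div q by auto
        have "Polynomial.lead_coeff q ^ e * poly F u = poly q u * poly s u + poly r u"
          using arg_cong[OF div(4), of "\<lambda>x. poly x u"] by simp
        then have "Polynomial.lead_coeff q ^ e * poly F u \<in> P" using qu evP[OF rP] p by auto
        then show thesis using FP lqe p by auto
      qed
    qed
    show ?thesis
    proof (intro bexI[of _ "l * d"] conjI allI impI)
      fix \<phi> :: "'r \<Rightarrow> 'c" assume sp: "specialisation A P \<phi>" and nz: "\<phi> (l * d) \<noteq> 0"
      note sd = specialisationD[OF sp A] and mp = map_poly_specialisation[OF sp A]
      have nz': "\<phi> l \<noteq> 0" "\<phi> d \<noteq> 0" using nz lA ds sd by auto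
      have ex: "\<exists>\<psi>. specialisation (adjoin A u) P \<psi> \<and> (\<forall>a\<in>A. \<psi> a = \<phi> a) \<and> \<psi> f \<noteq> 0 \<and> \<psi> u = c \<and>
          poly (pderiv (map_poly \<phi> m)) c \<noteq> 0"
        if c: "poly (map_poly \<phi> m) c = 0" for c
      proof -
        have "poly (map_poly \<phi> q) c = 0" if q: "q \<in> polys_over A" "poly q u \<in> P" for q
        proof -
          obtain e s r where div: "s \<in> polys_over A" "r \<in> polys_over A" "Polynomial.degree r < Polynomial.degree m"
            "smult (l ^ e) q = m * s + r"
            using pseudo_division[OF A mA _ q(1)] n0 m(2) unfolding l_def by auto
          have "poly r u = l ^ e * poly q u - poly m u * poly s u"
            using arg_cong[OF div(4), of "\<lambda>x. poly x u"] by simp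
          then have "poly r u \<in> P" using q mu p by auto
          then have "map_poly \<phi> r = 0" using zero[OF sp div(2)] small[OF div(2)] div m by auto
          moreover have "map_poly \<phi> ([:l ^ e:] * q) = map_poly \<phi> (m * s + r)" using div(4) by simp
          then have "map_poly \<phi> [:l ^ e:] * map_poly \<phi> q = map_poly \<phi> m * map_poly \<phi> s + map_poly \<phi> r"
            using div q lA mA by (simp only: mp cl s)
          moreover have ev: "poly (map_poly \<phi> [:l ^ e:]) c = \<phi> (l ^ e)" by (simp add: map_poly_pCons sd)
          ultimately have "\<phi> (l ^ e) * poly (map_poly \<phi> q) c = 0"
            using c arg_cong[of _ _ "\<lambda>x. poly x c"] by (metis (no_types, lifting) add.right_neutral mult_eq_0_iff poly_0 poly_mult ev)
          then show ?thesis using nz' lA sd by auto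
        qed
        from extend_specialisation_to_value[OF sp A this P] obtain \<psi> where
          \<psi>: "specialisation (adjoin A u) P \<psi>" "\<And>q. q \<in> polys_over A \<Longrightarrow> \<psi> (poly q u) = poly (map_poly \<phi> q) c"
            "\<forall>a\<in>A. \<psi> a = \<phi> a" "\<psi> u = c" by blast
        note sd' = specialisationD[OF \<psi>(1) subring_set_adjoin(1)[OF A]]
        have inA: "d \<in> adjoin A u" "poly s u \<in> adjoin A u" "poly F u \<in> adjoin A u"
          using ds FA subring_set_adjoin(2)[OF A, of u] by (auto simp: adjoin_def)
        note sA' = subring_setD[OF subring_set_adjoin(1)[OF A]]
        have "\<psi> (d - poly s u * poly F u) = 0" using sd'(5) ds(4) inA sA' by auto
        then have "\<psi> d = \<psi> (poly s u) * \<psi> (poly F u)" using inA sA' by (simp add: sd')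
        then have "\<psi> (poly F u) \<noteq> 0" using nz' \<psi>(3) ds(1) by auto
        then have "poly (map_poly \<phi> fq) c \<noteq> 0" "poly (pderiv (map_poly \<phi> m)) c \<noteq> 0"
          using \<psi>(2)[OF FA] fq mA cl by (auto simp: F_def mp)
        then show ?thesis using \<psi> fq by auto
      qed
      have dm: "Polynomial.degree (map_poly \<phi> m) = n"
        using nz' by (metis l_def m(2) map_poly_degree_eq)
      obtain c where c: "poly (map_poly \<phi> m) c = 0"
        using alg_closed_imp_poly_has_root[of "map_poly \<phi> m"] dm n0 by auto
      show "\<exists>\<psi>. specialisation (adjoin A u) P \<psi> \<and> (\<forall>a\<in>A. \<psi> a = \<phi> a) \<and> \<psi> f \<noteq> 0" using ex[OF c] by blast
      assume indep: "\<forall>q\<in>A. \<forall>b\<in>A. q \<notin> P \<longrightarrow> q * u - b \<notin> P"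
      have "n \<noteq> 1"
      proof
        assume "n = 1"
        then obtain b l' where ml: "m = [:b, l':]" using m(2) by (metis One_nat_def degree_eq_zeroE degree_pCons_eq_if nat.inject pCons_cases zero_neq_one)
        then have "l' = l" using \<open>n = 1\<close> m(2) by (auto simp: l_def split: if_splits)
        then have "l * u - (- b) \<in> P" using mu ml by (simp add: algebra_simps)
        moreover have "- b \<in> A" using coeffA[OF mA, of 0] ml s by auto
        ultimately show False using indep lA lP by blast
      qed
      obtain g where g: "map_poly \<phi> m = [:- c, 1:] * g" using c by (metis dvdE poly_eq_0_iff_dvd)
      have "g \<noteq> 0" using g dm n0 by auto
      then have "Polynomial.degree (map_poly \<phi> m) = 1 + Polynomial.degree g" unfolding g by (subst degree_mult_eq) auto
      then have "Polynomial.degree g > 0" using dm \<open>n \<noteq> 1\<close> n0 by simp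
      then obtain c' where c': "poly g c' = 0" using alg_closed_imp_poly_has_root by auto
      have root': "poly (map_poly \<phi> m) c' = 0" using c' g by simp
      have "c' \<noteq> c"
      proof
        assume "c' = c"
        then have "poly (pderiv (map_poly \<phi> m)) c = 0" unfolding g pderiv_mult using c' by (simp add: pderiv_pCons)
        then show False using ex[OF c] by auto
      qed
      then show "\<exists>\<psi> \<psi>'. specialisation (adjoin A u) P \<psi> \<and> (\<forall>a\<in>A. \<psi> a = \<phi> a) \<and> \<psi> f \<noteq> 0 \<and>
          specialisation (adjoin A u) P \<psi>' \<and> (\<forall>a\<in>A. \<psi>' a = \<phi> a) \<and> \<psi>' f \<noteq> 0 \<and> \<psi> u \<noteq> \<psi>' u"
        using ex[OF c] ex[OF root'] by metis
    qed (use lA lP ds s p in auto)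
  qed
qed

section \<open>Functions determined by the values of other functions\<close>

fun adjoin_list :: "'r::comm_ring_1 set \<Rightarrow> 'r list \<Rightarrow> 'r set" where
  "adjoin_list A [] = A"
| "adjoin_list A (u # us) = adjoin_list (adjoin A u) us"

lemma adjoin_mono: "A \<subseteq> B \<Longrightarrow> adjoin A u \<subseteq> adjoin B u"
  by (auto simp: adjoin_def polys_over_def)

lemma adjoin_list_mono: "A \<subseteq> B \<Longrightarrow> adjoin_list A us \<subseteq> adjoin_list B us"
  by (induction us arbitrary: A B) (auto dest: adjoin_mono)

lemma adjoin_list_props:
  assumes "subring_set A"
  shows "subring_set (adjoin_list A us)" "A \<subseteq> adjoin_list A us" "set us \<subseteq> adjoin_list A us"
proof -
  have "subring_set (adjoin_list A us) \<and> A \<subseteq> adjoin_list A us \<and> set us \<subseteq> adjoin_list A us"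
    using assms
  proof (induction us arbitrary: A)
    case (Cons u us)
    then show ?case using Cons.IH[of "adjoin A u"] subring_set_adjoin[OF Cons.prems, of u] by auto
  qed simp
  then show "subring_set (adjoin_list A us)" "A \<subseteq> adjoin_list A us" "set us \<subseteq> adjoin_list A us" by auto
qed

lemma adjoin_least:
  assumes "subring_set D" "A \<subseteq> D" "u \<in> D"
  shows "adjoin A u \<subseteq> D"
proof
  fix x assume "x \<in> adjoin A u"
  then obtain p where p: "p \<in> polys_over A" "x = poly p u" by (auto simp: adjoin_def)
  show "x \<in> D" unfolding p(2) poly_altdef
    by (intro subring_set_sum[OF assms(1)] subring_setD(4,7)[OF assms(1)])
       (use p assms in \<open>auto simp: polys_over_def\<close>)
qed

lemma adjoin_list_least:
  assumes "subring_set D" "A \<subseteq> D" "set us \<subseteq> D"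
  shows "adjoin_list A us \<subseteq> D"
  using assms(2,3) by (induction us arbitrary: A) (auto simp: adjoin_least[OF assms(1)])

lemma specialisation_mono:
  "specialisation A P \<phi> \<Longrightarrow> A' \<subseteq> A \<Longrightarrow> P' \<subseteq> P \<Longrightarrow> specialisation A' P' \<phi>"
  by (auto simp: specialisation_def subset_iff)

lemma extend_specialisation_list:
  fixes A P :: "'r::comm_ring_1 set"
  assumes A: "subring_set A" and P: "prime_set P" and char0: "\<forall>n>0. of_nat n \<notin> P"
    and f: "f \<in> adjoin_list A us" "f \<notin> P"
  shows "\<exists>d\<in>A. d \<notin> P \<and> (\<forall>\<phi> :: 'r \<Rightarrow> 'c::{alg_closed_field,field_char_0}.
    specialisation A P \<phi> \<longrightarrow> \<phi> d \<noteq> 0 \<longrightarrow>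
      (\<exists>\<psi>. specialisation (adjoin_list A us) P \<psi> \<and> (\<forall>a\<in>A. \<psi> a = \<phi> a) \<and> \<psi> f \<noteq> 0))"
  using A f
proof (induction us arbitrary: A)
  case Nil
  then show ?case by auto
next
  case (Cons u us)
  note ad = subring_set_adjoin[OF Cons.prems(1), of u]
  obtain d where d: "d \<in> adjoin A u" "d \<notin> P" and ext: "\<And>\<phi> :: 'r \<Rightarrow> 'c. specialisation (adjoin A u) P \<phi> \<Longrightarrow> \<phi> d \<noteq> 0 \<Longrightarrow>
      (\<exists>\<psi>. specialisation (adjoin_list (adjoin A u) us) P \<psi> \<and> (\<forall>a\<in>adjoin A u. \<psi> a = \<phi> a) \<and> \<psi> f \<noteq> 0)"
    using Cons.IH[OF ad(1)] Cons.prems by auto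
  obtain c where c: "c \<in> A" "c \<notin> P" and ext': "\<And>\<phi> :: 'r \<Rightarrow> 'c. specialisation A P \<phi> \<Longrightarrow> \<phi> c \<noteq> 0 \<Longrightarrow>
      (\<exists>\<psi>. specialisation (adjoin A u) P \<psi> \<and> (\<forall>a\<in>A. \<psi> a = \<phi> a) \<and> \<psi> d \<noteq> 0)"
    using extend_specialisation[OF Cons.prems(1) P char0 d, where ?'c = 'c] by blast
  show ?case
  proof (intro bexI[OF _ c(1)] conjI allI impI c(2))
    fix \<phi> :: "'r \<Rightarrow> 'c" assume "specialisation A P \<phi>" "\<phi> c \<noteq> 0"
    then obtain \<psi> where 1: "specialisation (adjoin A u) P \<psi>" "\<forall>a\<in>A. \<psi> a = \<phi> a" "\<psi> d \<noteq> 0" using ext' by blast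
    then obtain \<psi>' where 2: "specialisation (adjoin_list (adjoin A u) us) P \<psi>'" "\<forall>a\<in>adjoin A u. \<psi>' a = \<psi> a" "\<psi>' f \<noteq> 0"
      using ext by blast
    then show "\<exists>\<psi>. specialisation (adjoin_list A (u # us)) P \<psi> \<and> (\<forall>a\<in>A. \<psi> a = \<phi> a) \<and> \<psi> f \<noteq> 0"
      using 1 ad(2) by (intro exI[of _ \<psi>']) auto
  qed
qed

definition radical_ideal :: "'r::comm_ring_1 set \<Rightarrow> bool"
  where "radical_ideal Z \<longleftrightarrow> 0 \<in> Z \<and> (\<forall>a\<in>Z. \<forall>b\<in>Z. a + b \<in> Z) \<and> (\<forall>a\<in>Z. \<forall>r. r * a \<in> Z) \<and>
    (\<forall>a. a * a \<in> Z \<longrightarrow> a \<in> Z)"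

definition mult_subset :: "'r::comm_ring_1 set \<Rightarrow> 'r set \<Rightarrow> 'r set \<Rightarrow> bool"
  where "mult_subset D Z S \<longleftrightarrow> 1 \<in> S \<and> S \<subseteq> D \<and> (\<forall>s\<in>S. \<forall>t\<in>S. s * t \<in> S) \<and> S \<inter> Z = {}"

lemma radical_ideal_power:
  assumes Z: "radical_ideal Z" and "a ^ n \<in> Z" "n > 0"
  shows "a \<in> Z"
  using assms(2,3)
proof (induction n rule: less_induct)
  case (less n)
  show ?case
  proof (cases "n = 1")
    case False
    define k where "k = (n + 1) div 2"
    have k: "k < n" "k > 0" "2 * k \<ge> n" using False less.prems unfolding k_def by auto
    have "a ^ k * a ^ k = a ^ (2 * k - n) * a ^ n"
      using k by (simp add: mult_2 flip: power_add)
    then have "a ^ k \<in> Z" using Z less.prems(1) unfolding radical_ideal_def by metis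
    then show ?thesis using less.IH k by blast
  qed (use less in auto)
qed

lemma mult_subset_adjoin_powers:
  assumes S: "mult_subset D Z S" and D: "subring_set D" and Z: "radical_ideal Z"
    and b: "b \<in> D" and no: "\<And>s. s \<in> S \<Longrightarrow> s * b \<notin> Z"
  shows "mult_subset D Z {s * b ^ i | s i. s \<in> S}"
    and "S \<subseteq> {s * b ^ i | s i. s \<in> S}" and "b \<in> {s * b ^ i | s i. s \<in> S}"
proof -
  let ?X = "{s * b ^ i | s i. s \<in> S}"
  note Sd = S[unfolded mult_subset_def]
  show sub: "S \<subseteq> ?X" by (force intro: exI[of _ "0::nat"])
  show "b \<in> ?X" using Sd by (intro CollectI exI[of _ 1]) auto
  have nZ: "s * b ^ i \<notin> Z" if s: "s \<in> S" for s i
  proof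
    assume a: "s * b ^ i \<in> Z"
    show False
    proof (cases "i = 0")
      case True
      then show False using a s Sd by auto
    next
      case False
      have "(s * b) ^ i = s ^ (i - 1) * (s * b ^ i)"
        using False by (cases i) (auto simp: power_mult_distrib algebra_simps)
      then have "(s * b) ^ i \<in> Z" using a Z unfolding radical_ideal_def by metis
      then show False using radical_ideal_power[OF Z] False no s by auto
    qed
  qed
  show "mult_subset D Z ?X"
    unfolding mult_subset_def
  proof (intro conjI ballI)
    show "1 \<in> ?X" using sub Sd by blast
    show "?X \<subseteq> D" using Sd b by (auto intro!: subring_setD[OF D])
    show "?X \<inter> Z = {}" using nZ by auto
    fix x y assume "x \<in> ?X" "y \<in> ?X"
    then obtain s i t j where st: "s \<in> S" "t \<in> S" "x = s * b ^ i" "y = t * b ^ j" by blast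
    then have "x * y = (s * t) * b ^ (i + j)" by (simp add: power_add algebra_simps)
    moreover have "s * t \<in> S" using st Sd by auto
    ultimately show "x * y \<in> ?X" by blast
  qed
qed

text \<open>By Zorn's lemma. If \<open>S\<close> is maximal and \<open>b\<close> lies outside \<open>S\<close>, then adjoining the powers of \<open>b\<close> to \<open>S\<close> must
  produce an element of \<open>Z\<close>, and as \<open>Z\<close> is radical already \<open>s b\<close> lies in \<open>Z\<close> for some \<open>s\<close>. So the complement of
  \<open>S\<close> in \<open>D\<close> is a prime ideal of \<open>D\<close> that is minimal over \<open>Z \<inter> D\<close>.\<close>
lemma maximal_mult_subset:
  assumes S0: "mult_subset D Z S0" and D: "subring_set D" and Z: "radical_ideal Z"
  obtains S where "mult_subset D Z S" "S0 \<subseteq> S" "\<And>b. b \<in> D \<Longrightarrow> b \<notin> S \<Longrightarrow> \<exists>s\<in>S. s * b \<in> Z"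
proof -
  let ?F = "{S. mult_subset D Z S \<and> S0 \<subseteq> S}"
  have "\<exists>M\<in>?F. \<forall>M'\<in>?F. M \<subseteq> M' \<longrightarrow> M' = M"
  proof (rule subset_Zorn_nonempty)
    show "?F \<noteq> {}" using S0 by auto
    fix Ch assume ne: "Ch \<noteq> {}" and ch: "subset.chain ?F Ch"
    have el: "mult_subset D Z M'" "S0 \<subseteq> M'" if "M' \<in> Ch" for M' using ch that by (auto simp: subset.chain_def)
    have subset_chain_dest: "M1 \<subseteq> M2 \<or> M2 \<subseteq> M1" if "M1 \<in> Ch" "M2 \<in> Ch" for M1 M2
      using ch that unfolding subset.chain_def by blast
    have "s * t \<in> \<Union>Ch" if st: "s \<in> \<Union>Ch" "t \<in> \<Union>Ch" for s t
    proof -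
      obtain M' Y where XY: "M' \<in> Ch" "Y \<in> Ch" "s \<in> M'" "t \<in> Y" using st by blast
      then obtain W where "W \<in> Ch" "s \<in> W" "t \<in> W"
        using subset_chain_dest[OF XY(1,2)] by blast
      then show ?thesis using el unfolding mult_subset_def by blast
    qed
    moreover have "1 \<in> \<Union>Ch" "\<Union>Ch \<subseteq> D" "\<Union>Ch \<inter> Z = {}" "S0 \<subseteq> \<Union>Ch" using el ne unfolding mult_subset_def by blast+
    ultimately show "\<Union>Ch \<in> ?F" by (auto simp: mult_subset_def)
  qed
  then obtain S where SF: "S \<in> ?F" and maxF: "\<forall>M'\<in>?F. S \<subseteq> M' \<longrightarrow> M' = S" by (elim bexE)
  then have S: "mult_subset D Z S" "S0 \<subseteq> S" by simp_all
  have max: "M' = S" if "mult_subset D Z M'" "S \<subseteq> M'" for M'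
    using maxF that S(2) order.trans by auto
  note Sd = S(1)[unfolded mult_subset_def]
  have "\<exists>s\<in>S. s * b \<in> Z" if b: "b \<in> D" "b \<notin> S" for b
  proof (rule ccontr)
    assume no: "\<not> (\<exists>s\<in>S. s * b \<in> Z)"
    let ?X = "{s * b ^ i | s i. s \<in> S}"
    have no': "s * b \<notin> Z" if "s \<in> S" for s using no that by blast
    note X = mult_subset_adjoin_powers[OF S(1) D Z b(1) no']
    have "?X = S" using X(1,2) by (rule max)
    then show False using X(3) b(2) by blast
  qed
  then show ?thesis using that S by blast
qed

lemma exists_prime_avoiding:
  assumes Z: "radical_ideal Z" and S: "mult_subset UNIV Z S"
  obtains P where "prime_set P" "Z \<subseteq> P" "P \<inter> S = {}"
proof -
  have U: "subring_set (UNIV :: 'a set)" by (auto simp: subring_set_def)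
  obtain M where M: "mult_subset UNIV Z M" "S \<subseteq> M" "\<And>b. b \<notin> M \<Longrightarrow> \<exists>s\<in>M. s * b \<in> Z"
    using maximal_mult_subset[OF S U Z] by auto
  note Md = M(1)[unfolded mult_subset_def] and Zd = Z[unfolded radical_ideal_def]
  have iff: "b \<notin> M \<longleftrightarrow> (\<exists>s\<in>M. s * b \<in> Z)" for b using M(3) Md by blast
  have "prime_set (- M)"
    unfolding prime_set_def
  proof (intro conjI ballI allI)
    show "0 \<in> - M" "1 \<notin> - M" using Md Zd by auto
    fix a b assume "a \<in> - M" "b \<in> - M"
    then obtain s t where st: "s \<in> M" "t \<in> M" "s * a \<in> Z" "t * b \<in> Z" using M(3) by (metis ComplD)
    have eq: "(s * t) * (a + b) = t * (s * a) + s * (t * b)" by (simp add: algebra_simps)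
    have "t * (s * a) \<in> Z" "s * (t * b) \<in> Z" using st(3,4) Zd by blast+
    then have z: "(s * t) * (a + b) \<in> Z" unfolding eq using Zd by blast
    have "s * t \<in> M" using st(1,2) Md by blast
    with z show "a + b \<in> - M" unfolding Compl_iff iff by (rule bexI)
  next
    fix a b
    show "a * b \<in> - M \<longleftrightarrow> a \<in> - M \<or> b \<in> - M"
    proof
      show "a * b \<in> - M \<Longrightarrow> a \<in> - M \<or> b \<in> - M" using Md by blast
      assume "a \<in> - M \<or> b \<in> - M"
      then obtain s where s: "s \<in> M" "s * a \<in> Z \<or> s * b \<in> Z" using M(3) by blast
      have "s * (a * b) = b * (s * a)" "s * (a * b) = a * (s * b)" by (simp_all add: algebra_simps)
      then have "s * (a * b) \<in> Z" using s Zd by metis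
      then show "a * b \<in> - M" unfolding Compl_iff iff using s(1) by (rule bexI)
    qed
  qed
  then show ?thesis using that[of "- M"] M(2) Md by blast
qed

text \<open>In geometric terms, \<open>A\<close> and \<open>B\<close> are the rings of functions on a variety \<open>X\<close> and on its image \<open>Y\<close> under a
  morphism, \<open>Z\<close> consists of the functions that vanish, and \<open>a\<close> is constant on those fibres of \<open>X\<close> over \<open>Y\<close> on
  which \<open>\<pi>\<close> is not zero; then \<open>a\<close> is a rational function on a component of \<open>Y\<close>.

  The set \<open>S\<close> is a maximal multiplicative subset of \<open>B\<close> that avoids \<open>Z\<close> and contains the powers of \<open>\<pi>\<close>, so
  that all primes over \<open>Z\<close> avoiding \<open>S\<close> have the same intersection with \<open>B\<close>. Modulo one such prime, \<open>a\<close> is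
  a quotient of elements of \<open>B\<close>, because otherwise some point of \<open>Y\<close> would lift to two points of \<open>X\<close> at which
  \<open>a\<close> differs. The quotients obtained for two primes agree, because a general point of \<open>Y\<close> lifts to points on
  both components of \<open>X\<close>, and \<open>a\<close> has the same value at these. One quotient thus serves all primes
  over \<open>Z\<close> avoiding \<open>S\<close>. After multiplication by an element of \<open>S\<close> it serves \<open>Z\<close> itself, since otherwise some
  prime over \<open>Z\<close> would avoid \<open>S\<close> and the powers of \<open>Q a - b\<close>.\<close>
theorem separated_function_rational:
  fixes Z C0 :: "'r::comm_ring_1 set" and \<phi>0 :: "'r \<Rightarrow> 'c::{alg_closed_field,field_char_0}"
  assumes Z: "radical_ideal Z"
    and C0: "subring_set C0" "\<And>c. c \<in> C0 \<Longrightarrow> c \<noteq> 0 \<Longrightarrow> \<exists>c'\<in>C0. c * c' = 1"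
      "\<And>n. n > 0 \<Longrightarrow> of_nat n \<noteq> (0 :: 'r)"
    and \<phi>0: "specialisation C0 {0} \<phi>0"
    and B: "B = adjoin_list C0 us" and A: "A = adjoin_list B vs"
    and \<pi>: "\<pi> \<in> B" "\<And>i. \<pi> ^ i \<notin> Z"
  obtains S where "mult_subset B Z S"
    "\<And>a. a \<in> A \<Longrightarrow>
      (\<forall>\<psi> \<psi>' :: 'r \<Rightarrow> 'c. specialisation A Z \<psi> \<and> specialisation A Z \<psi>' \<and> (\<forall>c\<in>C0. \<psi> c = \<phi>0 c) \<and>
        (\<forall>b\<in>B. \<psi> b = \<psi>' b) \<and> \<psi> \<pi> \<noteq> 0 \<longrightarrow> \<psi> a = \<psi>' a) \<Longrightarrow>
      \<exists>Q\<in>S. \<exists>b\<in>B. Q * a - b \<in> Z"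
proof -
  note Bp = adjoin_list_props[OF C0(1), of us, folded B]
  note Ap = adjoin_list_props[OF Bp(1), of vs, folded A]
  note sB = subring_setD[OF Bp(1)] and sA = subring_setD[OF Ap(1)]
  have "mult_subset B Z (range ((^) \<pi>))"
    unfolding mult_subset_def
  proof (intro conjI ballI)
    show "1 \<in> range ((^) \<pi>)" by (rule range_eqI[of _ _ 0]) simp
    fix s t assume "s \<in> range ((^) \<pi>)" "t \<in> range ((^) \<pi>)"
    then obtain i j where "s = \<pi> ^ i" "t = \<pi> ^ j" by auto
    then show "s * t \<in> range ((^) \<pi>)" by (intro range_eqI[of _ _ "i + j"]) (simp add: power_add)
  qed (use \<pi> sB in auto)
  from maximal_mult_subset[OF this Bp(1) Z] obtain S where S: "mult_subset B Z S"
    and \<pi>S: "range ((^) \<pi>) \<subseteq> S" and max: "\<And>b. b \<in> B \<Longrightarrow> b \<notin> S \<Longrightarrow> \<exists>s\<in>S. s * b \<in> Z" by blast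
  have S1: "1 \<in> S" and SB: "\<And>s. s \<in> S \<Longrightarrow> s \<in> B" and Sm: "\<And>s t. s \<in> S \<Longrightarrow> t \<in> S \<Longrightarrow> s * t \<in> S"
    and SZ: "\<And>s. s \<in> S \<Longrightarrow> s \<notin> Z"
    using S unfolding mult_subset_def by blast+
  have piS: "\<pi> \<in> S" using \<pi>S by (metis power_one_right range_eqI subsetD)
  define primes where "primes = {P. prime_set P \<and> Z \<subseteq> P \<and> P \<inter> S = {}}"
  have BP: "b \<in> P \<longleftrightarrow> b \<notin> S" if P: "P \<in> primes" and b: "b \<in> B" for P b
  proof
    assume "b \<notin> S"
    then obtain s where "s \<in> S" "s * b \<in> P" using max[OF b] P by (auto simp: primes_def)
    then show "b \<in> P" using P prime_setD(4)[of P] by (auto simp: primes_def)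
  qed (use P in \<open>auto simp: primes_def\<close>)
  have primesD: "prime_set P" "Z \<subseteq> P" "P \<inter> S = {}" if "P \<in> primes" for P
    using that unfolding primes_def by blast+
  have C0P: "c = 0" if c: "c \<in> C0" "c \<in> P" and P: "P \<in> primes" for c P
  proof (rule ccontr)
    assume "c \<noteq> 0"
    then obtain c' where c': "c * c' = 1" using C0(2)[OF c(1)] by blast
    have "c * c' \<in> P" unfolding prime_setD(4)[OF primesD(1)[OF P]] using c(2) by blast
    then show False unfolding c' using prime_setD(2)[OF primesD(1)[OF P]] by blast
  qed
  have charP: "\<forall>n>0. of_nat n \<notin> P" if "P \<in> primes" for P
    using C0P[OF subring_setD(8)[OF C0(1)] _ that] C0(3) by blast
  have base: "\<exists>\<phi> :: 'r \<Rightarrow> 'c. specialisation B P \<phi> \<and> (\<forall>c\<in>C0. \<phi> c = \<phi>0 c) \<and> \<phi> f \<noteq> 0"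
    if f: "f \<in> S" and P: "P \<in> primes" for f P
  proof -
    note pP = primesD(1)[OF P]
    have fB: "f \<in> adjoin_list C0 us" "f \<notin> P" using f SB[OF f] B BP[OF P SB[OF f]] by auto
    obtain d where d: "d \<in> C0" "d \<notin> P" and ext: "\<And>\<phi> :: 'r \<Rightarrow> 'c. specialisation C0 P \<phi> \<Longrightarrow> \<phi> d \<noteq> 0 \<Longrightarrow>
      (\<exists>\<psi>. specialisation B P \<psi> \<and> (\<forall>a\<in>C0. \<psi> a = \<phi> a) \<and> \<psi> f \<noteq> 0)"
      using extend_specialisation_list[OF C0(1) pP charP[OF P] fB, where ?'c = 'c] B by blast
    have "d \<noteq> 0" using d prime_setD(1)[OF pP] by auto
    then obtain d' where d': "d' \<in> C0" "d * d' = 1" using C0(2) d by blast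
    have "\<phi>0 d * \<phi>0 d' = \<phi>0 1"
      using specialisationD(4)[OF \<phi>0 C0(1) d(1) d'(1)] unfolding d'(2) by (rule sym)
    then have "\<phi>0 d \<noteq> 0" using specialisationD(1)[OF \<phi>0 C0(1)] by (metis mult_zero_left zero_neq_one)
    moreover have "specialisation C0 P \<phi>0"
      using \<phi>0 C0P[OF _ _ P] by (auto simp: specialisation_def)
    ultimately show ?thesis using ext by blast
  qed
  show ?thesis
  proof (rule that[OF S])
    fix a assume aA: "a \<in> A" and
      sep': "\<forall>\<psi> \<psi>' :: 'r \<Rightarrow> 'c. specialisation A Z \<psi> \<and> specialisation A Z \<psi>' \<and> (\<forall>c\<in>C0. \<psi> c = \<phi>0 c) \<and>
        (\<forall>b\<in>B. \<psi> b = \<psi>' b) \<and> \<psi> \<pi> \<noteq> 0 \<longrightarrow> \<psi> a = \<psi>' a"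
    have sep: "\<psi> a = \<psi>' a" if "specialisation A Z \<psi>" "specialisation A Z \<psi>'" "\<And>c. c \<in> C0 \<Longrightarrow> \<psi> c = \<phi>0 c"
      "\<And>b. b \<in> B \<Longrightarrow> \<psi> b = \<psi>' b" "\<psi> \<pi> \<noteq> 0" for \<psi> \<psi>' :: "'r \<Rightarrow> 'c"
      using sep' that by blast
    \<comment> \<open>Two extensions to \<open>B[a]\<close> that differ at \<open>a\<close> are extended further to all of \<open>A\<close>; \<open>d1\<close> makes this possible.\<close>
    have one: "\<exists>Q\<in>S. \<exists>b\<in>B. Q * a - b \<in> P" if P: "P \<in> primes" for P
    proof (rule ccontr)
      assume no: "\<not> (\<exists>Q\<in>S. \<exists>b\<in>B. Q * a - b \<in> P)"
      note pP = primesD(1)[OF P] and ZP = primesD(2)[OF P]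
      let ?Ba = "adjoin B a"
      note Ba = subring_set_adjoin[OF Bp(1), of a]
      have sub: "A \<subseteq> adjoin_list ?Ba vs" unfolding A by (rule adjoin_list_mono) (rule Ba)
      have "1 \<in> adjoin_list ?Ba vs" "1 \<notin> P"
        using subring_setD(1)[OF adjoin_list_props(1)[OF Ba(1)]] prime_setD(2)[OF pP] by auto
      from extend_specialisation_list[OF Ba(1) pP charP[OF P] this, where ?'c = 'c] obtain d1 where
        d1: "d1 \<in> ?Ba" "d1 \<notin> P" and ext1: "\<And>\<phi> :: 'r \<Rightarrow> 'c. specialisation ?Ba P \<phi> \<Longrightarrow> \<phi> d1 \<noteq> 0 \<Longrightarrow>
          (\<exists>\<psi>. specialisation (adjoin_list ?Ba vs) P \<psi> \<and> (\<forall>a\<in>?Ba. \<psi> a = \<phi> a))" by blast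
      have no': "\<forall>q\<in>B. \<forall>b\<in>B. q \<notin> P \<longrightarrow> q * a - b \<notin> P" using no BP[OF P] by blast
      let ?good = "\<lambda>\<phi> \<psi>. specialisation ?Ba P \<psi> \<and> (\<forall>a\<in>B. \<psi> a = \<phi> a) \<and> \<psi> d1 \<noteq> 0"
      from extend_specialisation[OF Bp(1) pP charP[OF P] d1, where ?'c = 'c] obtain d where
        d: "d \<in> B" "d \<notin> P" and D: "\<forall>\<phi> :: 'r \<Rightarrow> 'c. specialisation B P \<phi> \<longrightarrow> \<phi> d \<noteq> 0 \<longrightarrow>
          (\<exists>\<psi>. ?good \<phi> \<psi>) \<and> ((\<forall>q\<in>B. \<forall>b\<in>B. q \<notin> P \<longrightarrow> q * a - b \<notin> P) \<longrightarrow>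
            (\<exists>\<psi> \<psi>'. specialisation ?Ba P \<psi> \<and> (\<forall>a\<in>B. \<psi> a = \<phi> a) \<and> \<psi> d1 \<noteq> 0 \<and>
              specialisation ?Ba P \<psi>' \<and> (\<forall>a\<in>B. \<psi>' a = \<phi> a) \<and> \<psi>' d1 \<noteq> 0 \<and> \<psi> a \<noteq> \<psi>' a))"
        by (elim bexE conjE)
      have ext2: "\<exists>\<psi> \<psi>'. specialisation ?Ba P \<psi> \<and> (\<forall>a\<in>B. \<psi> a = \<phi> a) \<and> \<psi> d1 \<noteq> 0 \<and>
          specialisation ?Ba P \<psi>' \<and> (\<forall>a\<in>B. \<psi>' a = \<phi> a) \<and> \<psi>' d1 \<noteq> 0 \<and> \<psi> a \<noteq> \<psi>' a"
        if "specialisation B P \<phi>" "\<phi> d \<noteq> 0" for \<phi> :: "'r \<Rightarrow> 'c"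
        by (rule mp[OF conjunct2[OF mp[OF mp[OF spec[OF D] that(1)] that(2)]] no'])
      have "d * \<pi> \<in> S" using d(2) BP[OF P d(1)] by (intro Sm piS) blast
      from base[OF this P] obtain \<phi> :: "'r \<Rightarrow> 'c" where \<phi>: "specialisation B P \<phi>" "\<forall>c\<in>C0. \<phi> c = \<phi>0 c" "\<phi> (d * \<pi>) \<noteq> 0"
        by blast
      then have nz: "\<phi> d \<noteq> 0" "\<phi> \<pi> \<noteq> 0" using specialisationD(4)[OF \<phi>(1) Bp(1) d(1) \<pi>(1)] by auto
      from ext2[OF \<phi>(1) nz(1)] obtain \<psi> \<psi>' where
        1: "specialisation ?Ba P \<psi>" "\<forall>a\<in>B. \<psi> a = \<phi> a" "\<psi> d1 \<noteq> 0"
        and 2: "specialisation ?Ba P \<psi>'" "\<forall>a\<in>B. \<psi>' a = \<phi> a" "\<psi>' d1 \<noteq> 0" and ne: "\<psi> a \<noteq> \<psi>' a" by blast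
      obtain \<Psi> where \<Psi>: "specialisation (adjoin_list ?Ba vs) P \<Psi>" "\<forall>a\<in>?Ba. \<Psi> a = \<psi> a" using ext1 1 by blast
      obtain \<Psi>' where \<Psi>': "specialisation (adjoin_list ?Ba vs) P \<Psi>'" "\<forall>a\<in>?Ba. \<Psi>' a = \<psi>' a" using ext1 2 by blast
      have BBa: "b \<in> ?Ba" if "b \<in> B" for b using that Ba by auto
      have "\<Psi> a = \<Psi>' a"
      proof (rule sep)
        show "specialisation A Z \<Psi>" using \<Psi>(1) sub ZP by (rule specialisation_mono)
        show "specialisation A Z \<Psi>'" using \<Psi>'(1) sub ZP by (rule specialisation_mono)
        show "\<Psi> \<pi> \<noteq> 0" using \<Psi>(2) 1(2) nz \<pi>(1) BBa by auto
        show "\<Psi> b = \<Psi>' b" if "b \<in> B" for b using \<Psi>(2) \<Psi>'(2) 1(2) 2(2) that BBa by auto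
        show "\<Psi> c = \<phi>0 c" if "c \<in> C0" for c using \<Psi>(2) 1(2) \<phi>(2) that BBa Bp(2) by (metis subsetD)
      qed
      then show False using ne \<Psi>(2) \<Psi>'(2) Ba(3) by auto
    qed
    \<comment> \<open>If the quotients differed, a specialisation of \<open>B\<close> at which they differ would extend to \<open>A\<close> modulo both
      primes.\<close>
    have two: "Q' * b - Q * b' \<in> P" if P: "P \<in> primes" "P' \<in> primes" and Q: "Q \<in> S" "Q' \<in> S" "b \<in> B" "b' \<in> B"
      and QP: "Q * a - b \<in> P" "Q' * a - b' \<in> P'" for P P' Q Q' b b'
    proof (rule ccontr)
      let ?e = "Q' * b - Q * b'"
      assume e: "?e \<notin> P"
      have QB: "Q \<in> B" "Q' \<in> B" using Q SB by auto
      have eB: "?e \<in> B" using Q QB sB by auto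
      have eS: "?e \<in> S" using e BP[OF P(1) eB] by blast
      have ext: "\<exists>d\<in>S. \<forall>\<phi> :: 'r \<Rightarrow> 'c. specialisation B P \<phi> \<longrightarrow> \<phi> d \<noteq> 0 \<longrightarrow>
          (\<exists>\<psi>. specialisation A P \<psi> \<and> (\<forall>a\<in>B. \<psi> a = \<phi> a))" if P: "P \<in> primes" for P
      proof -
        note pP = primesD(1)[OF P]
        have "1 \<in> adjoin_list B vs" "1 \<notin> P" using sA(1) A prime_setD(2)[OF pP] by auto
        from extend_specialisation_list[OF Bp(1) pP charP[OF P] this, where ?'c = 'c]
        show ?thesis using BP[OF P] A by blast
      qed
      obtain d where d: "d \<in> S" and extd: "\<And>\<phi> :: 'r \<Rightarrow> 'c. specialisation B P \<phi> \<Longrightarrow> \<phi> d \<noteq> 0 \<Longrightarrow>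
          (\<exists>\<psi>. specialisation A P \<psi> \<and> (\<forall>a\<in>B. \<psi> a = \<phi> a))" using ext[OF P(1)] by blast
      obtain d' where d': "d' \<in> S" and extd': "\<And>\<phi> :: 'r \<Rightarrow> 'c. specialisation B P' \<phi> \<Longrightarrow> \<phi> d' \<noteq> 0 \<Longrightarrow>
          (\<exists>\<psi>. specialisation A P' \<psi> \<and> (\<forall>a\<in>B. \<psi> a = \<phi> a))" using ext[OF P(2)] by blast
      have dB: "d \<in> B" "d' \<in> B" using d d' SB by auto
      have prodS: "?e * (d * (d' * \<pi>)) \<in> S" by (intro Sm eS d d' piS)
      from base[OF prodS P(1)] obtain \<phi> :: "'r \<Rightarrow> 'c" where
        \<phi>: "specialisation B P \<phi>" "\<forall>c\<in>C0. \<phi> c = \<phi>0 c" "\<phi> (?e * (d * (d' * \<pi>))) \<noteq> 0" by blast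
      note sd = specialisationD[OF \<phi>(1) Bp(1)]
      have "\<phi> (?e * (d * (d' * \<pi>))) = \<phi> ?e * (\<phi> d * (\<phi> d' * \<phi> \<pi>))"
        using eB dB \<pi>(1) sB by (simp add: sd(4))
      then have nz: "\<phi> ?e \<noteq> 0" "\<phi> d \<noteq> 0" "\<phi> d' \<noteq> 0" "\<phi> \<pi> \<noteq> 0" using \<phi>(3) by auto
      have \<phi>': "specialisation B P' \<phi>" using \<phi>(1) BP[OF P(1)] BP[OF P(2)] by (auto simp: specialisation_def)
      obtain \<psi> where \<psi>: "specialisation A P \<psi>" "\<forall>a\<in>B. \<psi> a = \<phi> a" using extd \<phi> nz by blast
      obtain \<psi>' where \<psi>': "specialisation A P' \<psi>'" "\<forall>a\<in>B. \<psi>' a = \<phi> a" using extd' \<phi>' nz by blast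
      have eq: "\<psi> a = \<psi>' a"
      proof (rule sep)
        show "specialisation A Z \<psi>" using \<psi>(1) primesD(2)[OF P(1)] by (intro specialisation_mono[OF \<psi>(1)]) auto
        show "specialisation A Z \<psi>'" using \<psi>'(1) primesD(2)[OF P(2)] by (intro specialisation_mono[OF \<psi>'(1)]) auto
        show "\<psi> c = \<phi>0 c" if "c \<in> C0" for c using that \<psi>(2) \<phi>(2) Bp(2) by (metis subsetD)
        show "\<psi> b = \<psi>' b" if "b \<in> B" for b using that \<psi>(2) \<psi>'(2) by auto
        show "\<psi> \<pi> \<noteq> 0" using nz \<psi>(2) \<pi>(1) by auto
      qed
      have BA: "x \<in> A" if "x \<in> B" for x using that Ap(2) by auto
      have rel: "\<chi> q * \<chi> a = \<chi> c" if "specialisation A P0 \<chi>" "q \<in> B" "c \<in> B" "q * a - c \<in> P0" for P0 \<chi> q c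
      proof -
        note sx = specialisationD[OF that(1) Ap(1)]
        have qc: "q \<in> A" "c \<in> A" using BA that(2,3) by blast+
        have qa: "q * a \<in> A" using qc(1) aA by (rule sA(4))
        have "\<chi> (q * a - c) = 0" using sA(6)[OF qa qc(2)] that(4) by (rule sx(5))
        then show ?thesis using sx(7)[OF qa qc(2)] sx(4)[OF qc(1) aA] by simp
      qed
      have "\<phi> Q * \<psi> a = \<phi> b" "\<phi> Q' * \<psi> a = \<phi> b'"
        using rel[OF \<psi>(1) QB(1) Q(3) QP(1)] rel[OF \<psi>'(1) QB(2) Q(4) QP(2)] \<psi>(2) \<psi>'(2) eq QB Q by auto
      moreover have "\<phi> ?e = \<phi> Q' * \<phi> b - \<phi> Q * \<phi> b'" using QB Q sB by (simp add: sd)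
      ultimately have "\<phi> ?e = \<phi> Q' * (\<phi> Q * \<psi> a) - \<phi> Q * (\<phi> Q' * \<psi> a)" by simp
      then show False using nz by (simp add: algebra_simps)
    qed
    have SU: "mult_subset UNIV Z S" using S unfolding mult_subset_def by blast
    obtain P where "prime_set P" "Z \<subseteq> P" "P \<inter> S = {}" by (rule exists_prime_avoiding[OF Z SU])
    then have P: "P \<in> primes" by (simp add: primes_def)
    obtain Q b where Q: "Q \<in> S" "b \<in> B" "Q * a - b \<in> P" using one[OF P] by blast
    have all: "Q * a - b \<in> P'" if P': "P' \<in> primes" for P'
    proof -
      note pP = primesD(1)[OF P']
      obtain Q' b' where Q': "Q' \<in> S" "b' \<in> B" "Q' * a - b' \<in> P'" using one[OF P'] by blast
      have "Q * b' - Q' * b \<in> P'" using two[OF P' P Q'(1) Q(1) Q'(2) Q(2) Q'(3) Q(3)] .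
      then have "Q * (Q' * a - b') + (Q * b' - Q' * b) \<in> P'" using Q'(3) by (auto simp: prime_setD[OF pP])
      also have "Q * (Q' * a - b') + (Q * b' - Q' * b) = Q' * (Q * a - b)" by (simp add: algebra_simps)
      finally show ?thesis using Q'(1) P' prime_setD(4)[OF pP] by (auto simp: primes_def)
    qed
    show "\<exists>Q\<in>S. \<exists>b\<in>B. Q * a - b \<in> Z"
    proof (rule ccontr)
      assume no: "\<not> (\<exists>Q\<in>S. \<exists>b\<in>B. Q * a - b \<in> Z)"
      let ?x = "Q * a - b"
      let ?T = "{s * ?x ^ i | s i. s \<in> S}"
      have sx: "s * ?x \<notin> Z" if s: "s \<in> S" for s
      proof
        assume "s * ?x \<in> Z"
        then have "(s * Q) * a - s * b \<in> Z" by (simp add: algebra_simps)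
        moreover have "s * Q \<in> S" "s * b \<in> B" using Sm[OF s Q(1)] sB(4)[OF SB[OF s] Q(2)] .
        ultimately show False using no by blast
      qed
      have "subring_set (UNIV :: 'r set)" by (simp add: subring_set_def)
      note T = mult_subset_adjoin_powers[OF SU this Z UNIV_I sx]
      obtain P' where P': "prime_set P'" "Z \<subseteq> P'" "P' \<inter> ?T = {}" by (rule exists_prime_avoiding[OF Z T(1)])
      then have "P' \<in> primes" using T(2) unfolding primes_def by blast
      then have "?x \<in> P'" by (rule all)
      then show False using P'(3) T(3) by blast
    qed
  qed
qed

section \<open>Evaluation of polynomials and rational functions\<close>

definition ring_map :: "('a::comm_ring_1 \<Rightarrow> 'b::comm_ring_1) \<Rightarrow> bool"
  where "ring_map h \<longleftrightarrow> h 1 = 1 \<and> (\<forall>a b. h (a + b) = h a + h b \<and> h (a * b) = h a * h b)"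

lemma ring_mapD:
  assumes "ring_map h"
  shows "h 1 = 1" "h 0 = 0" "h (a + b) = h a + h b" "h (a * b) = h a * h b" "h (- a) = - h a"
    "h (a - b) = h a - h b" "h (a ^ n) = h a ^ n" "h (of_nat n) = of_nat n"
    "h (sum f I) = (\<Sum>i\<in>I. h (f i))" "h (prod f I) = (\<Prod>i\<in>I. h (f i))"
proof -
  note * = assms[unfolded ring_map_def]
  show 1: "h 1 = 1" "h (a + b) = h a + h b" "h (a * b) = h a * h b" for a b using * by auto
  have "h (0 + 0) = h 0 + h 0" by (rule 1)
  then show 0: "h 0 = 0" by simp
  have m: "h (- x) = - h x" for x
  proof -
    have "h (- x) + h x = 0" using 1(2)[of "- x" x] 0 by simp
    then show ?thesis by (simp add: eq_neg_iff_add_eq_0)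
  qed
  then show "h (- a) = - h a" .
  show "h (a - b) = h a - h b" using 1(2)[of a "- b"] m by simp
  show "h (a ^ n) = h a ^ n" by (induction n) (simp_all add: 1)
  show "h (of_nat n) = of_nat n" by (induction n) (simp_all add: 0 1)
  show "h (sum f I) = (\<Sum>i\<in>I. h (f i))" by (induction I rule: infinite_finite_induct) (simp_all add: 0 1)
  show "h (prod f I) = (\<Prod>i\<in>I. h (f i))" by (induction I rule: infinite_finite_induct) (simp_all add: 0 1)
qed

lemma ring_map_compose: "ring_map f \<Longrightarrow> ring_map g \<Longrightarrow> ring_map (\<lambda>x. f (g x))"
  by (auto simp: ring_map_def)

lemma ring_map_id: "ring_map (\<lambda>x. x)"
  by (auto simp: ring_map_def)

lemma ring_map_inj_field: "ring_map (h :: 'a::field \<Rightarrow> 'b::field) \<Longrightarrow> h a = 0 \<longleftrightarrow> a = 0"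
  by (metis ring_mapD(1,2,4) mult_zero_left right_inverse zero_neq_one)

definition monom_value :: "('x \<Rightarrow> 'r::comm_ring_1) \<Rightarrow> ('x \<Rightarrow>\<^sub>0 nat) \<Rightarrow> 'r"
  where "monom_value \<alpha> t = (\<Prod>x\<in>Poly_Mapping.keys t. \<alpha> x ^ Poly_Mapping.lookup t x)"

lemma monom_value_superset:
  assumes "finite F" "Poly_Mapping.keys t \<subseteq> F"
  shows "monom_value \<alpha> t = (\<Prod>x\<in>F. \<alpha> x ^ Poly_Mapping.lookup t x)"
  unfolding monom_value_def using assms
  by (intro prod.mono_neutral_left) (auto simp: in_keys_iff)

lemma monom_value_add: "monom_value \<alpha> (s + t) = monom_value \<alpha> s * monom_value \<alpha> t"
proof -
  let ?F = "Poly_Mapping.keys s \<union> Poly_Mapping.keys t"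
  have "Poly_Mapping.keys (s + t) \<subseteq> ?F" by (rule Poly_Mapping.keys_add)
  then show ?thesis
    by (simp add: monom_value_superset[of ?F] lookup_add power_add prod.distrib)
qed

lemma monom_value_0: "monom_value \<alpha> 0 = 1"
  by (simp add: monom_value_def)

lemma monom_value_single: "monom_value \<alpha> (Poly_Mapping.single x n) = \<alpha> x ^ n"
  by (simp add: monom_value_def)

lemma eval_mpoly_superset:
  assumes "h 0 = 0" "finite F" "Poly_Mapping.keys p \<subseteq> F"
  shows "eval_mpoly h \<alpha> p = (\<Sum>t\<in>F. h (Poly_Mapping.lookup p t) * monom_value \<alpha> t)"
  unfolding eval_mpoly_def monom_value_def[symmetric] using assms
  by (intro sum.mono_neutral_left) (auto simp: in_keys_iff)

lemma mpoly_as_sum: "p = (\<Sum>t\<in>Poly_Mapping.keys p. Poly_Mapping.single t (Poly_Mapping.lookup p t))"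
proof (rule poly_mapping_eqI)
  fix k
  have "(\<Sum>t\<in>Poly_Mapping.keys p. Poly_Mapping.lookup (Poly_Mapping.single t (Poly_Mapping.lookup p t)) k)
    = (\<Sum>t\<in>Poly_Mapping.keys p. if t = k then Poly_Mapping.lookup p k else 0)"
    by (intro sum.cong) (auto simp: lookup_single when_def)
  then show "Poly_Mapping.lookup p k = Poly_Mapping.lookup
      (\<Sum>t\<in>Poly_Mapping.keys p. Poly_Mapping.single t (Poly_Mapping.lookup p t)) k"
    by (simp add: lookup_sum not_in_keys_iff_lookup_eq_zero)
qed

context
  fixes h :: "'c::comm_ring_1 \<Rightarrow> 'r::comm_ring_1" and \<alpha> :: "'x \<Rightarrow> 'r"
  assumes h: "ring_map h"
begin

lemma eval_mpoly_single: "eval_mpoly h \<alpha> (Poly_Mapping.single t c) = h c * monom_value \<alpha> t"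
  by (simp add: eval_mpoly_def ring_mapD[OF h] monom_value_def)

lemma eval_mpoly_add: "eval_mpoly h \<alpha> (p + q) = eval_mpoly h \<alpha> p + eval_mpoly h \<alpha> q"
proof -
  let ?F = "Poly_Mapping.keys p \<union> Poly_Mapping.keys q"
  have "Poly_Mapping.keys (p + q) \<subseteq> ?F" by (rule Poly_Mapping.keys_add)
  then show ?thesis
    by (simp add: eval_mpoly_superset[of h ?F] ring_mapD[OF h] lookup_add sum.distrib distrib_right)
qed

lemma eval_mpoly_0: "eval_mpoly h \<alpha> 0 = 0"
  by (simp add: eval_mpoly_def)

lemma eval_mpoly_sum: "eval_mpoly h \<alpha> (\<Sum>i\<in>I. f i) = (\<Sum>i\<in>I. eval_mpoly h \<alpha> (f i))"
  by (induction I rule: infinite_finite_induct) (simp_all add: eval_mpoly_add eval_mpoly_0)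

lemma eval_mpoly_mult: "eval_mpoly h \<alpha> (p * q) = eval_mpoly h \<alpha> p * eval_mpoly h \<alpha> q"
proof -
  let ?s = "\<lambda>p t. Poly_Mapping.single t (Poly_Mapping.lookup p t)"
  have "p * q = (\<Sum>t\<in>Poly_Mapping.keys p. ?s p t) * (\<Sum>u\<in>Poly_Mapping.keys q. ?s q u)"
    using mpoly_as_sum[of p] mpoly_as_sum[of q] by simp
  also have "\<dots> = (\<Sum>t\<in>Poly_Mapping.keys p. \<Sum>u\<in>Poly_Mapping.keys q. ?s p t * ?s q u)"
    by (rule sum_product)
  finally have "eval_mpoly h \<alpha> (p * q) =
      (\<Sum>t\<in>Poly_Mapping.keys p. \<Sum>u\<in>Poly_Mapping.keys q. eval_mpoly h \<alpha> (?s p t) * eval_mpoly h \<alpha> (?s q u))"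
    by (simp add: eval_mpoly_sum mult_single eval_mpoly_single monom_value_add ring_mapD[OF h] ac_simps)
  also have "\<dots> = eval_mpoly h \<alpha> (\<Sum>t\<in>Poly_Mapping.keys p. ?s p t) * eval_mpoly h \<alpha> (\<Sum>u\<in>Poly_Mapping.keys q. ?s q u)"
    by (simp add: eval_mpoly_sum sum_product)
  finally show ?thesis using mpoly_as_sum[of p] mpoly_as_sum[of q] by simp
qed

lemma eval_mpoly_mconst: "eval_mpoly h \<alpha> (mconst c) = h c"
  by (simp add: mconst_def eval_mpoly_single monom_value_0)

lemma eval_mpoly_mvar: "eval_mpoly h \<alpha> (mvar x) = \<alpha> x"
  by (simp add: mvar_def eval_mpoly_single monom_value_single ring_mapD[OF h])

lemma ring_map_eval_mpoly: "ring_map (eval_mpoly h \<alpha>)"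
  unfolding ring_map_def
  using eval_mpoly_mconst[of 1] by (simp add: eval_mpoly_add eval_mpoly_mult mconst_def ring_mapD[OF h])

end

lemma ring_map_mconst: "ring_map (mconst :: 'c::comm_ring_1 \<Rightarrow> ('x, 'c) mpoly)"
  by (simp add: ring_map_def mconst_def single_add mult_single)

lemma prod_monomials:
  "(\<Prod>i\<in>I. Poly_Mapping.single (f i) (1::'c::comm_ring_1)) = Poly_Mapping.single (\<Sum>i\<in>I. f i) 1"
  by (induction I rule: infinite_finite_induct) (simp_all add: mult_single)

lemma monom_as_product:
  fixes c :: "'c::comm_ring_1" and t :: "'x \<Rightarrow>\<^sub>0 nat"
  shows "Poly_Mapping.single t c = mconst c * monom_value mvar t"
proof -
  have "mvar x ^ n = Poly_Mapping.single (Poly_Mapping.single x n) (1::'c)" for x :: 'x and n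
    by (induction n) (simp_all add: mvar_def mult_single single_add[symmetric])
  then have "monom_value mvar t = (\<Prod>x\<in>Poly_Mapping.keys t.
      Poly_Mapping.single (Poly_Mapping.single x (Poly_Mapping.lookup t x)) (1::'c))"
    by (simp add: monom_value_def)
  also have "\<dots> = Poly_Mapping.single (\<Sum>x\<in>Poly_Mapping.keys t. Poly_Mapping.single x (Poly_Mapping.lookup t x)) 1"
    by (rule prod_monomials)
  finally show ?thesis
    using mpoly_as_sum[of t] by (simp add: mconst_def mult_single)
qed

lemma polysD:
  assumes "p \<in> polys C Vs"
  shows "t \<in> Poly_Mapping.keys p \<Longrightarrow> Poly_Mapping.lookup p t \<in> C"
    "t \<in> Poly_Mapping.keys p \<Longrightarrow> x \<in> Poly_Mapping.keys t \<Longrightarrow> x \<in> Vs"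
    "0 \<in> C \<Longrightarrow> Poly_Mapping.lookup p t \<in> C"
proof -
  show 1: "t \<in> Poly_Mapping.keys p \<Longrightarrow> Poly_Mapping.lookup p t \<in> C" for t
    using assms in_keys_lookup_in_range[of t p] unfolding polys_def by blast
  show "t \<in> Poly_Mapping.keys p \<Longrightarrow> x \<in> Poly_Mapping.keys t \<Longrightarrow> x \<in> Vs"
    using assms unfolding polys_def by blast
  show "0 \<in> C \<Longrightarrow> Poly_Mapping.lookup p t \<in> C"
    using 1[of t] by (cases "t \<in> Poly_Mapping.keys p") (auto simp: in_keys_iff)
qed

lemma polysI:
  assumes "\<And>t. t \<in> Poly_Mapping.keys p \<Longrightarrow> Poly_Mapping.lookup p t \<in> C"
    "\<And>t x. t \<in> Poly_Mapping.keys p \<Longrightarrow> x \<in> Poly_Mapping.keys t \<Longrightarrow> x \<in> Vs"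
  shows "p \<in> polys C Vs"
proof -
  have "c \<in> C" if "c \<in> Poly_Mapping.range p" for c
  proof -
    obtain t where "c = Poly_Mapping.lookup p t" "c \<noteq> 0"
      using \<open>c \<in> Poly_Mapping.range p\<close> by (auto simp: range.rep_eq)
    then show ?thesis using assms(1)[of t] by (simp add: in_keys_iff)
  qed
  then show ?thesis using assms(2) unfolding polys_def by blast
qed

lemma polys_mono: "p \<in> polys C Vs \<Longrightarrow> C \<subseteq> C' \<Longrightarrow> Vs \<subseteq> Vs' \<Longrightarrow> p \<in> polys C' Vs'"
  unfolding polys_def by blast

lemma mconst_in_polys: "c \<in> C \<Longrightarrow> mconst c \<in> polys C Vs"
  by (rule polysI) (auto simp: mconst_def split: if_splits)

lemma mvar_in_polys: "1 \<in> C \<Longrightarrow> x \<in> Vs \<Longrightarrow> mvar x \<in> polys C Vs"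
  by (rule polysI) (auto simp: mvar_def split: if_splits)

lemma polys_add:
  assumes "subring_set C" "p \<in> polys C Vs" "q \<in> polys C Vs"
  shows "p + q \<in> polys C Vs"
proof (rule polysI)
  fix t assume "t \<in> Poly_Mapping.keys (p + q)"
  then have "t \<in> Poly_Mapping.keys p \<union> Poly_Mapping.keys q" using Poly_Mapping.keys_add[of p q] by blast
  then show "x \<in> Vs" if "x \<in> Poly_Mapping.keys t" for x
    using polysD(2)[OF assms(2)] polysD(2)[OF assms(3)] that by blast
  show "Poly_Mapping.lookup (p + q) t \<in> C"
    unfolding lookup_add using assms by (intro subring_setD polysD(3)[of _ C Vs])
qed

lemma polys_sum:
  assumes "subring_set C" "\<And>i. i \<in> I \<Longrightarrow> f i \<in> polys C Vs"
  shows "(\<Sum>i\<in>I. f i) \<in> polys C Vs"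
  using assms(2)
proof (induction I rule: infinite_finite_induct)
  case (insert x F)
  have "f x + sum f F \<in> polys C Vs" by (rule polys_add[OF assms(1)]) (use insert in auto)
  then show ?case using insert(1,2) by simp
qed (auto intro!: polysI)

lemma monom_in_polys:
  "c \<in> C \<Longrightarrow> Poly_Mapping.keys t \<subseteq> Vs \<Longrightarrow> Poly_Mapping.single t c \<in> polys C Vs"
  by (rule polysI) (auto split: if_splits)

lemma polys_mult:
  assumes "subring_set C" "p \<in> polys C Vs" "q \<in> polys C Vs"
  shows "p * q \<in> polys C Vs"
proof -
  let ?s = "\<lambda>p t. Poly_Mapping.single t (Poly_Mapping.lookup p t)"
  have "p * q = (\<Sum>t\<in>Poly_Mapping.keys p. ?s p t) * (\<Sum>u\<in>Poly_Mapping.keys q. ?s q u)"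
    using mpoly_as_sum[of p] mpoly_as_sum[of q] by simp
  also have "\<dots> = (\<Sum>t\<in>Poly_Mapping.keys p. \<Sum>u\<in>Poly_Mapping.keys q. ?s p t * ?s q u)"
    by (rule sum_product)
  also have "\<dots> \<in> polys C Vs"
    unfolding mult_single
  proof (intro polys_sum[OF assms(1)] monom_in_polys subring_setD(4)[OF assms(1)])
    fix t u assume tu: "t \<in> Poly_Mapping.keys p" "u \<in> Poly_Mapping.keys q"
    show "Poly_Mapping.lookup p t \<in> C" using tu(1) by (rule polysD[OF assms(2)])
    show "Poly_Mapping.lookup q u \<in> C" using tu(2) by (rule polysD[OF assms(3)])
    have "Poly_Mapping.keys t \<subseteq> Vs" "Poly_Mapping.keys u \<subseteq> Vs"
      using polysD(2)[OF assms(2) tu(1)] polysD(2)[OF assms(3) tu(2)] by blast+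
    then show "Poly_Mapping.keys (t + u) \<subseteq> Vs" using Poly_Mapping.keys_add[of t u] by blast
  qed
  finally show ?thesis .
qed

lemma subring_set_polys:
  assumes "subring_set C"
  shows "subring_set (polys C Vs)"
  unfolding subring_set_def
proof (intro conjI ballI)
  show "1 \<in> polys C Vs" using mconst_in_polys[OF subring_setD(1)[OF assms], of Vs] by (simp add: mconst_def)
  fix p q assume pq: "p \<in> polys C Vs" "q \<in> polys C Vs"
  show "p + q \<in> polys C Vs" "p * q \<in> polys C Vs" using polys_add polys_mult assms pq by blast+
  have "- p = mconst (- 1) * p" by (simp add: mconst_def single_uminus)
  then show "- p \<in> polys C Vs"
    using polys_mult[OF assms mconst_in_polys pq(1), of "- 1"] subring_setD[OF assms] by simp
qed

lemma polys_induct [consumes 2, case_names const var add mult]: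
  assumes C: "subring_set C" and p: "p \<in> polys C Vs"
    and "\<And>c. c \<in> C \<Longrightarrow> Q (mconst c)" "\<And>x. x \<in> Vs \<Longrightarrow> Q (mvar x)"
    and add: "\<And>p q. Q p \<Longrightarrow> Q q \<Longrightarrow> Q (p + q)" and mult: "\<And>p q. Q p \<Longrightarrow> Q q \<Longrightarrow> Q (p * q)"
  shows "Q p"
proof -
  have Q0: "Q 0" and Q1: "Q 1"
    using assms(3)[of 0] assms(3)[of 1] subring_setD[OF C] by (simp_all add: mconst_def)
  have pow: "Q (mvar x ^ n)" if "x \<in> Vs" for x n
    by (induction n) (use that assms(4) mult Q1 in simp_all)
  have prod: "Q (\<Prod>x\<in>F. mvar x ^ g x)" if "F \<subseteq> Vs" for F g
    using that by (induction F rule: infinite_finite_induct) (use pow mult Q1 in simp_all)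
  have "Q (Poly_Mapping.single t (Poly_Mapping.lookup p t))" if t: "t \<in> Poly_Mapping.keys p" for t
  proof -
    have "Poly_Mapping.keys t \<subseteq> Vs" using polysD(2)[OF p t] by blast
    then show ?thesis unfolding monom_as_product monom_value_def
      by (intro mult prod assms(3) polysD(1)[OF p t])
  qed
  then have "Q (\<Sum>t\<in>F. Poly_Mapping.single t (Poly_Mapping.lookup p t))" if "F \<subseteq> Poly_Mapping.keys p" for F
    using that by (induction F rule: infinite_finite_induct) (use add Q0 in simp_all)
  from this[OF order.refl] show ?thesis by (simp only: mpoly_as_sum[of p, symmetric])
qed

lemma subring_set_UNIV: "subring_set UNIV"
  by (simp add: subring_set_def)

lemma in_polys_UNIV: "p \<in> polys UNIV UNIV"
  by (simp add: polys_def)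

lemma eval_mpoly_cong:
  assumes "p \<in> polys C Vs" "\<And>c. c \<in> C \<Longrightarrow> h c = h' c" "\<And>x. x \<in> Vs \<Longrightarrow> \<alpha> x = \<beta> x"
  shows "eval_mpoly h \<alpha> p = eval_mpoly h' \<beta> p"
  unfolding eval_mpoly_def
proof (intro sum.cong refl)
  fix t assume t: "t \<in> Poly_Mapping.keys p"
  have "(\<Prod>x\<in>Poly_Mapping.keys t. \<alpha> x ^ Poly_Mapping.lookup t x) = (\<Prod>x\<in>Poly_Mapping.keys t. \<beta> x ^ Poly_Mapping.lookup t x)"
    by (intro prod.cong refl) (simp add: assms(3) polysD(2)[OF assms(1) t])
  then show "h (Poly_Mapping.lookup p t) * (\<Prod>x\<in>Poly_Mapping.keys t. \<alpha> x ^ Poly_Mapping.lookup t x) =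
    h' (Poly_Mapping.lookup p t) * (\<Prod>x\<in>Poly_Mapping.keys t. \<beta> x ^ Poly_Mapping.lookup t x)"
    using assms(2) polysD(1)[OF assms(1) t] by simp
qed

lemma eval_mpoly_in_subring:
  assumes "subring_set A" "p \<in> polys C Vs" "\<And>c. c \<in> C \<Longrightarrow> h c \<in> A" "\<And>x. x \<in> Vs \<Longrightarrow> \<alpha> x \<in> A"
  shows "eval_mpoly h \<alpha> p \<in> A"
  unfolding eval_mpoly_def
  by (intro subring_set_sum[OF assms(1)] subring_setD(4,7)[OF assms(1)] subring_set_prod[OF assms(1)] assms(3,4))
     (auto intro: polysD[OF assms(2)])

lemma specialisation_eval_mpoly:
  assumes "specialisation A P \<phi>" "subring_set A" "p \<in> polys C Vs"
    "\<And>c. c \<in> C \<Longrightarrow> h c \<in> A" "\<And>x. x \<in> Vs \<Longrightarrow> \<alpha> x \<in> A"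
  shows "\<phi> (eval_mpoly h \<alpha> p) = eval_mpoly (\<lambda>c. \<phi> (h c)) (\<lambda>x. \<phi> (\<alpha> x)) p"
proof -
  note sA = subring_setD(4,7)[OF assms(2)] and sp = specialisationD[OF assms(1,2)]
  have pr: "(\<Prod>x\<in>Poly_Mapping.keys t. \<alpha> x ^ Poly_Mapping.lookup t x) \<in> A \<and>
    \<phi> (\<Prod>x\<in>Poly_Mapping.keys t. \<alpha> x ^ Poly_Mapping.lookup t x) = (\<Prod>x\<in>Poly_Mapping.keys t. \<phi> (\<alpha> x) ^ Poly_Mapping.lookup t x)"
    if t: "t \<in> Poly_Mapping.keys p" for t
  proof -
    have x: "\<alpha> x \<in> A" if "x \<in> Poly_Mapping.keys t" for x
      using assms(5) polysD(2)[OF assms(3) t that] .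
    then show ?thesis
      using specialisation_prod[OF assms(1,2), of "Poly_Mapping.keys t" "\<lambda>x. \<alpha> x ^ Poly_Mapping.lookup t x"]
        subring_set_prod[OF assms(2), of "Poly_Mapping.keys t" "\<lambda>x. \<alpha> x ^ Poly_Mapping.lookup t x"] sA(2) sp(8) by simp
  qed
  have c: "h (Poly_Mapping.lookup p t) \<in> A" if "t \<in> Poly_Mapping.keys p" for t
    using assms(4) polysD(1)[OF assms(3) that] .
  show ?thesis
    unfolding eval_mpoly_def
    by (subst specialisation_sum[OF assms(1,2)]) (use pr c sA sp(4) in \<open>auto intro!: sum.cong\<close>)
qed

lemma ring_map_specialisation: "ring_map (h :: 'a::comm_ring_1 \<Rightarrow> 'b::field) \<Longrightarrow> specialisation A {0} h"
  unfolding specialisation_def using ring_mapD(1-4)[of h] by blast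

lemma ring_map_eval:
  assumes "ring_map \<phi>"
  shows "\<phi> (eval_mpoly h \<alpha> p) = eval_mpoly (\<lambda>c. \<phi> (h c)) (\<lambda>x. \<phi> (\<alpha> x)) p"
  unfolding eval_mpoly_def by (simp add: ring_mapD[OF assms])

lemma eval_mpoly_subst:
  assumes "ring_map h"
  shows "eval_mpoly h \<alpha> (eval_mpoly mconst \<theta> p) = eval_mpoly h (\<lambda>x. eval_mpoly h \<alpha> (\<theta> x)) p"
  by (subst ring_map_eval[OF ring_map_eval_mpoly[OF assms]]) (simp add: eval_mpoly_mconst[OF assms])

lemma eval_mpoly_mvar_id: "eval_mpoly mconst mvar p = p" for p :: "('x, 'c::comm_ring_1) mpoly"
  unfolding eval_mpoly_def monom_value_def[symmetric] monom_as_product[symmetric] by (rule mpoly_as_sum[symmetric])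

context
  fixes h :: "'a::idom \<Rightarrow> 'b::idom"
  assumes h: "ring_map h" and inj: "\<And>a. h a = 0 \<Longrightarrow> a = 0"
begin

lemma fract_map_Fract:
  assumes "q \<noteq> 0"
  shows "fract_map h (Fract p q) = Fract (h p) (h q)"
  unfolding fract_map_def
proof (rule the_equality)
  have nz: "h a \<noteq> 0" if "a \<noteq> 0" for a using inj that by blast
  show "\<forall>p' q'. q' \<noteq> 0 \<and> Fract p q = Fract p' q' \<longrightarrow> Fract (h p) (h q) = Fract (h p') (h q')"
  proof (intro allI impI, elim conjE)
    fix p' q' assume q': "q' \<noteq> 0" and "Fract p q = Fract p' q'"
    then have "p * q' = p' * q" using assms by (simp add: eq_fract)
    then have "h (p * q') = h (p' * q)" by simp
    then show "Fract (h p) (h q) = Fract (h p') (h q')"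
      using assms q' nz by (simp add: ring_mapD[OF h] eq_fract)
  qed
  show "g = Fract (h p) (h q)" if "\<forall>p' q'. q' \<noteq> 0 \<and> Fract p q = Fract p' q' \<longrightarrow> g = Fract (h p') (h q')" for g
    using that assms by blast
qed

lemma ring_map_fract_map: "ring_map (fract_map h)"
proof -
  have nz: "h a \<noteq> 0" if "a \<noteq> 0" for a using inj that by blast
  have "fract_map h (x + y) = fract_map h x + fract_map h y \<and> fract_map h (x * y) = fract_map h x * fract_map h y" for x y
    by (cases x; cases y) (simp add: fract_map_Fract ring_mapD[OF h] nz)
  moreover have "fract_map h 1 = 1"
    using fract_map_Fract[of 1 1] by (simp add: ring_mapD[OF h] One_fract_def)
  ultimately show ?thesis unfolding ring_map_def by blast
qed

end

lemma ring_map_divide: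
  assumes "ring_map (h :: 'a::field \<Rightarrow> 'b::field)"
  shows "h (a / b) = h a / h b"
proof (cases "b = 0")
  case False
  have "h (a / b) * h b = h a" using False by (simp add: ring_mapD(4)[OF assms, symmetric])
  then show ?thesis using ring_map_inj_field[OF assms, of b] False by (simp add: field_simps)
qed (simp add: ring_mapD[OF assms])

definition of_poly :: "(nat, 'c::field) mpoly \<Rightarrow> 'c ratfun" where "of_poly p = Fract p 1"

definition rvar :: "nat \<Rightarrow> 'c::field ratfun" where "rvar i = of_poly (mvar i)"

lemma ring_map_of_poly: "ring_map of_poly"
  by (simp add: ring_map_def of_poly_def One_fract_def)

lemma of_poly_eq_0_iff: "of_poly p = 0 \<longleftrightarrow> p = 0"
  by (simp add: of_poly_def Zero_fract_def eq_fract)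

lemma of_poly_mconst: "of_poly (mconst c) = rconst c"
  by (simp add: of_poly_def rconst_def)

lemma ring_map_rconst: "ring_map (rconst :: 'c::field \<Rightarrow> 'c ratfun)"
  using ring_map_compose[OF ring_map_of_poly ring_map_mconst] by (simp add: of_poly_mconst)

lemma of_poly_eval: "of_poly p = eval_mpoly rconst rvar p"
proof -
  have "of_poly (eval_mpoly mconst mvar p) = eval_mpoly rconst rvar p"
    by (subst ring_map_eval[OF ring_map_of_poly]) (simp add: of_poly_mconst rvar_def[abs_def])
  then show ?thesis by (simp add: eval_mpoly_mvar_id)
qed

lemma Fract_as_quotient: "q \<noteq> 0 \<Longrightarrow> Fract p q = of_poly p / of_poly q"
  by (simp add: of_poly_def divide_fract)

lemma ratfuns_iff:
  "f \<in> ratfuns K r \<longleftrightarrow> (\<exists>p\<in>polys K {..<r}. \<exists>q\<in>polys K {..<r}. q \<noteq> 0 \<and> f = of_poly p / of_poly q)"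
  unfolding ratfuns_def using Fract_as_quotient by (auto; metis)

definition subfield_set :: "'f::field set \<Rightarrow> bool"
  where "subfield_set K \<longleftrightarrow> subring_set K \<and> (\<forall>a\<in>K. inverse a \<in> K)"

lemma subfield_setD:
  assumes "subfield_set K"
  shows "subring_set K" "a \<in> K \<Longrightarrow> inverse a \<in> K" "a \<in> K \<Longrightarrow> b \<in> K \<Longrightarrow> a / b \<in> K"
  using assms subring_setD(4)[of K] unfolding subfield_set_def by (auto simp: divide_inverse)

lemma subfield_set_ratfuns:
  assumes "subring_set K"
  shows "subfield_set (ratfuns K r)"
proof -
  note P = subring_setD[OF subring_set_polys[OF assms, of "{..<r}"]] and e = ring_mapD[OF ring_map_of_poly]
  have "a + b \<in> ratfuns K r \<and> a * b \<in> ratfuns K r \<and> - a \<in> ratfuns K r \<and> inverse a \<in> ratfuns K r"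
    if ab: "a \<in> ratfuns K r" "b \<in> ratfuns K r" for a b
  proof -
    obtain p q p' q' where pq: "p \<in> polys K {..<r}" "q \<in> polys K {..<r}" "q \<noteq> 0" "a = of_poly p / of_poly q"
      "p' \<in> polys K {..<r}" "q' \<in> polys K {..<r}" "q' \<noteq> 0" "b = of_poly p' / of_poly q'"
      using ab unfolding ratfuns_iff by blast
    have nz: "of_poly q \<noteq> 0" "of_poly q' \<noteq> 0" "q * q' \<noteq> 0" using pq by (simp_all add: of_poly_eq_0_iff)
    have "a + b = of_poly (p * q' + p' * q) / of_poly (q * q')" "a * b = of_poly (p * p') / of_poly (q * q')"
      "- a = of_poly (- p) / of_poly q"
      unfolding pq(4,8) using nz by (simp_all add: e field_simps)
    moreover have "inverse a \<in> ratfuns K r"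
    proof (cases "p = 0")
      case True
      then have "inverse a = of_poly 0 / of_poly q" using pq(4) by (simp add: e)
      then show ?thesis unfolding ratfuns_iff using P(2) pq by blast
    next
      case False
      then have "inverse a = of_poly q / of_poly p" using pq(4) by (simp add: field_simps)
      then show ?thesis unfolding ratfuns_iff using pq False by blast
    qed
    moreover have "p * q' + p' * q \<in> polys K {..<r}" "q * q' \<in> polys K {..<r}" "p * p' \<in> polys K {..<r}" "- p \<in> polys K {..<r}"
      using pq P by simp_all
    ultimately show ?thesis unfolding ratfuns_iff using nz(3) pq by blast
  qed
  moreover have "1 \<in> ratfuns K r"
    unfolding ratfuns_iff by (intro bexI[of _ 1]) (use P in \<open>simp_all add: e\<close>)
  ultimately show ?thesis unfolding subfield_set_def subring_set_def by blast
qed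

lemma of_poly_in_ratfuns: "subring_set K \<Longrightarrow> p \<in> polys K {..<r} \<Longrightarrow> of_poly p \<in> ratfuns K r"
  unfolding ratfuns_iff
  by (intro bexI[of _ p] bexI[of _ 1]) (auto simp: ring_mapD[OF ring_map_of_poly] subring_setD[OF subring_set_polys])

lemma rconst_in_ratfuns: "subring_set K \<Longrightarrow> c \<in> K \<Longrightarrow> rconst c \<in> ratfuns K r"
  unfolding of_poly_mconst[symmetric] by (intro of_poly_in_ratfuns mconst_in_polys)

lemma rvar_in_ratfuns: "subring_set K \<Longrightarrow> i < r \<Longrightarrow> rvar i \<in> ratfuns K r"
  unfolding rvar_def by (intro of_poly_in_ratfuns mvar_in_polys) (auto dest: subring_setD)

section \<open>Descent to fixed vectors\<close>

text \<open>A nonzero vector of \<open>V\<close> with minimal support, scaled to have an entry 1, is fixed by every \<open>\<gamma>\<close>: otherwise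
  its difference with its image under \<open>\<gamma>\<close> would be a nonzero vector of \<open>V\<close> with smaller support. Subtracting a
  multiple of such a vector from \<open>v\<close> shrinks the support of \<open>v\<close>, so \<open>v\<close> is a combination of fixed vectors. The
  conclusion is phrased for a subspace \<open>N\<close> that contains the fixed vectors; applied to the kernel of a
  linear form, it yields a fixed vector outside the kernel.\<close>
lemma descent_to_fixed_vectors:
  fixes V N :: "('i \<Rightarrow> 'f::field) set"
  assumes K: "subfield_set K" and \<Gamma>: "\<And>\<gamma>. \<gamma> \<in> \<Gamma> \<Longrightarrow> ring_map \<gamma>"
    and fin: "\<And>v. v \<in> V \<Longrightarrow> finite {i. v i \<noteq> 0}" and VK: "\<And>v i. v \<in> V \<Longrightarrow> v i \<in> K"
    and Vadd: "\<And>v w. v \<in> V \<Longrightarrow> w \<in> V \<Longrightarrow> (\<lambda>i. v i + w i) \<in> V"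
    and Vscale: "\<And>c v. c \<in> K \<Longrightarrow> v \<in> V \<Longrightarrow> (\<lambda>i. c * v i) \<in> V"
    and stable: "\<And>\<gamma> v. \<gamma> \<in> \<Gamma> \<Longrightarrow> v \<in> V \<Longrightarrow> (\<lambda>i. \<gamma> (v i)) \<in> V"
    and N0: "(\<lambda>i. 0) \<in> N" and Nadd: "\<And>v w. v \<in> N \<Longrightarrow> w \<in> N \<Longrightarrow> (\<lambda>i. v i + w i) \<in> N"
    and Nscale: "\<And>c v. c \<in> K \<Longrightarrow> v \<in> N \<Longrightarrow> (\<lambda>i. c * v i) \<in> N"
    and fixed: "\<And>v. v \<in> V \<Longrightarrow> (\<And>\<gamma> i. \<gamma> \<in> \<Gamma> \<Longrightarrow> \<gamma> (v i) = v i) \<Longrightarrow> v \<in> N"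
    and v: "v \<in> V"
  shows "v \<in> N"
  using v
proof (induction "card {i. v i \<noteq> 0}" arbitrary: v rule: less_induct)
  case less
  let ?S = "\<lambda>v :: 'i \<Rightarrow> 'f. {i. v i \<noteq> 0}"
  note sK = subring_setD[OF subfield_setD(1)[OF K]]
  have Vdiff: "(\<lambda>i. a i - c * b i) \<in> V" if ab: "a \<in> V" "b \<in> V" "c \<in> K" for a b c
    using Vadd[OF ab(1) Vscale[OF sK(5)[OF ab(3)] ab(2)]] by simp
  show ?case
  proof (cases "?S v = {}")
    case True
    then have "v = (\<lambda>i. 0)" by auto
    then show ?thesis using N0 by simp
  next
    case False
    define good where "good w \<longleftrightarrow> w \<in> V \<and> ?S w \<noteq> {} \<and> ?S w \<subseteq> ?S v" for w
    have "good v" using False less.prems by (simp add: good_def)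
    then obtain w where w: "good w" "\<And>y. good y \<Longrightarrow> card (?S w) \<le> card (?S y)"
      using ex_has_least_nat[of good v "\<lambda>w. card (?S w)"] by blast
    from w(1) obtain i where wi: "w i \<noteq> 0" unfolding good_def by blast
    have wV: "w \<in> V" using w(1) by (simp add: good_def)
    define u where "u = (\<lambda>j. inverse (w i) * w j)"
    have uV: "u \<in> V" unfolding u_def by (rule Vscale[OF subfield_setD(2)[OF K VK[OF wV]] wV])
    have Su: "?S u = ?S w" using wi by (auto simp: u_def)
    have ui: "u i = 1" using wi by (simp add: u_def)
    have ufix: "\<gamma> (u j) = u j" if \<gamma>: "\<gamma> \<in> \<Gamma>" for \<gamma> j
    proof (rule ccontr)
      assume ne: "\<gamma> (u j) \<noteq> u j"
      define y where "y = (\<lambda>j. \<gamma> (u j) - 1 * u j)"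
      have yV: "y \<in> V" unfolding y_def by (rule Vdiff[OF stable[OF \<gamma> uV] uV sK(1)])
      have sub: "?S y \<subseteq> ?S w - {i}"
      proof
        fix j assume "j \<in> ?S y"
        then have yj: "y j \<noteq> 0" by simp
        have "w j \<noteq> 0"
        proof
          assume "w j = 0"
          then have "u j = 0" by (simp add: u_def)
          then show False using yj ring_mapD(2)[OF \<Gamma>[OF \<gamma>]] by (simp add: y_def)
        qed
        moreover have "j \<noteq> i"
          using yj ring_mapD(1)[OF \<Gamma>[OF \<gamma>]] by (auto simp: y_def ui)
        ultimately show "j \<in> ?S w - {i}" by simp
      qed
      have "y j \<noteq> 0" using ne by (simp add: y_def)
      then have "good y" unfolding good_def using yV sub w(1) unfolding good_def by blast
      then have "card (?S w) \<le> card (?S y)" by (rule w(2))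
      also have "\<dots> \<le> card (?S w - {i})" using sub fin[OF wV] by (intro card_mono) auto
      also have "\<dots> < card (?S w)" using fin[OF wV] wi by (intro card_Diff1_less) auto
      finally show False by simp
    qed
    have uN: "u \<in> N" using uV ufix by (rule fixed)
    define y where "y = (\<lambda>j. v j - v i * u j)"
    have yV: "y \<in> V" unfolding y_def by (rule Vdiff[OF less.prems uV VK[OF less.prems]])
    have iv: "i \<in> ?S v" using wi w(1) by (auto simp: good_def)
    have "?S y \<subseteq> ?S v - {i}"
    proof
      fix j assume "j \<in> ?S y"
      then have yj: "y j \<noteq> 0" by simp
      then have "v j \<noteq> 0 \<or> u j \<noteq> 0" by (auto simp: y_def)
      then have "v j \<noteq> 0" using Su w(1) unfolding good_def by blast
      moreover have "j \<noteq> i" using yj by (auto simp: y_def ui)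
      ultimately show "j \<in> ?S v - {i}" by simp
    qed
    then have "card (?S y) \<le> card (?S v - {i})" using fin[OF less.prems] by (intro card_mono) auto
    also have "\<dots> < card (?S v)" using fin[OF less.prems] iv by (intro card_Diff1_less) auto
    finally have "y \<in> N" using yV by (rule less.hyps)
    from Nadd[OF this Nscale[OF VK[OF less.prems, of i] uN]] show ?thesis by (simp add: y_def)
  qed
qed

section \<open>Representations and their action on rational functions\<close>

lemma GL_iff: "A \<in> carrier (GL n) \<longleftrightarrow> A \<in> carrier_mat n n \<and> det A \<noteq> 0" for A :: "'c::field mat"
proof
  assume A: "A \<in> carrier (GL n)"
  then have "A \<in> Units (ring_mat TYPE('c) n ())" by (simp add: GL_def units_of_def)
  then show "A \<in> carrier_mat n n \<and> det A \<noteq> 0"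
    using unit_imp_det_non_zero[of A n "()"] by (auto simp: Units_def ring_mat_def)
next
  assume "A \<in> carrier_mat n n \<and> det A \<noteq> 0"
  then show "A \<in> carrier (GL n)"
    using det_non_zero_imp_unit[of A n "()"] by (simp add: GL_def units_of_def)
qed

lemma GL_simps: "monoid.mult (GL n) A B = A * B" "one (GL n) = 1\<^sub>m n"
  by (simp_all add: GL_def units_of_def ring_mat_def)

lemma group_GL: "Group.group (GL n :: 'c::field mat monoid)"
  unfolding GL_def
  by (rule monoid.units_group) (meson ring_mat ring_def)

lemma linear_algebraic_groupD:
  fixes G :: "'k::field_char_0 alg_closure mat set"
  assumes "linear_algebraic_group n G"
  shows "A \<in> G \<Longrightarrow> A \<in> carrier_mat n n" "A \<in> G \<Longrightarrow> det A \<noteq> 0" "1\<^sub>m n \<in> G"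
    "A \<in> G \<Longrightarrow> B \<in> G \<Longrightarrow> A * B \<in> G" "A \<in> G \<Longrightarrow> \<exists>B\<in>G. A * B = 1\<^sub>m n \<and> B * A = 1\<^sub>m n"
proof -
  have sg: "subgroup G (GL n)" using assms by (simp add: linear_algebraic_group_def)
  interpret g: Group.group "GL n :: 'k alg_closure mat monoid" by (rule group_GL)
  have mem: "A \<in> carrier (GL n)" if "A \<in> G" for A using subgroup.mem_carrier[OF sg that] .
  show "A \<in> G \<Longrightarrow> A \<in> carrier_mat n n" "A \<in> G \<Longrightarrow> det A \<noteq> 0" using mem[of A] by (simp_all add: GL_iff)
  show "1\<^sub>m n \<in> G" using subgroup.one_closed[OF sg] by (simp add: GL_simps)
  show "A \<in> G \<Longrightarrow> B \<in> G \<Longrightarrow> A * B \<in> G" using subgroup.m_closed[OF sg, of A B] by (simp add: GL_simps)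
  show "\<exists>B\<in>G. A * B = 1\<^sub>m n \<and> B * A = 1\<^sub>m n" if A: "A \<in> G"
    using subgroup.m_inv_closed[OF sg A] g.r_inv[OF mem[OF A]] g.l_inv[OF mem[OF A]]
    by (auto simp: GL_simps)
qed

lemma galois_groupD:
  assumes "\<tau> \<in> galois_group"
  shows "ring_map \<tau>" "\<tau> (to_ac c) = to_ac c" "bij \<tau>" "inv_into UNIV \<tau> \<in> galois_group" "\<tau> (inv_into UNIV \<tau> x) = x"
proof -
  have iso: "\<tau> \<in> ring_iso ring_of_type_algebra ring_of_type_algebra" and c: "\<And>c. \<tau> (to_ac c) = to_ac c"
    using assms by (auto simp: galois_group_def)
  show rm: "ring_map \<tau>" and b: "bij \<tau>"
    using iso unfolding ring_iso_def Ring.ring_hom_def ring_of_type_algebra_def ring_map_def by auto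
  show "\<tau> (to_ac c) = to_ac c" by (rule c)
  show inv: "\<tau> (inv_into UNIV \<tau> x) = x" for x using b by (simp add: bij_is_surj surj_f_inv_f)
  have "inv_into UNIV \<tau> (to_ac c) = to_ac c" for c using b c by (metis bij_inv_eq_iff)
  moreover have "inv_into UNIV \<tau> \<in> ring_iso ring_of_type_algebra ring_of_type_algebra"
  proof -
    have inj: "x = y" if "\<tau> x = \<tau> y" for x y using b that by (metis bij_pointE)
    have "inv_into UNIV \<tau> (x + y) = inv_into UNIV \<tau> x + inv_into UNIV \<tau> y" "inv_into UNIV \<tau> (x * y) = inv_into UNIV \<tau> x * inv_into UNIV \<tau> y" "inv_into UNIV \<tau> 1 = 1" for x y
      by (rule inj; simp add: inv ring_mapD[OF rm])+
    then show ?thesis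
      using bij_imp_bij_inv[OF b] unfolding ring_iso_def Ring.ring_hom_def ring_of_type_algebra_def by auto
  qed
  ultimately show "inv_into UNIV \<tau> \<in> galois_group" by (simp add: galois_group_def)
qed

lemma galois_eval_mat:
  assumes "\<tau> \<in> galois_group" and p: "p \<in> polys (range to_ac) ({..<n} \<times> {..<n})" and A: "A \<in> carrier_mat n n"
  shows "eval_mat p (map_mat \<tau> A) = \<tau> (eval_mat p A)"
  unfolding eval_mat_def
  by (subst ring_map_eval[OF galois_groupD(1)[OF assms(1)]], rule eval_mpoly_cong[OF p])
     (use A galois_groupD(2)[OF assms(1)] in auto)

lemma galois_det:
  assumes "\<tau> \<in> galois_group" and A: "A \<in> carrier_mat n n"
  shows "det (map_mat \<tau> A) = \<tau> (det A)"
proof -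
  note r = ring_mapD[OF galois_groupD(1)[OF assms(1)]]
  interpret comm_ring_hom \<tau> by unfold_locales (simp_all add: r)
  show ?thesis by (rule hom_det)
qed

text \<open>The equations of \<open>G\<close> have coefficients in the base field, which the Galois group fixes.\<close>
lemma galois_stable_group:
  fixes G :: "'k::field_char_0 alg_closure mat set"
  assumes G: "linear_algebraic_group n G" and \<tau>: "\<tau> \<in> galois_group" and A: "A \<in> G"
  shows "map_mat \<tau> A \<in> G"
proof -
  obtain P where P: "P \<subseteq> polys (range to_ac) ({..<n} \<times> {..<n})"
    and G': "G = {A \<in> carrier (GL n). \<forall>p\<in>P. eval_mat p A = 0}"
    using G by (auto simp: linear_algebraic_group_def zariski_closed_def)
  note An = linear_algebraic_groupD(1,2)[OF G A]
  note r = ring_mapD[OF galois_groupD(1)[OF \<tau>]] ring_map_inj_field[OF galois_groupD(1)[OF \<tau>]]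
  have "eval_mat p (map_mat \<tau> A) = 0" if "p \<in> P" for p
    using galois_eval_mat[OF \<tau> _ An(1), of p] P that A r(2) unfolding G' by auto
  moreover have "map_mat \<tau> A \<in> carrier (GL n)"
    unfolding GL_iff using An galois_det[OF \<tau> An(1)] r(11) by auto
  ultimately show ?thesis unfolding G' by blast
qed

locale representation =
  fixes n m :: nat and G :: "'k::field_char_0 alg_closure mat set"
    and \<rho> :: "'k alg_closure mat \<Rightarrow> 'k alg_closure mat"
  assumes group: "linear_algebraic_group n G" and action: "linear_action n G m \<rho>"
begin

lemma rho_carrier: "A \<in> G \<Longrightarrow> \<rho> A \<in> carrier_mat m m"
  and rho_mult: "A \<in> G \<Longrightarrow> B \<in> G \<Longrightarrow> \<rho> (A * B) = \<rho> A * \<rho> B"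
  and rho_det: "A \<in> G \<Longrightarrow> det (\<rho> A) \<noteq> 0"
  using action GL_iff[of _ m] unfolding linear_action_def hom_def by (auto simp: GL_simps Pi_iff)

lemma rho_one: "\<rho> (1\<^sub>m n) = 1\<^sub>m m"
proof -
  have 1: "1\<^sub>m n \<in> G" by (rule linear_algebraic_groupD[OF group])
  have hom: "\<rho> \<in> hom ((GL n)\<lparr>carrier := G\<rparr>) (GL m)" using action by (simp add: linear_action_def)
  interpret g: Group.group "GL n :: 'k alg_closure mat monoid" by (rule group_GL)
  interpret G: Group.group "(GL n :: 'k alg_closure mat monoid)\<lparr>carrier := G\<rparr>"
    using g.subgroup_imp_group group by (simp add: linear_algebraic_group_def)
  show ?thesis
    using hom_one[OF hom G.group_axioms group_GL] by (simp add: GL_simps)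
qed

lemma rho_galois:
  assumes "\<tau> \<in> galois_group" "A \<in> G" "i < m" "j < m"
  shows "\<rho> (map_mat \<tau> A) $$ (i, j) = \<tau> (\<rho> A $$ (i, j))"
proof -
  obtain p d where p: "p \<in> polys (range to_ac) ({..<n} \<times> {..<n})"
    and eq: "\<And>A. A \<in> G \<Longrightarrow> \<rho> A $$ (i, j) = eval_mat p A / det A ^ d"
    using action assms(3,4) unfolding linear_action_def by blast
  note A = linear_algebraic_groupD(1)[OF group assms(2)] and r = galois_groupD(1)[OF assms(1)]
  show ?thesis
    using eq[OF assms(2)] eq[OF galois_stable_group[OF group assms(1,2)]]
    by (simp add: galois_eval_mat[OF assms(1) p A] galois_det[OF assms(1) A] ring_map_divide[OF r] ring_mapD[OF r])
qed

end

lemma ring_map_lin_subst: "ring_map (lin_subst m B)"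
  unfolding lin_subst_def by (rule ring_map_eval_mpoly[OF ring_map_mconst])

lemma lin_subst_mconst: "lin_subst m B (mconst c) = mconst c"
  unfolding lin_subst_def by (rule eval_mpoly_mconst[OF ring_map_mconst])

lemma lin_subst_mvar:
  "lin_subst m B (mvar i) = (if i < m then \<Sum>j<m. mconst (B $$ (i, j)) * mvar j else mvar i)"
  unfolding lin_subst_def by (rule eval_mpoly_mvar[OF ring_map_mconst])

lemma mpoly_ring_map_eqI:
  fixes F F' :: "('x, 'c::comm_ring_1) mpoly \<Rightarrow> 'r::comm_ring_1"
  assumes "ring_map F" "ring_map F'" "\<And>c. F (mconst c) = F' (mconst c)" "\<And>x. F (mvar x) = F' (mvar x)"
  shows "F p = F' p"
  by (induction p rule: polys_induct[OF subring_set_UNIV in_polys_UNIV])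
     (simp_all add: assms ring_mapD[OF assms(1)] ring_mapD[OF assms(2)])

lemma ratfun_ring_map_eqI:
  fixes F F' :: "'c::field ratfun \<Rightarrow> 'f::field"
  assumes F: "ring_map F" "ring_map F'" and c: "\<And>c. F (rconst c) = F' (rconst c)"
    and v: "\<And>i. F (rvar i) = F' (rvar i)"
  shows "F f = F' f"
proof -
  have p: "F (of_poly p) = F' (of_poly p)" for p
    by (rule mpoly_ring_map_eqI[OF ring_map_compose[OF F(1) ring_map_of_poly] ring_map_compose[OF F(2) ring_map_of_poly]])
       (simp_all add: of_poly_mconst c v[unfolded rvar_def])
  obtain a b where "f = of_poly a / of_poly b" using Fract_as_quotient by (metis Fract_cases)
  then show ?thesis by (simp add: ring_map_divide[OF F(1)] ring_map_divide[OF F(2)] p)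
qed

lemma lin_subst_lin_subst:
  assumes "B \<in> carrier_mat m m" "B' \<in> carrier_mat m m"
  shows "lin_subst m B (lin_subst m B' p) = lin_subst m (B' * B) p"
proof (rule mpoly_ring_map_eqI[OF ring_map_compose[OF ring_map_lin_subst ring_map_lin_subst] ring_map_lin_subst])
  note r = ring_mapD[OF ring_map_lin_subst] and mc = ring_mapD[OF ring_map_mconst]
  fix i
  show "lin_subst m B (lin_subst m B' (mvar i)) = lin_subst m (B' * B) (mvar i)"
  proof (cases "i < m")
    case True
    have "lin_subst m B (lin_subst m B' (mvar i)) =
        (\<Sum>j<m. \<Sum>k<m. mconst (B' $$ (i, j)) * (mconst (B $$ (j, k)) * mvar k))"
      using True by (simp add: lin_subst_mvar r lin_subst_mconst sum_distrib_left)
    also have "\<dots> = (\<Sum>k<m. \<Sum>j<m. mconst (B' $$ (i, j)) * (mconst (B $$ (j, k)) * mvar k))"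
      by (rule sum.swap)
    also have "\<dots> = (\<Sum>k<m. mconst ((B' * B) $$ (i, k)) * mvar k)"
    proof (rule sum.cong)
      fix k assume "k \<in> {..<m}"
      then have "(B' * B) $$ (i, k) = (\<Sum>j<m. B' $$ (i, j) * B $$ (j, k))"
        using assms True by (simp add: scalar_prod_def lessThan_atLeast0)
      then show "(\<Sum>j<m. mconst (B' $$ (i, j)) * (mconst (B $$ (j, k)) * mvar k)) = mconst ((B' * B) $$ (i, k)) * mvar k"
        by (simp add: mc sum_distrib_right mult.assoc)
    qed simp
    finally show ?thesis using True by (simp add: lin_subst_mvar)
  qed (simp add: lin_subst_mvar)
qed (simp add: lin_subst_mconst)

lemma lin_subst_one: "lin_subst m (1\<^sub>m m) p = p"
proof (rule mpoly_ring_map_eqI[of "lin_subst m (1\<^sub>m m)" "\<lambda>p. p"])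
  note mc = ring_mapD[OF ring_map_mconst]
  fix i
  have "(\<Sum>j<m. mconst (1\<^sub>m m $$ (i, j)) * mvar j) = (\<Sum>j<m. if j = i then mvar i else (0 :: (nat, 'a) mpoly))" if "i < m"
    using that by (intro sum.cong) (auto simp: mc)
  then show "lin_subst m (1\<^sub>m m) (mvar i) = (mvar i :: (nat, 'a) mpoly)" by (auto simp: lin_subst_mvar)
qed (simp_all add: ring_map_lin_subst ring_map_id lin_subst_mconst)

lemma lin_subst_inj:
  assumes B: "B \<in> carrier_mat m m" "det B \<noteq> 0" and z: "lin_subst m B p = 0"
  shows "p = 0"
proof -
  have "B \<in> Units (ring_mat TYPE('a) m ())" by (rule det_non_zero_imp_unit[OF B])
  then obtain B' where B': "B' \<in> carrier_mat m m" "B * B' = 1\<^sub>m m"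
    unfolding Units_def ring_mat_def by auto
  have "p = lin_subst m (B * B') p" by (simp add: B' lin_subst_one)
  also have "\<dots> = lin_subst m B' (lin_subst m B p)" using lin_subst_lin_subst[OF B'(1) B(1)] by simp
  also have "\<dots> = 0" by (simp add: z ring_mapD[OF ring_map_lin_subst])
  finally show ?thesis .
qed

lemma map_mpoly_eval:
  assumes "ring_map h"
  shows "Poly_Mapping.map h p = eval_mpoly (\<lambda>c. mconst (h c)) mvar p"
proof (rule poly_mapping_eqI)
  fix k
  have "eval_mpoly (\<lambda>c. mconst (h c)) mvar p = (\<Sum>t\<in>Poly_Mapping.keys p. Poly_Mapping.single t (h (Poly_Mapping.lookup p t)))"
    unfolding eval_mpoly_def monom_value_def[symmetric] monom_as_product[symmetric] ..
  then have "Poly_Mapping.lookup (eval_mpoly (\<lambda>c. mconst (h c)) mvar p) k =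
      (\<Sum>t\<in>Poly_Mapping.keys p. if t = k then h (Poly_Mapping.lookup p k) else 0)"
    by (auto simp: lookup_sum lookup_single when_def intro!: sum.cong)
  then show "Poly_Mapping.lookup (Poly_Mapping.map h p) k = Poly_Mapping.lookup (eval_mpoly (\<lambda>c. mconst (h c)) mvar p) k"
    by (auto simp: Poly_Mapping.map.rep_eq when_def in_keys_iff)
qed

definition galois_map :: "('k::field_char_0 alg_closure \<Rightarrow> 'k alg_closure) \<Rightarrow> 'k alg_closure ratfun \<Rightarrow> 'k alg_closure ratfun"
  where "galois_map \<tau> = fract_map (Poly_Mapping.map \<tau>)"

lemma galois_map_props:
  fixes \<tau> :: "'k::field_char_0 alg_closure \<Rightarrow> 'k alg_closure"
  assumes "\<tau> \<in> galois_group"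
  shows "ring_map (galois_map \<tau>)" "galois_map \<tau> (rconst c) = rconst (\<tau> c)" "galois_map \<tau> (rvar i) = rvar i"
    "f \<in> ratfuns UNIV r \<Longrightarrow> galois_map \<tau> f \<in> ratfuns UNIV r"
proof -
  note \<tau> = galois_groupD(1)[OF assms]
  let ?m = "Poly_Mapping.map \<tau> :: (nat, 'k alg_closure) mpoly \<Rightarrow> _"
  have rc: "ring_map (\<lambda>c. mconst (\<tau> c) :: (nat, 'k alg_closure) mpoly)" by (rule ring_map_compose[OF ring_map_mconst \<tau>])
  have eq: "?m = eval_mpoly (\<lambda>c. mconst (\<tau> c)) mvar" by (rule ext) (rule map_mpoly_eval[OF \<tau>])
  have rm: "ring_map ?m" unfolding eq by (rule ring_map_eval_mpoly[OF rc])
  have inj: "p = 0" if "?m p = 0" for p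
    using that ring_map_inj_field[OF \<tau>] unfolding map_eq_zero_iff
    by (metis (no_types, lifting) poly_mapping_eqI lookup_zero in_keys_iff)
  have Fr: "galois_map \<tau> (Fract p q) = Fract (?m p) (?m q)" if "q \<noteq> 0" for p q
    unfolding galois_map_def by (rule fract_map_Fract[OF rm inj that])
  have op: "galois_map \<tau> (of_poly p) = of_poly (?m p)" for p
    using Fr[of 1 p] by (simp add: of_poly_def ring_mapD[OF rm])
  show R: "ring_map (galois_map \<tau>)" unfolding galois_map_def by (rule ring_map_fract_map[OF rm inj])
  show "galois_map \<tau> (rconst c) = rconst (\<tau> c)"
    unfolding of_poly_mconst[symmetric] op by (simp add: eq eval_mpoly_mconst[OF rc])
  show "galois_map \<tau> (rvar i) = rvar i" unfolding rvar_def op by (simp add: eq eval_mpoly_mvar[OF rc])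
  have mp: "?m p \<in> polys UNIV {..<r}" if "p \<in> polys UNIV {..<r}" for p
    unfolding eq using subring_set_polys[OF subring_set_UNIV] that
    by (rule eval_mpoly_in_subring) (auto intro: mconst_in_polys mvar_in_polys)
  show "f \<in> ratfuns UNIV r \<Longrightarrow> galois_map \<tau> f \<in> ratfuns UNIV r"
    unfolding ratfuns_iff using mp inj by (auto simp: ring_map_divide[OF R] op) metis
qed

definition lin_act :: "nat \<Rightarrow> 'c::field mat \<Rightarrow> 'c ratfun \<Rightarrow> 'c ratfun"
  where "lin_act m B = fract_map (lin_subst m B)"

lemma lin_act_props:
  fixes B :: "'c::field mat"
  assumes B: "B \<in> carrier_mat m m" "det B \<noteq> 0"
  shows "ring_map (lin_act m B)" "lin_act m B (rconst c) = rconst c"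
    "lin_act m B (rvar i) = (if i < m then \<Sum>j<m. rconst (B $$ (i, j)) * rvar j else rvar i)"
    "f \<in> ratfuns UNIV m \<Longrightarrow> lin_act m B f \<in> ratfuns UNIV m"
proof -
  note rm = ring_map_lin_subst[of m B] and inj = lin_subst_inj[OF B]
  have Fr: "lin_act m B (Fract p q) = Fract (lin_subst m B p) (lin_subst m B q)" if "q \<noteq> 0" for p q
    unfolding lin_act_def by (rule fract_map_Fract[OF rm inj that])
  have op: "lin_act m B (of_poly p) = of_poly (lin_subst m B p)" for p
    using Fr[of 1 p] by (simp add: of_poly_def ring_mapD[OF rm])
  show R: "ring_map (lin_act m B)" unfolding lin_act_def by (rule ring_map_fract_map[OF rm inj])
  show "lin_act m B (rconst c) = rconst c"
    unfolding of_poly_mconst[symmetric] op by (simp add: lin_subst_mconst)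
  show "lin_act m B (rvar i) = (if i < m then \<Sum>j<m. rconst (B $$ (i, j)) * rvar j else rvar i)"
    unfolding rvar_def op by (simp add: lin_subst_mvar ring_mapD[OF ring_map_of_poly] of_poly_mconst)
  have mp: "lin_subst m B p \<in> polys UNIV {..<m}" if "p \<in> polys UNIV {..<m}" for p
    unfolding lin_subst_def using subring_set_polys[OF subring_set_UNIV] that
  proof (rule eval_mpoly_in_subring)
    fix x assume "x \<in> {..<m}"
    then show "(if x < m then \<Sum>j<m. mconst (B $$ (x, j)) * mvar j else mvar x) \<in> polys UNIV {..<m}"
      by (auto intro!: polys_sum polys_mult mconst_in_polys mvar_in_polys subring_set_UNIV)
  qed (auto intro: mconst_in_polys)
  show "f \<in> ratfuns UNIV m \<Longrightarrow> lin_act m B f \<in> ratfuns UNIV m"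
    unfolding ratfuns_iff using mp inj by (auto simp: ring_map_divide[OF R] op) metis
qed

lemma lin_act_lin_act:
  assumes B: "B \<in> carrier_mat m m" "det B \<noteq> 0" "B' \<in> carrier_mat m m" "det B' \<noteq> 0"
  shows "lin_act m B (lin_act m B' f) = lin_act m (B' * B) f"
proof -
  have B'': "B' * B \<in> carrier_mat m m" "det (B' * B) \<noteq> 0" using B by (auto simp: det_mult)
  note r = lin_act_props[OF B(1,2)] and r' = lin_act_props[OF B(3,4)] and r'' = lin_act_props[OF B'']
  show ?thesis
  proof (rule ratfun_ring_map_eqI[of "\<lambda>f. lin_act m B (lin_act m B' f)"])
    show "ring_map (\<lambda>f. lin_act m B (lin_act m B' f))" by (rule ring_map_compose[OF r(1) r'(1)])
    fix i
    have "lin_act m B (lin_act m B' (rvar i)) = of_poly (lin_subst m B (lin_subst m B' (mvar i)))"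
      by (simp add: lin_subst_mvar ring_mapD[OF ring_map_lin_subst] lin_subst_mconst r r' ring_mapD[OF r(1)]
        ring_mapD[OF ring_map_of_poly] of_poly_mconst rvar_def[symmetric])
    also have "\<dots> = of_poly (lin_subst m (B' * B) (mvar i))" by (simp only: lin_subst_lin_subst[OF B(1,3)])
    also have "\<dots> = lin_act m (B' * B) (rvar i)"
      by (simp add: lin_subst_mvar r'' ring_mapD[OF ring_map_of_poly] of_poly_mconst rvar_def[symmetric])
    finally show "lin_act m B (lin_act m B' (rvar i)) = lin_act m (B' * B) (rvar i)" .
  qed (simp_all add: r r' r'')
qed

context representation
begin

abbreviation act :: "'k alg_closure mat \<Rightarrow> 'k alg_closure ratfun \<Rightarrow> 'k alg_closure ratfun"
  where "act A \<equiv> lin_act m (\<rho> A)"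

lemmas act_props = lin_act_props[OF rho_carrier rho_det]

lemma act_act: "A \<in> G \<Longrightarrow> B \<in> G \<Longrightarrow> act A (act B f) = act (B * A) f"
  by (simp add: lin_act_lin_act rho_carrier rho_det rho_mult)

text \<open>The representation is defined over the base field, so conjugating it by the Galois group only moves the
  group element.\<close>
lemma galois_act:
  assumes "\<tau> \<in> galois_group" "A \<in> G"
  shows "galois_map \<tau> (act A f) = act (map_mat \<tau> A) (galois_map \<tau> f)"
proof -
  note A = galois_stable_group[OF group assms]
  note g = galois_map_props[OF assms(1)] and gr = ring_mapD[OF galois_map_props(1)[OF assms(1)]]
  note a = act_props[OF assms(2) assms(2)] and a' = act_props[OF A A]
  show ?thesis
  proof (rule ratfun_ring_map_eqI[of "\<lambda>f. galois_map \<tau> (act A f)" "\<lambda>f. act (map_mat \<tau> A) (galois_map \<tau> f)"])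
    show "ring_map (\<lambda>f. galois_map \<tau> (act A f))" by (rule ring_map_compose[OF g(1) a(1)])
    show "ring_map (\<lambda>f. act (map_mat \<tau> A) (galois_map \<tau> f))" by (rule ring_map_compose[OF a'(1) g(1)])
    fix i
    show "galois_map \<tau> (act A (rvar i)) = act (map_mat \<tau> A) (galois_map \<tau> (rvar i))"
      by (simp add: a a' g gr rho_galois[OF assms])
  qed (simp_all add: a a' g)
qed

lemma invariant_field_iff:
  "f \<in> invariant_field G m \<rho> \<longleftrightarrow> f \<in> ratfuns UNIV m \<and> (\<forall>A\<in>G. act A f = f) \<and> (\<forall>\<tau>\<in>galois_group. galois_map \<tau> f = f)"
  by (simp add: invariant_field_def lin_act_def galois_map_def)

end

section \<open>Functions on the group built from orbit maps\<close>

context representation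
begin

abbreviation "L \<equiv> ratfuns (UNIV :: 'k alg_closure set) m"

definition "galois_fixed = {r \<in> L. \<forall>\<tau>\<in>galois_group. galois_map \<tau> r = r}"

text \<open>A vector \<open>v\<close> in \<open>combs\<close> is the formal sum of the \<open>v r\<close> times \<open>r\<close>, with \<open>r\<close> ranging over the Galois invariant
  rational functions on \<open>V\<close>, and \<open>comb_value\<close> is the sum of the terms \<open>c(v) r(gv)\<close> that it stands for, viewed as
  a function of \<open>g\<close> with values in \<open>L\<close>. Formal sums are kept apart from the functions that they represent because
  descent needs coordinates on which the symmetries act.\<close>
definition "combs = {v. finite {r. v r \<noteq> 0} \<and> (\<forall>r. v r \<in> L) \<and> (\<forall>r. v r \<noteq> 0 \<longrightarrow> r \<in> galois_fixed)}"

definition comb_value :: "('k alg_closure ratfun \<Rightarrow> 'k alg_closure ratfun) \<Rightarrow> 'k alg_closure mat \<Rightarrow> 'k alg_closure ratfun"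
  where "comb_value v A = (\<Sum>r | v r \<noteq> 0. v r * act A r)"

lemma L_subfield: "subfield_set L"
  by (rule subfield_set_ratfuns[OF subring_set_UNIV])

lemmas L_subring = subfield_setD(1)[OF L_subfield]
lemmas L_closed = subring_setD[OF L_subring]

lemma combsD:
  assumes "v \<in> combs"
  shows "finite {r. v r \<noteq> 0}" "v r \<in> L" "v r \<noteq> 0 \<Longrightarrow> r \<in> galois_fixed"
  using assms unfolding combs_def by blast+

lemma comb_value_superset:
  assumes "finite F" "{r. v r \<noteq> 0} \<subseteq> F"
  shows "comb_value v A = (\<Sum>r\<in>F. v r * act A r)"
  unfolding comb_value_def using assms by (intro sum.mono_neutral_left) auto

lemma combs_zero: "(\<lambda>r. 0) \<in> combs" "comb_value (\<lambda>r. 0) A = 0"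
  using L_closed(2) by (simp_all add: combs_def comb_value_def)

lemma combs_add:
  assumes "v \<in> combs" "w \<in> combs"
  shows "(\<lambda>r. v r + w r) \<in> combs" "comb_value (\<lambda>r. v r + w r) A = comb_value v A + comb_value w A"
proof -
  let ?F = "{r. v r \<noteq> 0} \<union> {r. w r \<noteq> 0}"
  have F: "finite ?F" using combsD(1)[OF assms(1)] combsD(1)[OF assms(2)] by simp
  have sub: "{r. v r + w r \<noteq> 0} \<subseteq> ?F" by auto
  have "v r + w r \<noteq> 0 \<Longrightarrow> r \<in> galois_fixed" for r
    using combsD(3)[OF assms(1), of r] combsD(3)[OF assms(2), of r] by (cases "v r = 0") auto
  moreover have "v r + w r \<in> L" for r using L_closed(3) combsD(2)[OF assms(1)] combsD(2)[OF assms(2)] .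
  ultimately show "(\<lambda>r. v r + w r) \<in> combs"
    using finite_subset[OF sub F] by (simp add: combs_def)
  show "comb_value (\<lambda>r. v r + w r) A = comb_value v A + comb_value w A"
    by (simp add: comb_value_superset[OF F] sub sum.distrib distrib_right)
qed

lemma combs_map:
  assumes v: "v \<in> combs" and h: "h 0 = 0" "\<And>x. x \<in> L \<Longrightarrow> h x \<in> L"
  shows "(\<lambda>r. h (v r)) \<in> combs" "comb_value (\<lambda>r. h (v r)) A = (\<Sum>r | v r \<noteq> 0. h (v r) * act A r)"
proof -
  have sub: "{r. h (v r) \<noteq> 0} \<subseteq> {r. v r \<noteq> 0}" using h(1) by auto
  have "h (v r) \<noteq> 0 \<Longrightarrow> r \<in> galois_fixed" for r
    using combsD(3)[OF v, of r] h(1) by (cases "v r = 0") auto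
  then show "(\<lambda>r. h (v r)) \<in> combs"
    using finite_subset[OF sub combsD(1)[OF v]] h(2)[OF combsD(2)[OF v]] by (simp add: combs_def)
  show "comb_value (\<lambda>r. h (v r)) A = (\<Sum>r | v r \<noteq> 0. h (v r) * act A r)"
    by (rule comb_value_superset[OF combsD(1)[OF v] sub])
qed

lemma combs_scale:
  assumes "c \<in> L" "v \<in> combs"
  shows "(\<lambda>r. c * v r) \<in> combs" "comb_value (\<lambda>r. c * v r) A = c * comb_value v A"
  using combs_map[OF assms(2), of "\<lambda>x. c * x"] L_closed(4)[OF assms(1)]
  by (simp_all add: comb_value_def sum_distrib_left mult.assoc)

lemma combs_sum:
  assumes "\<And>i. i \<in> I \<Longrightarrow> v i \<in> combs"
  shows "(\<lambda>r. \<Sum>i\<in>I. v i r) \<in> combs" "comb_value (\<lambda>r. \<Sum>i\<in>I. v i r) A = (\<Sum>i\<in>I. comb_value (v i) A)"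
proof -
  have "(\<lambda>r. \<Sum>i\<in>I. v i r) \<in> combs \<and> comb_value (\<lambda>r. \<Sum>i\<in>I. v i r) A = (\<Sum>i\<in>I. comb_value (v i) A)"
    using assms by (induction I rule: infinite_finite_induct) (simp_all add: combs_zero combs_add)
  then show "(\<lambda>r. \<Sum>i\<in>I. v i r) \<in> combs" "comb_value (\<lambda>r. \<Sum>i\<in>I. v i r) A = (\<Sum>i\<in>I. comb_value (v i) A)"
    by blast+
qed

lemma combs_single:
  assumes "c \<in> L" "r \<in> galois_fixed"
  shows "(\<lambda>s. if s = r then c else 0) \<in> combs" "comb_value (\<lambda>s. if s = r then c else 0) A = c * act A r"
proof -
  have fin: "finite {s. (if s = r then c else 0) \<noteq> 0}" by (rule finite_subset[of _ "{r}"]) auto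
  then show "(\<lambda>s. if s = r then c else 0) \<in> combs"
    using assms L_closed(2) by (simp add: combs_def)
  show "comb_value (\<lambda>s. if s = r then c else 0) A = c * act A r"
    by (subst comb_value_superset[of "{r}"]) auto
qed

lemma galois_fixed_mult: "r \<in> galois_fixed \<Longrightarrow> s \<in> galois_fixed \<Longrightarrow> r * s \<in> galois_fixed"
  using L_closed(4) by (simp add: galois_fixed_def ring_mapD(4)[OF galois_map_props(1)])

lemma galois_fixed_one: "1 \<in> galois_fixed"
  using L_closed(1) by (simp add: galois_fixed_def ring_mapD(1)[OF galois_map_props(1)])

lemma galois_fixed_rvar: "i < m \<Longrightarrow> rvar i \<in> galois_fixed"
  by (simp add: galois_fixed_def galois_map_props(3) rvar_in_ratfuns[OF subring_set_UNIV])

definition "comb_functions = {f. \<exists>v\<in>combs. \<forall>A\<in>G. f A = comb_value v A}"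

lemma comb_functions_single:
  assumes "c \<in> L" "r \<in> galois_fixed" "\<And>A. A \<in> G \<Longrightarrow> f A = c * act A r"
  shows "f \<in> comb_functions"
  unfolding comb_functions_def using combs_single[OF assms(1,2)] assms(3)
  by (intro CollectI bexI[of _ "\<lambda>s. if s = r then c else 0"]) simp_all

lemma comb_functions_add:
  assumes "f \<in> comb_functions" "g \<in> comb_functions"
  shows "f + g \<in> comb_functions"
proof -
  obtain v w where "v \<in> combs" "w \<in> combs" "\<forall>A\<in>G. f A = comb_value v A" "\<forall>A\<in>G. g A = comb_value w A"
    using assms unfolding comb_functions_def by blast
  then show ?thesis unfolding comb_functions_def
    by (intro CollectI bexI[of _ "\<lambda>r. v r + w r"]) (simp_all add: combs_add)
qed

lemma comb_functions_sum:
  assumes "\<And>i. i \<in> I \<Longrightarrow> f i \<in> comb_functions"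
  shows "(\<Sum>i\<in>I. f i) \<in> comb_functions"
proof -
  have "0 \<in> comb_functions" unfolding comb_functions_def
    by (intro CollectI bexI[OF _ combs_zero(1)]) (simp add: combs_zero)
  then show ?thesis
    using assms by (induction I rule: infinite_finite_induct) (simp_all add: comb_functions_add)
qed

lemma sum_fun_apply: "(\<Sum>i\<in>I. f i) x = (\<Sum>i\<in>I. f i x)" for f :: "'i \<Rightarrow> 'x \<Rightarrow> 'b::comm_monoid_add"
  by (induction I rule: infinite_finite_induct) simp_all

text \<open>Multiplication of values corresponds to multiplication of the \<open>r\<close>, since the action is by
  field automorphisms.\<close>
lemma comb_functions_mult:
  assumes f: "f \<in> comb_functions" and g: "g \<in> comb_functions"
  shows "f * g \<in> comb_functions"
proof -
  obtain v where v: "v \<in> combs" "\<And>A. A \<in> G \<Longrightarrow> f A = comb_value v A" using f unfolding comb_functions_def by blast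
  obtain w where w: "w \<in> combs" "\<And>A. A \<in> G \<Longrightarrow> g A = comb_value w A" using g unfolding comb_functions_def by blast
  let ?h = "\<Sum>r | v r \<noteq> 0. \<Sum>s | w s \<noteq> 0. (\<lambda>A. (v r * w s) * act A (r * s))"
  have "?h \<in> comb_functions"
  proof (intro comb_functions_sum)
    fix r s assume "r \<in> {r. v r \<noteq> 0}" "s \<in> {s. w s \<noteq> 0}"
    then have rs: "r \<in> galois_fixed" "s \<in> galois_fixed" using combsD(3)[OF v(1)] combsD(3)[OF w(1)] by blast+
    show "(\<lambda>A. (v r * w s) * act A (r * s)) \<in> comb_functions"
      by (rule comb_functions_single[OF L_closed(4)[OF combsD(2)[OF v(1), of r] combsD(2)[OF w(1), of s]] galois_fixed_mult[OF rs]]) simp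
  qed
  then obtain u where u: "u \<in> combs" "\<And>A. A \<in> G \<Longrightarrow> ?h A = comb_value u A" unfolding comb_functions_def by blast
  have "(f * g) A = comb_value u A" if A: "A \<in> G" for A
  proof -
    have "f A * g A = ?h A"
      by (simp add: v(2)[OF A] w(2)[OF A] comb_value_def sum_product sum_fun_apply
          ring_mapD(4)[OF act_props(1)[OF A A]] mult_ac)
    then show ?thesis using u(2)[OF A] by simp
  qed
  then show ?thesis unfolding comb_functions_def using u(1) by blast
qed

lemma comb_functions_const: "c \<in> L \<Longrightarrow> (\<lambda>A. c) \<in> comb_functions"
  by (rule comb_functions_single[OF _ galois_fixed_one])
     (simp_all add: ring_mapD(1)[OF act_props(1)])

lemma subring_comb_functions: "subring_set comb_functions"
  unfolding subring_set_def
proof (intro conjI ballI)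
  show "1 \<in> comb_functions" using comb_functions_const[OF L_closed(1)] by (simp add: one_fun_def)
  fix f g assume fg: "f \<in> comb_functions" "g \<in> comb_functions"
  show "f + g \<in> comb_functions" "f * g \<in> comb_functions"
    using comb_functions_add[OF fg] comb_functions_mult[OF fg] .
  have "- f = (\<lambda>A. - 1) * f" by (rule ext) simp
  then show "- f \<in> comb_functions"
    using comb_functions_mult[OF comb_functions_const[OF L_closed(5)[OF L_closed(1)]] fg(1)] by simp
qed

end

section \<open>Entries of representations as functions on orbits\<close>

lemma specialisation_det:
  assumes sp: "specialisation A P \<psi>" "subring_set A" and M: "M \<in> carrier_mat n n"
    and ent: "\<And>i j. i < n \<Longrightarrow> j < n \<Longrightarrow> M $$ (i, j) \<in> A"
  shows "det M \<in> A" "\<psi> (det M) = det (map_mat \<psi> M)"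
proof -
  note d = specialisationD[OF sp] and s = subring_setD[OF sp(2)]
  have sgn: "signof p \<in> A" "\<psi> (signof p) = signof p" for p :: "nat \<Rightarrow> nat"
    using d s by (auto simp: sign_def)
  have ent': "M $$ (i, p i) \<in> A" if "p permutes {0..<n}" "i \<in> {0..<n}" for p i
    using that ent permutes_in_image[of p "{0..<n}" i] by auto
  have pr: "(\<Prod>i = 0..<n. M $$ (i, p i)) \<in> A" if "p permutes {0..<n}" for p
    by (rule subring_set_prod[OF sp(2) ent'[OF that]])
  have summand: "signof p * (\<Prod>i = 0..<n. M $$ (i, p i)) \<in> A" if "p permutes {0..<n}" for p
    by (rule s(4)[OF sgn(1) pr[OF that]])
  show "det M \<in> A" unfolding det_def'[OF M] by (rule subring_set_sum[OF sp(2)]) (use summand in simp)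
  have "\<psi> (det M) = (\<Sum>p | p permutes {0..<n}. \<psi> (signof p * (\<Prod>i = 0..<n. M $$ (i, p i))))"
    unfolding det_def'[OF M] by (rule specialisation_sum[OF sp]) (use summand in simp)
  also have "\<dots> = (\<Sum>p | p permutes {0..<n}. signof p * (\<Prod>i = 0..<n. map_mat \<psi> M $$ (i, p i)))"
  proof (rule sum.cong)
    fix p assume "p \<in> {p. p permutes {0..<n}}"
    then have p: "p permutes {0..<n}" by simp
    have "\<psi> (\<Prod>i = 0..<n. M $$ (i, p i)) = (\<Prod>i = 0..<n. \<psi> (M $$ (i, p i)))"
      by (rule specialisation_prod[OF sp ent'[OF p]])
    also have "\<dots> = (\<Prod>i = 0..<n. map_mat \<psi> M $$ (i, p i))"
      using M permutes_in_image[OF p] by (intro prod.cong) auto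
    finally show "\<psi> (signof p * (\<Prod>i = 0..<n. M $$ (i, p i))) = signof p * (\<Prod>i = 0..<n. map_mat \<psi> M $$ (i, p i))"
      using d(4)[OF sgn(1) pr[OF p]] sgn(2) by simp
  qed simp
  also have "\<dots> = det (map_mat \<psi> M)" using det_def'[of "map_mat \<psi> M" n] M by simp
  finally show "\<psi> (det M) = det (map_mat \<psi> M)" .
qed

lemma ring_map_apply: "ring_map (\<lambda>f. f x)" for x :: 'x
  by (simp add: ring_map_def)

lemma ring_map_constant: "ring_map h \<Longrightarrow> ring_map (\<lambda>c. (\<lambda>_ :: 'x. h c))"
  by (simp add: ring_map_def fun_eq_iff)

lemma eval_mpoly_apply: "(eval_mpoly h \<alpha> p) x = eval_mpoly (\<lambda>c. h c x) (\<lambda>i. \<alpha> i x) p"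
  for h :: "'c::zero \<Rightarrow> 'x \<Rightarrow> 'r::comm_ring_1"
  by (rule ring_map_eval[OF ring_map_apply])

lemma fun_power_apply: "(f ^ k) x = f x ^ k" for f :: "'x \<Rightarrow> 'r::comm_ring_1"
  by (rule ring_mapD(7)[OF ring_map_apply])

locale almost_free_representation = representation +
  assumes free: "almost_free n G m \<rho>"

lemma rconst_eq_iff: "rconst c = rconst c' \<longleftrightarrow> c = c'"
  using ring_map_inj_field[OF ring_map_rconst, of "c - c'"] by (simp add: ring_mapD[OF ring_map_rconst])

text \<open>This applies \<open>separated_function_rational\<close> to functions from \<open>G\<close> to \<open>L\<close>. The ring \<open>B\<close> is generated by the
  constants and by the coordinates of \<open>v\<close> and of \<open>gv\<close>; the ring \<open>R\<close> contains in addition the entries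
  of \<open>g\<close> and the inverse of the determinant. A specialisation of \<open>R\<close> is a pair of a point \<open>v\<close> and an element \<open>g\<close> of
  \<open>G\<close>, and its restriction to \<open>B\<close> records \<open>v\<close> and \<open>gv\<close>. If two such pairs have the same restriction, then
  \<open>g\<close> and \<open>g'\<close> differ by an element of the stabiliser of \<open>v\<close>, which is trivial where \<open>\<pi>\<close>, one of the polynomials
  that define the open set of the almost free action, is not zero. So every regular function on \<open>G\<close> is a
  quotient of elements of \<open>B\<close>.\<close>
lemma (in almost_free_representation) representation_entries_rational:
  assumes \<sigma>: "representation n d G \<sigma>"
  obtains q where "q \<in> combs" "\<exists>A\<in>G. comb_value q A \<noteq> 0"
    "\<And>i j. i < d \<Longrightarrow> j < d \<Longrightarrow> \<exists>w\<in>combs. \<forall>A\<in>G. comb_value q A * rconst (\<sigma> A $$ (i, j)) = comb_value w A"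
proof -
  interpret S: representation n d G \<sigma> by (rule \<sigma>)
  let ?cst = "\<lambda>c :: 'a alg_closure. (\<lambda>_ :: 'a alg_closure mat. rconst c)"
  let ?x = "\<lambda>l. (\<lambda>_ :: 'a alg_closure mat. rvar l :: 'a alg_closure ratfun)"
  let ?y = "\<lambda>l A. act A (rvar l)"
  let ?g = "\<lambda>ij :: nat \<times> nat. (\<lambda>A :: 'a alg_closure mat. rconst (A $$ ij))"
  let ?t = "\<lambda>A :: 'a alg_closure mat. rconst (1 / det A)"
  define C0 where "C0 = range ?cst"
  define Z :: "('a alg_closure mat \<Rightarrow> 'a alg_closure ratfun) set" where "Z = {f. \<forall>A\<in>G. f A = 0}"
  define us where "us = map ?x [0..<m] @ map ?y [0..<m]"
  define vs where "vs = ?t # map ?g (List.product [0..<n] [0..<n])"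
  define B where "B = adjoin_list C0 us"
  define R where "R = adjoin_list B vs"
  note G = linear_algebraic_groupD[OF group]
  note rc = ring_mapD[OF ring_map_rconst]
  have rcst: "ring_map ?cst" by (rule ring_map_constant[OF ring_map_rconst])
  note cst = ring_mapD[OF rcst]
  have C0: "subring_set C0" unfolding subring_set_def C0_def
  proof (intro conjI ballI)
    show "1 \<in> range ?cst" using cst(1) by (metis rangeI)
    fix a b assume "a \<in> range ?cst" "b \<in> range ?cst"
    then obtain c c' where cc: "a = ?cst c" "b = ?cst c'" by blast
    show "a + b \<in> range ?cst" unfolding cc cst(3)[symmetric] by (rule rangeI)
    show "a * b \<in> range ?cst" unfolding cc cst(4)[symmetric] by (rule rangeI)
    show "- a \<in> range ?cst" unfolding cc cst(5)[symmetric] by (rule rangeI)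
  qed
  have cst_inj: "c = c'" if "?cst c = ?cst c'" for c c'
  proof -
    have "?cst c undefined = ?cst c' undefined" using that by (rule fun_cong)
    then show ?thesis by (simp add: rconst_eq_iff)
  qed
  \<comment> \<open>Constant functions specialise to their constants.\<close>
  define \<phi>0 where "\<phi>0 f = (SOME c. f = ?cst c)" for f
  have \<phi>0: "\<phi>0 (?cst c) = c" for c
    unfolding \<phi>0_def by (rule some_equality) (use cst_inj in blast)+
  have sp0: "specialisation C0 {0} \<phi>0"
    unfolding specialisation_def
  proof (intro conjI ballI)
    show "\<phi>0 1 = 1" using \<phi>0[of 1] by (simp only: cst(1))
    fix a b assume "a \<in> C0" "b \<in> C0"
    then obtain c c' where cc: "a = ?cst c" "b = ?cst c'" unfolding C0_def by blast
    show "\<phi>0 (a + b) = \<phi>0 a + \<phi>0 b" unfolding cc cst(3)[symmetric] \<phi>0 ..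
    show "\<phi>0 (a * b) = \<phi>0 a * \<phi>0 b" unfolding cc cst(4)[symmetric] \<phi>0 ..
  next
    fix a assume "a \<in> C0 \<inter> {0}"
    then have "a = ?cst 0" by (simp only: cst(2)) simp
    then show "\<phi>0 a = 0" using \<phi>0[of 0] by simp
  qed
  have units: "\<exists>c'\<in>C0. c * c' = 1" if c: "c \<in> C0" "c \<noteq> 0" for c
  proof -
    obtain a where a: "c = ?cst a" using c(1) unfolding C0_def by blast
    have "a \<noteq> 0" using c(2) a cst(2) by metis
    then have "c * ?cst (inverse a) = 1" unfolding a cst(4)[symmetric] using cst(1) by simp
    then show ?thesis unfolding C0_def by blast
  qed
  have char0: "of_nat k \<noteq> (0 :: 'a alg_closure mat \<Rightarrow> 'a alg_closure ratfun)" if "k > 0" for k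
  proof
    assume "of_nat k = (0 :: 'a alg_closure mat \<Rightarrow> 'a alg_closure ratfun)"
    then have "?cst (of_nat k) = ?cst 0" unfolding cst(8) cst(2) .
    then have "(of_nat k :: 'a alg_closure) = 0" by (rule cst_inj)
    then show False using that by simp
  qed
  have Z: "radical_ideal Z" by (simp add: radical_ideal_def Z_def)
  note Bp = adjoin_list_props[OF C0, of us, folded B_def]
  note Rp = adjoin_list_props[OF Bp(1), of vs, folded R_def]
  note sB = subring_setD[OF Bp(1)] and sR = subring_setD[OF Rp(1)]
  have cstB: "?cst c \<in> B" for c using Bp(2) unfolding C0_def by blast
  have cstR: "?cst c \<in> R" for c using cstB Rp(2) by blast
  have xB: "?x l \<in> B" "?y l \<in> B" if "l < m" for l using Bp(3) that unfolding us_def by auto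
  have xR: "?x l \<in> R" "?y l \<in> R" if "l < m" for l using xB[OF that] Rp(2) by blast+
  have gR: "?g (i, j) \<in> R" if "i < n" "j < n" for i j using Rp(3) that unfolding vs_def by auto
  have tR: "?t \<in> R" using Rp(3) unfolding vs_def by auto
  obtain P where P: "P \<subseteq> polys (range to_ac) {..<m}" and U: "{v \<in> carrier_vec m. \<exists>p\<in>P. eval_mpoly (\<lambda>c. c) (\<lambda>i. v $ i) p \<noteq> 0} \<noteq> {}"
    and stab: "\<And>v p A. v \<in> carrier_vec m \<Longrightarrow> p \<in> P \<Longrightarrow> eval_mpoly (\<lambda>c. c) (\<lambda>i. v $ i) p \<noteq> 0 \<Longrightarrow> A \<in> G \<Longrightarrow>
      \<rho> A *\<^sub>v v = v \<Longrightarrow> A = 1\<^sub>m n"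
  proof -
    obtain P where P: "P \<subseteq> polys (range to_ac) {..<m}"
      and U: "{v \<in> carrier_vec m. \<exists>p\<in>P. eval_mpoly (\<lambda>c. c) (\<lambda>i. v $ i) p \<noteq> 0} \<noteq> {}"
      and st: "\<forall>v\<in>{v \<in> carrier_vec m. \<exists>p\<in>P. eval_mpoly (\<lambda>c. c) (\<lambda>i. v $ i) p \<noteq> 0}. {A \<in> G. \<rho> A *\<^sub>v v = v} = {1\<^sub>m n}"
      using free unfolding almost_free_def Let_def by blast
    show ?thesis by (rule that[OF P U]) (use st in blast)
  qed
  obtain p and v0 :: "'a alg_closure vec" where p: "p \<in> P" and "eval_mpoly (\<lambda>c. c) (\<lambda>i. v0 $ i) p \<noteq> 0" using U by blast
  then have p0: "p \<noteq> 0" by (auto simp: eval_mpoly_0[OF ring_map_id])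
  have pm: "p \<in> polys UNIV {..<m}" using P p polys_mono[OF _ subset_UNIV order.refl] by blast
  define \<pi> where "\<pi> = eval_mpoly ?cst ?x p"
  have \<pi>A: "\<pi> A = of_poly p" for A
    unfolding \<pi>_def eval_mpoly_apply by (simp add: of_poly_eval)
  have \<pi>B: "\<pi> \<in> B" unfolding \<pi>_def by (rule eval_mpoly_in_subring[OF Bp(1) pm]) (auto intro: cstB xB)
  have \<pi>Z: "\<pi> ^ i \<notin> Z" for i
    using G(3) p0 by (auto simp: Z_def fun_power_apply \<pi>A of_poly_eq_0_iff)
  \<comment> \<open>The point of \<open>G\<close> defined by a specialisation of the coordinate ring.\<close>
  define pt where "pt \<psi> = mat n n (\<lambda>ij. \<psi> (?g ij))"
    for \<psi> :: "('a alg_closure mat \<Rightarrow> 'a alg_closure ratfun) \<Rightarrow> 'a alg_closure"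
  \<comment> \<open>The regular function on \<open>GL\<close> with numerator \<open>q\<close> and denominator a power of the determinant.\<close>
  define reg where "reg q e = eval_mpoly ?cst ?g q * ?t ^ e" for q :: "(nat \<times> nat, 'a alg_closure) mpoly" and e :: nat
  have regA: "reg q e A = rconst (eval_mat q A / det A ^ e)" for q e A
  proof -
    have "reg q e A = rconst (eval_mat q A) * rconst (1 / det A) ^ e"
      by (simp add: reg_def eval_mat_def eval_mpoly_apply fun_power_apply ring_map_eval[OF ring_map_rconst])
    also have "\<dots> = rconst (eval_mat q A * (1 / det A) ^ e)" by (simp only: rc(4,7))
    finally show ?thesis by (simp add: power_one_over)
  qed
  have regR: "reg q e \<in> R" if q: "q \<in> polys C ({..<n} \<times> {..<n})" for q e C
  proof -
    have "eval_mpoly ?cst ?g q \<in> R" by (rule eval_mpoly_in_subring[OF Rp(1) q]) (use cstR gR in auto)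
    then show ?thesis unfolding reg_def using sR(7)[OF tR] by (rule sR(4))
  qed
  have spec_pt: "pt \<psi> \<in> G \<and> (\<forall>q e. q \<in> polys (range to_ac) ({..<n} \<times> {..<n}) \<longrightarrow>
      \<psi> (reg q e) = eval_mat q (pt \<psi>) / det (pt \<psi>) ^ e)"
    if sp: "specialisation R Z \<psi>" and \<psi>c: "\<And>c. \<psi> (?cst c) = c" for \<psi>
  proof -
    note d = specialisationD[OF sp Rp(1)]
    have ev: "\<psi> (eval_mpoly ?cst ?g q) = eval_mat q (pt \<psi>)" and evR: "eval_mpoly ?cst ?g q \<in> R"
      if q: "q \<in> polys (range to_ac) ({..<n} \<times> {..<n})" for q
    proof -
      have "\<psi> (eval_mpoly ?cst ?g q) = eval_mpoly (\<lambda>c. \<psi> (?cst c)) (\<lambda>ij. \<psi> (?g ij)) q"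
        by (rule specialisation_eval_mpoly[OF sp Rp(1) q]) (use cstR gR in auto)
      also have "\<dots> = eval_mat q (pt \<psi>)"
        unfolding eval_mat_def by (rule eval_mpoly_cong[OF q]) (auto simp: pt_def \<psi>c)
      finally show "\<psi> (eval_mpoly ?cst ?g q) = eval_mat q (pt \<psi>)" .
      show "eval_mpoly ?cst ?g q \<in> R" by (rule eval_mpoly_in_subring[OF Rp(1) q]) (use cstR gR in auto)
    qed
    define M where "M = mat n n ?g"
    have M: "M \<in> carrier_mat n n" by (simp add: M_def)
    have ent: "M $$ (i, j) \<in> R" if "i < n" "j < n" for i j using gR that by (simp add: M_def)
    have "map_mat \<psi> M = pt \<psi>" by (rule eq_matI) (simp_all add: M_def pt_def)
    then have detM: "det M \<in> R" "\<psi> (det M) = det (pt \<psi>)" using specialisation_det[OF sp Rp(1) M ent] by simp_all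
    have "det M * ?t - 1 \<in> Z"
    proof -
      have "(det M) A * ?t A = 1" if A: "A \<in> G" for A
      proof -
        interpret comm_ring_hom "\<lambda>f :: 'a alg_closure mat \<Rightarrow> 'a alg_closure ratfun. f A" by unfold_locales simp_all
        interpret rh: comm_ring_hom "rconst :: 'a alg_closure \<Rightarrow> 'a alg_closure ratfun" by unfold_locales (simp_all add: rc)
        have "map_mat (\<lambda>f. f A) M = map_mat rconst A"
          using G(1)[OF A] by (intro eq_matI) (auto simp: M_def)
        then have "(det M) A = rconst (det A)" using hom_det[of M] rh.hom_det[of A] by simp
        then show ?thesis using G(2)[OF A] by (simp add: rc(4)[symmetric] rc(1))
      qed
      then show ?thesis by (simp add: Z_def)
    qed
    then have "\<psi> (det M * ?t - 1) = 0" using detM tR sR by (intro d(5)) simp_all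
    then have dt: "det (pt \<psi>) * \<psi> ?t = 1" using d(7)[OF sR(4)[OF detM(1) tR] sR(1)] d(4)[OF detM(1) tR] detM(2) d(1) by simp
    then have det0: "det (pt \<psi>) \<noteq> 0" by auto
    obtain E where E: "E \<subseteq> polys (range to_ac) ({..<n} \<times> {..<n})"
      and G': "G = {A \<in> carrier (GL n). \<forall>p\<in>E. eval_mat p A = 0}"
      using group by (auto simp: linear_algebraic_group_def zariski_closed_def)
    have "eval_mat q (pt \<psi>) = 0" if q: "q \<in> E" for q
    proof -
      have qp: "q \<in> polys (range to_ac) ({..<n} \<times> {..<n})" using q E by blast
      have "(eval_mpoly ?cst ?g q) A = 0" if "A \<in> G" for A
      proof -
        have "(eval_mpoly ?cst ?g q) A = rconst (eval_mat q A)"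
          by (simp add: eval_mpoly_apply eval_mat_def ring_map_eval[OF ring_map_rconst])
        then show ?thesis using that q G' rc(2) by auto
      qed
      then have "eval_mpoly ?cst ?g q \<in> Z" by (simp add: Z_def)
      then show ?thesis using d(5)[OF evR[OF qp]] ev[OF qp] by simp
    qed
    moreover have "pt \<psi> \<in> carrier (GL n)" using det0 by (simp add: GL_iff pt_def)
    ultimately have "pt \<psi> \<in> G" unfolding G' by blast
    moreover have "\<psi> (reg q e) = eval_mat q (pt \<psi>) / det (pt \<psi>) ^ e"
      if q: "q \<in> polys (range to_ac) ({..<n} \<times> {..<n})" for q e
    proof -
      have "\<psi> ?t = 1 / det (pt \<psi>)" using dt det0 by (simp add: field_simps)
      then show ?thesis unfolding reg_def
        using d(4)[OF evR[OF q] sR(7)[OF tR, of e]] d(8)[OF tR, of e] ev[OF q] by (simp add: power_one_over)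
    qed
    ultimately show ?thesis by blast
  qed
  have point_y: "\<psi> (?y l) = (\<Sum>j<m. \<rho> (pt \<psi>) $$ (l, j) * \<psi> (?x j))"
    if sp: "specialisation R Z \<psi>" and \<psi>c: "\<And>c. \<psi> (?cst c) = c" and l: "l < m" for \<psi> l
  proof -
    note d = specialisationD[OF sp Rp(1)] and s = spec_pt[OF sp \<psi>c]
    have "\<forall>j. \<exists>q e. j < m \<longrightarrow> q \<in> polys (range to_ac) ({..<n} \<times> {..<n}) \<and> (\<forall>A\<in>G. \<rho> A $$ (l, j) = eval_mat q A / det A ^ e)"
      using action l unfolding linear_action_def by blast
    then obtain q e where qe: "\<And>j. j < m \<Longrightarrow> q j \<in> polys (range to_ac) ({..<n} \<times> {..<n})"
      "\<And>j A. j < m \<Longrightarrow> A \<in> G \<Longrightarrow> \<rho> A $$ (l, j) = eval_mat (q j) A / det A ^ e j" by metis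
    let ?s = "\<Sum>j<m. reg (q j) (e j) * ?x j"
    have inR: "reg (q j) (e j) * ?x j \<in> R" if "j < m" for j
      using regR[OF qe(1)[OF that]] xR(1)[OF that] by (rule sR(4))
    then have sR': "?s \<in> R" by (intro subring_set_sum[OF Rp(1)]) simp
    have "?y l - ?s \<in> Z"
    proof -
      have "?y l A = ?s A" if A: "A \<in> G" for A
        using act_props(3)[OF A A, of l] l qe(2)[OF _ A] by (simp add: sum_fun_apply regA)
      then show ?thesis by (simp add: Z_def)
    qed
    then have "\<psi> (?y l - ?s) = 0" using sR(6)[OF xR(2)[OF l] sR'] by (intro d(5))
    then have "\<psi> (?y l) = \<psi> ?s" using d(7)[OF xR(2)[OF l] sR'] by simp
    also have "\<dots> = (\<Sum>j<m. \<psi> (reg (q j) (e j) * ?x j))" by (rule specialisation_sum[OF sp Rp(1)]) (use inR in simp)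
    also have "\<dots> = (\<Sum>j<m. \<rho> (pt \<psi>) $$ (l, j) * \<psi> (?x j))"
      using s qe d(4)[OF regR[OF qe(1)] xR(1)] by (intro sum.cong) simp_all
    finally show ?thesis .
  qed
  obtain S where S: "mult_subset B Z S" and rat: "\<And>a. a \<in> R \<Longrightarrow>
      (\<forall>\<psi> \<psi>' :: ('a alg_closure mat \<Rightarrow> 'a alg_closure ratfun) \<Rightarrow> 'a alg_closure.
        specialisation R Z \<psi> \<and> specialisation R Z \<psi>' \<and> (\<forall>c\<in>C0. \<psi> c = \<phi>0 c) \<and>
        (\<forall>b\<in>B. \<psi> b = \<psi>' b) \<and> \<psi> \<pi> \<noteq> 0 \<longrightarrow> \<psi> a = \<psi>' a) \<Longrightarrow>
      \<exists>Q\<in>S. \<exists>b\<in>B. Q * a - b \<in> Z"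
    apply (rule separated_function_rational[of Z C0 \<phi>0 B us R vs \<pi>])
    subgoal by (rule Z)
    subgoal by (rule C0)
    subgoal by (rule units)
    subgoal by (rule char0)
    subgoal by (rule sp0)
    subgoal by (rule B_def)
    subgoal by (rule R_def)
    subgoal by (rule \<pi>B)
    subgoal by (rule \<pi>Z)
    subgoal premises prems for S by (rule prems(1)[OF prems(2)]) (rule prems(3))
    done
  have same_point: "pt \<psi> = pt \<psi>'"
    if sp: "specialisation R Z \<psi>" "specialisation R Z \<psi>'" and c: "\<And>c. c \<in> C0 \<Longrightarrow> \<psi> c = \<phi>0 c"
      and b: "\<And>b. b \<in> B \<Longrightarrow> \<psi> b = \<psi>' b" and nz: "\<psi> \<pi> \<noteq> 0" for \<psi> \<psi>'
  proof -
    have \<psi>c: "\<psi> (?cst a) = a" "\<psi>' (?cst a) = a" for a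
      using c[of "?cst a"] b[OF cstB, of a] \<phi>0 by (auto simp: C0_def)
    define v where "v = vec m (\<lambda>l. \<psi> (?x l))"
    have v: "v \<in> carrier_vec m" by (simp add: v_def)
    have xx: "\<psi>' (?x l) = \<psi> (?x l)" if "l < m" for l using b[OF xB(1)[OF that]] by simp
    have G1: "pt \<psi> \<in> G" "pt \<psi>' \<in> G" using spec_pt[OF sp(1) \<psi>c(1)] spec_pt[OF sp(2) \<psi>c(2)] by blast+
    have mv: "(\<rho> A *\<^sub>v v) $ l = (\<Sum>j<m. \<rho> A $$ (l, j) * \<psi> (?x j))" if "A \<in> G" "l < m" for A l
      using rho_carrier[OF that(1)] that(2) by (simp add: v_def scalar_prod_def lessThan_atLeast0)
    have eq: "\<rho> (pt \<psi>) *\<^sub>v v = \<rho> (pt \<psi>') *\<^sub>v v"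
    proof (rule eq_vecI)
      show "dim_vec (\<rho> (pt \<psi>) *\<^sub>v v) = dim_vec (\<rho> (pt \<psi>') *\<^sub>v v)"
        using rho_carrier[OF G1(1)] rho_carrier[OF G1(2)] by simp
      fix l assume "l < dim_vec (\<rho> (pt \<psi>') *\<^sub>v v)"
      then have l: "l < m" using rho_carrier[OF G1(2)] by simp
      have "\<psi> (?y l) = \<psi>' (?y l)" by (rule b[OF xB(2)[OF l]])
      then show "(\<rho> (pt \<psi>) *\<^sub>v v) $ l = (\<rho> (pt \<psi>') *\<^sub>v v) $ l"
        using point_y[OF sp(1) \<psi>c(1) l] point_y[OF sp(2) \<psi>c(2) l] mv[OF G1(1) l] mv[OF G1(2) l] xx by simp
    qed
    obtain h where h: "h \<in> G" "pt \<psi>' * h = 1\<^sub>m n" "h * pt \<psi>' = 1\<^sub>m n" using G(5)[OF G1(2)] by blast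
    have hA: "h * pt \<psi> \<in> G" by (rule G(4)[OF h(1) G1(1)])
    have "\<rho> (h * pt \<psi>) *\<^sub>v v = \<rho> h *\<^sub>v (\<rho> (pt \<psi>') *\<^sub>v v)"
      using rho_mult[OF h(1) G1(1)] rho_carrier[OF h(1)] rho_carrier[OF G1(1)] v eq by (simp add: assoc_mult_mat_vec)
    also have "\<dots> = \<rho> (h * pt \<psi>') *\<^sub>v v"
      using rho_mult[OF h(1) G1(2)] rho_carrier[OF h(1)] rho_carrier[OF G1(2)] v by (simp add: assoc_mult_mat_vec)
    also have "\<dots> = v" using h(3) rho_one v by simp
    finally have fixv: "\<rho> (h * pt \<psi>) *\<^sub>v v = v" .
    have "eval_mpoly (\<lambda>c. c) (\<lambda>i. v $ i) p = \<psi> \<pi>"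
    proof -
      have "\<psi> \<pi> = eval_mpoly (\<lambda>c. \<psi> (?cst c)) (\<lambda>i. \<psi> (?x i)) p"
        unfolding \<pi>_def by (rule specialisation_eval_mpoly[OF sp(1) Rp(1) pm]) (use cstR xR in auto)
      also have "\<dots> = eval_mpoly (\<lambda>c. c) (\<lambda>i. v $ i) p"
        by (rule eval_mpoly_cong[OF pm]) (auto simp: v_def \<psi>c)
      finally show ?thesis by simp
    qed
    then have "h * pt \<psi> = 1\<^sub>m n" using stab[OF v p _ hA fixv] nz by simp
    then have "pt \<psi>' * (h * pt \<psi>) = pt \<psi>'" using G(1)[OF G1(2)] by simp
    moreover have "pt \<psi>' * (h * pt \<psi>) = pt \<psi>"
      using h(2) G(1)[OF G1(1)] G(1)[OF G1(2)] G(1)[OF h(1)] by (simp add: assoc_mult_mat[symmetric])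
    ultimately show ?thesis by simp
  qed
  have S1: "1 \<in> S" and SB: "\<And>s. s \<in> S \<Longrightarrow> s \<in> B" and Sm: "\<And>s t. s \<in> S \<Longrightarrow> t \<in> S \<Longrightarrow> s * t \<in> S"
    and SZ: "\<And>s. s \<in> S \<Longrightarrow> s \<notin> Z"
    using S unfolding mult_subset_def by blast+
  have entry: "\<exists>Q\<in>S. \<exists>b\<in>B. \<forall>A\<in>G. Q A * rconst (\<sigma> A $$ (i, j)) = b A" if ij: "i < d" "j < d" for i j
  proof -
    obtain q e where q: "q \<in> polys (range to_ac) ({..<n} \<times> {..<n})"
      and eq: "\<And>A. A \<in> G \<Longrightarrow> \<sigma> A $$ (i, j) = eval_mat q A / det A ^ e"
      using S.action ij unfolding linear_action_def by blast
    have "\<exists>Q\<in>S. \<exists>b\<in>B. Q * reg q e - b \<in> Z"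
    proof (rule rat[OF regR[OF q]], intro allI impI, elim conjE)
      fix \<psi> \<psi>' :: "('a alg_closure mat \<Rightarrow> 'a alg_closure ratfun) \<Rightarrow> 'a alg_closure"
      assume a: "specialisation R Z \<psi>" "specialisation R Z \<psi>'" "\<forall>c\<in>C0. \<psi> c = \<phi>0 c"
        "\<forall>b\<in>B. \<psi> b = \<psi>' b" "\<psi> \<pi> \<noteq> 0"
      have \<psi>c: "\<psi> (?cst c) = c" "\<psi>' (?cst c) = c" for c
        using a(3) bspec[OF a(4) cstB, of c] \<phi>0 by (auto simp: C0_def)
      have "pt \<psi> = pt \<psi>'" by (rule same_point[OF a(1,2) bspec[OF a(3)] bspec[OF a(4)] a(5)])
      then show "\<psi> (reg q e) = \<psi>' (reg q e)" using spec_pt[OF a(1) \<psi>c(1)] spec_pt[OF a(2) \<psi>c(2)] q by simp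
    qed
    then obtain Q b where "Q \<in> S" "b \<in> B" "Q * reg q e - b \<in> Z" by blast
    then show ?thesis using eq by (intro bexI[of _ Q] bexI[of _ b]) (auto simp: Z_def regA)
  qed
  then obtain Q b where Qb: "\<And>i j. i < d \<Longrightarrow> j < d \<Longrightarrow> Q i j \<in> S \<and> b i j \<in> B \<and> (\<forall>A\<in>G. Q i j A * rconst (\<sigma> A $$ (i, j)) = b i j A)"
    by metis
  define T where "T = {..<d} \<times> {..<d}"
  define Q0 where "Q0 = (\<Prod>ij\<in>T. Q (fst ij) (snd ij))"
  have prodS: "(\<Prod>ij\<in>T'. Q (fst ij) (snd ij)) \<in> S" if "T' \<subseteq> T" for T'
    using that by (induction T' rule: infinite_finite_induct) (use S1 Sm Qb in \<open>auto simp: T_def\<close>)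
  have entry0: "\<exists>b\<in>B. \<forall>A\<in>G. Q0 A * rconst (\<sigma> A $$ (i, j)) = b A" if ij: "i < d" "j < d" for i j
  proof -
    let ?r = "\<Prod>ij\<in>T - {(i, j)}. Q (fst ij) (snd ij)"
    have "finite T" "(i, j) \<in> T" using ij by (simp_all add: T_def)
    then have "Q0 = Q i j * ?r" unfolding Q0_def by (subst prod.remove[of T "(i, j)"]) simp_all
    then have "Q0 A * rconst (\<sigma> A $$ (i, j)) = (?r * b i j) A" if "A \<in> G" for A
      using Qb[OF ij] that by (simp add: mult_ac)
    moreover have "?r * b i j \<in> B" 
    proof (rule sB(4))
      show "?r \<in> B" by (rule SB[OF prodS]) blast
      show "b i j \<in> B" using Qb[OF ij] by blast
    qed
    ultimately show ?thesis by blast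
  qed
  \<comment> \<open>The denominators found so far lie in \<open>B\<close>, and every element of \<open>B\<close> is represented by a formal sum.\<close>
  have "B \<subseteq> comb_functions"
    unfolding B_def
  proof (rule adjoin_list_least[OF subring_comb_functions])
    show "C0 \<subseteq> comb_functions"
      unfolding C0_def using comb_functions_const[OF rconst_in_ratfuns[OF subring_set_UNIV UNIV_I]] by blast
    show "set us \<subseteq> comb_functions"
    proof
      fix u assume "u \<in> set us"
      then obtain l where l: "l < m" "u = ?x l \<or> u = ?y l" by (auto simp: us_def)
      have "?x l \<in> comb_functions" by (rule comb_functions_const[OF rvar_in_ratfuns[OF subring_set_UNIV l(1)]])
      moreover have "?y l \<in> comb_functions"
        by (rule comb_functions_single[OF L_closed(1) galois_fixed_rvar[OF l(1)]]) simp
      ultimately show "u \<in> comb_functions" using l(2) by blast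
    qed
  qed
  then have comb: "\<exists>w\<in>combs. \<forall>A\<in>G. f A = comb_value w A" if "f \<in> B" for f
    using that unfolding comb_functions_def by blast
  have Q0S: "Q0 \<in> S" unfolding Q0_def by (rule prodS) simp
  obtain q where q: "q \<in> combs" "\<And>A. A \<in> G \<Longrightarrow> Q0 A = comb_value q A" using comb[OF SB[OF Q0S]] by blast
  show ?thesis
  proof (rule that[OF q(1)])
    show "\<exists>A\<in>G. comb_value q A \<noteq> 0" using SZ[OF Q0S] q(2) unfolding Z_def by auto
    fix i j assume ij: "i < d" "j < d"
    obtain b where "b \<in> B" "\<forall>A\<in>G. Q0 A * rconst (\<sigma> A $$ (i, j)) = b A" using entry0[OF ij] by blast
    then show "\<exists>w\<in>combs. \<forall>A\<in>G. comb_value q A * rconst (\<sigma> A $$ (i, j)) = comb_value w A"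
      using comb[of b] q(2) by auto
  qed
qed

section \<open>Equivariant vectors\<close>

lemma (in representation) rho_entry_mult:
  assumes "A \<in> G" "B \<in> G" "i < m" "j < m"
  shows "rconst (\<rho> (A * B) $$ (i, j)) = (\<Sum>k<m. rconst (\<rho> A $$ (i, k)) * rconst (\<rho> B $$ (k, j)))"
proof -
  have "\<rho> (A * B) $$ (i, j) = (\<Sum>k<m. \<rho> A $$ (i, k) * \<rho> B $$ (k, j))"
    unfolding rho_mult[OF assms(1,2)]
    using rho_carrier[OF assms(1)] rho_carrier[OF assms(2)] assms(3,4) by (simp add: scalar_prod_def lessThan_atLeast0)
  then show ?thesis by (simp add: ring_mapD[OF ring_map_rconst])
qed

lemma (in representation) rho_entry_one:
  assumes "i < m" "j < m"
  shows "rconst (\<rho> (1\<^sub>m n) $$ (i, j)) = (if i = j then 1 else 0)"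
  using assms by (simp add: rho_one ring_mapD[OF ring_map_rconst])

text \<open>Right translation by an element of \<open>G\<close> and the action of the Galois group enter in the same way: both are
  automorphisms \<open>\<gamma>\<close> of \<open>L\<close> together with a permutation \<open>\<pi>\<close> of \<open>G\<close> such that \<open>\<gamma>\<close> sends the value at \<open>A\<close> of a formal sum
  to the value at \<open>\<pi> A\<close> of its image. The matrices \<open>N\<close> and \<open>N'\<close> are inverse to each other and express
  how \<open>\<sigma>\<close> changes along \<open>\<pi>\<close>, as \<open>\<gamma>(\<sigma>(A)) = \<sigma>(\<pi> A) N\<close>. With this notion each descent is carried out once for
  all symmetries.\<close>
definition (in representation) intertwines ::
  "nat \<Rightarrow> ('k alg_closure mat \<Rightarrow> 'k alg_closure mat) \<Rightarrow> ('k alg_closure ratfun \<Rightarrow> 'k alg_closure ratfun) \<Rightarrow>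
   ('k alg_closure mat \<Rightarrow> 'k alg_closure mat) \<Rightarrow> (nat \<Rightarrow> nat \<Rightarrow> 'k alg_closure ratfun) \<Rightarrow>
   (nat \<Rightarrow> nat \<Rightarrow> 'k alg_closure ratfun) \<Rightarrow> bool"
  where "intertwines d \<sigma> \<gamma> \<pi> N N' \<longleftrightarrow> ring_map \<gamma> \<and> (\<forall>x\<in>L. \<gamma> x \<in> L) \<and> (\<forall>i j. N i j \<in> L \<and> N' i j \<in> L) \<and>
    (\<forall>A\<in>G. \<pi> A \<in> G) \<and> (\<forall>B\<in>G. \<exists>A\<in>G. \<pi> A = B) \<and>
    (\<forall>A\<in>G. \<forall>r\<in>galois_fixed. \<gamma> (act A r) = act (\<pi> A) r) \<and>
    (\<forall>A\<in>G. \<forall>i<d. \<forall>j<d. \<gamma> (rconst (\<sigma> A $$ (i, j))) = (\<Sum>k<d. rconst (\<sigma> (\<pi> A) $$ (i, k)) * N k j)) \<and>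
    (\<forall>A\<in>G. \<forall>i<d. \<forall>j<d. rconst (\<sigma> (\<pi> A) $$ (i, j)) = (\<Sum>k<d. \<gamma> (rconst (\<sigma> A $$ (i, k))) * N' k j)) \<and>
    (\<forall>i<d. \<forall>k<d. (\<Sum>j<d. N' i j * N j k) = (if i = k then 1 else 0))"

lemma (in representation) intertwines_act:
  assumes \<sigma>: "representation n d G \<sigma>" and h: "h \<in> G"
  shows "\<exists>\<pi> N. intertwines d \<sigma> (act h) \<pi> N (\<lambda>i j. rconst (\<sigma> h $$ (i, j)))"
proof -
  interpret S: representation n d G \<sigma> by (rule \<sigma>)
  note G = linear_algebraic_groupD[OF group]
  obtain h' where h': "h' \<in> G" "h * h' = 1\<^sub>m n" "h' * h = 1\<^sub>m n" using G(5)[OF h] by blast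
  have c: "(A * h) * h' = A" "(A * h') * h = A" if "A \<in> G" for A
    using G(1)[OF that] G(1)[OF h] G(1)[OF h'(1)] h'(2,3) by (simp_all add: assoc_mult_mat)
  show ?thesis
    unfolding intertwines_def
  proof (intro exI[of _ "\<lambda>A. A * h"] exI[of _ "\<lambda>i j. rconst (\<sigma> h' $$ (i, j))"] conjI ballI allI impI)
    show "ring_map (act h)" by (rule act_props(1)[OF h h])
    show "act h x \<in> L" if "x \<in> L" for x using act_props(4)[OF h h] that .
    show "A * h \<in> G" if "A \<in> G" for A using G(4)[OF that h] .
    show "\<exists>A\<in>G. A * h = B" if "B \<in> G" for B using c(2)[OF that] G(4)[OF that h'(1)] by blast
    show "act h (act A r) = act (A * h) r" if "A \<in> G" for A r by (rule act_act[OF h that])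
    show "act h (rconst (\<sigma> A $$ (i, j))) = (\<Sum>k<d. rconst (\<sigma> (A * h) $$ (i, k)) * rconst (\<sigma> h' $$ (k, j)))"
      if "A \<in> G" "i < d" "j < d" for A i j
      unfolding act_props(2)[OF h h]
      using S.rho_entry_mult[OF G(4)[OF that(1) h] h'(1) that(2,3)] unfolding c(1)[OF that(1)] .
    show "rconst (\<sigma> (A * h) $$ (i, j)) = (\<Sum>k<d. act h (rconst (\<sigma> A $$ (i, k))) * rconst (\<sigma> h $$ (k, j)))"
      if "A \<in> G" "i < d" "j < d" for A i j
      unfolding act_props(2)[OF h h] by (rule S.rho_entry_mult[OF that(1) h that(2,3)])
    show "(\<Sum>j<d. rconst (\<sigma> h $$ (i, j)) * rconst (\<sigma> h' $$ (j, k))) = (if i = k then 1 else 0)"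
      if "i < d" "k < d" for i k
      using S.rho_entry_mult[OF h h'(1) that] S.rho_entry_one[OF that] h'(2) by simp
  qed (auto intro: rconst_in_ratfuns[OF subring_set_UNIV])
qed

lemma (in representation) intertwines_galois:
  assumes \<sigma>: "representation n d G \<sigma>" and \<tau>: "\<tau> \<in> galois_group"
  shows "\<exists>\<pi> N. intertwines d \<sigma> (galois_map \<tau>) \<pi> N (\<lambda>i j. if i = j then 1 else 0)"
proof -
  interpret S: representation n d G \<sigma> by (rule \<sigma>)
  note G = linear_algebraic_groupD[OF group] and g = galois_map_props[OF \<tau>]
  have inv: "map_mat \<tau> (map_mat (inv_into UNIV \<tau>) B) = B" for B
    by (rule eq_matI) (simp_all add: galois_groupD(5)[OF \<tau>])
  show ?thesis
    unfolding intertwines_def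
  proof (intro exI[of _ "map_mat \<tau>"] exI[of _ "\<lambda>i j. if i = j then 1 else 0"] conjI ballI allI impI)
    show "ring_map (galois_map \<tau>)" by (rule g)
    show "galois_map \<tau> x \<in> L" if "x \<in> L" for x using g(4) that .
    show "map_mat \<tau> A \<in> G" if "A \<in> G" for A using galois_stable_group[OF group \<tau> that] .
    show "\<exists>A\<in>G. map_mat \<tau> A = B" if "B \<in> G" for B
      using galois_stable_group[OF group galois_groupD(4)[OF \<tau>] that] inv by blast
    show "galois_map \<tau> (act A r) = act (map_mat \<tau> A) r" if "A \<in> G" "r \<in> galois_fixed" for A r
      using galois_act[OF \<tau> that(1), of r] that(2) \<tau> by (simp add: galois_fixed_def)
    show "galois_map \<tau> (rconst (\<sigma> A $$ (i, j))) = (\<Sum>k<d. rconst (\<sigma> (map_mat \<tau> A) $$ (i, k)) * (if k = j then 1 else 0))"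
      if "A \<in> G" "i < d" "j < d" for A i j
      using that S.rho_galois[OF \<tau> that] g(2) by (simp add: if_distrib cong: if_cong)
    show "rconst (\<sigma> (map_mat \<tau> A) $$ (i, j)) = (\<Sum>k<d. galois_map \<tau> (rconst (\<sigma> A $$ (i, k))) * (if k = j then 1 else 0))"
      if "A \<in> G" "i < d" "j < d" for A i j
      using that S.rho_galois[OF \<tau> that] g(2) by (simp add: if_distrib cong: if_cong)
    show "(\<Sum>j<d. (if i = j then 1 else 0) * (if j = k then 1 else 0)) = (if i = k then 1 else (0 :: 'k alg_closure ratfun))"
      if "i < d" "k < d" for i k
    proof -
      have "(\<Sum>j<d. (if i = j then 1 else 0) * (if j = k then 1 else 0)) =
          (\<Sum>j<d. if j = i then (if i = k then 1 else 0) else (0 :: 'k alg_closure ratfun))"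
        by (intro sum.cong) auto
      then show ?thesis using that by simp
    qed
  qed (use L_closed in auto)
qed

text \<open>Two descents, both over \<open>L\<close> and for all symmetries at once. The first one makes the denominator \<open>q\<close> of the
  entries of \<open>\<sigma>\<close> fixed. The second one works with the families of formal sums that represent \<open>q \<sigma>(g) u\<close>
  for some vector \<open>u\<close> over \<open>L\<close>: such a family determines \<open>u\<close> by its value at \<open>g = 1\<close>, and if the family is fixed, then
  \<open>u\<close> is equivariant. The columns of \<open>\<sigma>\<close> provide the families belonging to the standard basis vectors, so the
  linear form with coefficients \<open>c\<close> does not vanish on all families, hence not on all fixed ones.\<close>
lemma (in almost_free_representation) equivariant_vector:
  fixes \<sigma> :: "'a alg_closure mat \<Rightarrow> 'a alg_closure mat" and c :: "nat \<Rightarrow> 'a alg_closure ratfun"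
  assumes \<sigma>: "representation n d G \<sigma>" and c: "j0 < d" "c j0 \<noteq> 0"
  shows "\<exists>u. (\<forall>i<d. u i \<in> L) \<and> (\<forall>A\<in>G. \<forall>i<d. act A (u i) = (\<Sum>k<d. rconst (\<sigma> A $$ (i, k)) * u k)) \<and>
    (\<forall>\<tau>\<in>galois_group. \<forall>i<d. galois_map \<tau> (u i) = u i) \<and> (\<Sum>i<d. c i * u i) \<noteq> 0"
proof -
  interpret S: representation n d G \<sigma> by (rule \<sigma>)
  note G = linear_algebraic_groupD[OF group]
  define \<Gamma> where "\<Gamma> = {\<gamma>. \<exists>\<pi> N N'. intertwines d \<sigma> \<gamma> \<pi> N N'}"
  have tw: "ring_map \<gamma>" "\<forall>x\<in>L. \<gamma> x \<in> L" "N i j \<in> L" "N' i j \<in> L" "A \<in> G \<Longrightarrow> \<pi> A \<in> G" "B \<in> G \<Longrightarrow> \<exists>A\<in>G. \<pi> A = B"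
    "A \<in> G \<Longrightarrow> r \<in> galois_fixed \<Longrightarrow> \<gamma> (act A r) = act (\<pi> A) r"
    "A \<in> G \<Longrightarrow> i < d \<Longrightarrow> j < d \<Longrightarrow> \<gamma> (rconst (\<sigma> A $$ (i, j))) = (\<Sum>k<d. rconst (\<sigma> (\<pi> A) $$ (i, k)) * N k j)"
    "A \<in> G \<Longrightarrow> i < d \<Longrightarrow> j < d \<Longrightarrow> rconst (\<sigma> (\<pi> A) $$ (i, j)) = (\<Sum>k<d. \<gamma> (rconst (\<sigma> A $$ (i, k))) * N' k j)"
    "i < d \<Longrightarrow> j < d \<Longrightarrow> (\<Sum>k<d. N' i k * N k j) = (if i = j then 1 else 0)"
    if "intertwines d \<sigma> \<gamma> \<pi> N N'" for \<gamma> \<pi> N N' A B i j r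
    using that unfolding intertwines_def by simp_all
  have val: "(\<lambda>r. \<gamma> (v r)) \<in> combs" "\<And>A. A \<in> G \<Longrightarrow> comb_value (\<lambda>r. \<gamma> (v r)) (\<pi> A) = \<gamma> (comb_value v A)"
    if t: "intertwines d \<sigma> \<gamma> \<pi> N N'" and v: "v \<in> combs" for \<gamma> \<pi> N N' v
  proof -
    note r = ring_mapD[OF tw(1)[OF t]]
    note m = combs_map[of v \<gamma>, OF v r(2)]
    show "(\<lambda>r. \<gamma> (v r)) \<in> combs" by (rule m(1)) (use tw(2)[OF t] in blast)
    fix A assume A: "A \<in> G"
    have "comb_value (\<lambda>r. \<gamma> (v r)) (\<pi> A) = (\<Sum>r | v r \<noteq> 0. \<gamma> (v r) * act (\<pi> A) r)"
      by (rule m(2)) (use tw(2)[OF t] in blast)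
    also have "\<dots> = (\<Sum>r | v r \<noteq> 0. \<gamma> (v r * act A r))"
    proof (rule sum.cong)
      fix s assume "s \<in> {r. v r \<noteq> 0}"
      then have "s \<in> galois_fixed" using combsD(3)[OF v] by blast
      then show "\<gamma> (v s) * act (\<pi> A) s = \<gamma> (v s * act A s)" using tw(7)[OF t A] r(4) by simp
    qed simp
    also have "\<dots> = \<gamma> (comb_value v A)" by (simp add: comb_value_def r(9))
    finally show "comb_value (\<lambda>r. \<gamma> (v r)) (\<pi> A) = \<gamma> (comb_value v A)" .
  qed
  obtain q0 where q0: "q0 \<in> combs" "\<exists>A\<in>G. comb_value q0 A \<noteq> 0"
    "\<And>i j. i < d \<Longrightarrow> j < d \<Longrightarrow> \<exists>w\<in>combs. \<forall>A\<in>G. comb_value q0 A * rconst (\<sigma> A $$ (i, j)) = comb_value w A"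
    apply (rule representation_entries_rational[OF \<sigma>])
    subgoal premises prems for q by (rule prems(1)[OF prems(2,3)]) (rule prems(4))
    done
  \<comment> \<open>The space of denominators, which contains \<open>q0\<close>.\<close>
  define V where "V = {v \<in> combs. \<forall>i<d. \<forall>j<d. \<exists>w\<in>combs. \<forall>A\<in>G. comb_value v A * rconst (\<sigma> A $$ (i, j)) = comb_value w A}"
  have VD: "v \<in> combs" "i < d \<Longrightarrow> j < d \<Longrightarrow> \<exists>w\<in>combs. \<forall>A\<in>G. comb_value v A * rconst (\<sigma> A $$ (i, j)) = comb_value w A"
    if "v \<in> V" for v i j using that unfolding V_def by blast+
  have VI: "v \<in> V" if "v \<in> combs" "\<And>i j. i < d \<Longrightarrow> j < d \<Longrightarrow> \<exists>w\<in>combs. \<forall>A\<in>G. comb_value v A * rconst (\<sigma> A $$ (i, j)) = comb_value w A" for v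
    using that unfolding V_def by blast
  have "\<exists>q\<in>V. (\<forall>\<gamma>\<in>\<Gamma>. \<forall>r. \<gamma> (q r) = q r) \<and> (\<exists>A\<in>G. comb_value q A \<noteq> 0)"
  proof (rule ccontr)
    assume no: "\<not> ?thesis"
    define N where "N = {v \<in> combs. \<forall>A\<in>G. comb_value v A = 0}"
    have "q0 \<in> N"
    proof (rule descent_to_fixed_vectors[where K = L and V = V and \<Gamma> = \<Gamma>])
      show "subfield_set L" by (rule L_subfield)
      show "ring_map \<gamma>" if "\<gamma> \<in> \<Gamma>" for \<gamma> using that tw(1) unfolding \<Gamma>_def by blast
      show "finite {i. v i \<noteq> 0}" "v i \<in> L" if "v \<in> V" for v i using combsD(1,2)[OF VD(1)[OF that]] .
      show "(\<lambda>i. v i + w i) \<in> V" if vw: "v \<in> V" "w \<in> V" for v w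
      proof (rule VI[OF combs_add(1)[OF VD(1)[OF vw(1)] VD(1)[OF vw(2)]]])
        fix i j assume ij: "i < d" "j < d"
        obtain v' w' where "v' \<in> combs" "w' \<in> combs" "\<forall>A\<in>G. comb_value v A * rconst (\<sigma> A $$ (i, j)) = comb_value v' A"
          "\<forall>A\<in>G. comb_value w A * rconst (\<sigma> A $$ (i, j)) = comb_value w' A"
          using VD(2)[OF vw(1) ij] VD(2)[OF vw(2) ij] by blast
        then show "\<exists>w'\<in>combs. \<forall>A\<in>G. comb_value (\<lambda>i. v i + w i) A * rconst (\<sigma> A $$ (i, j)) = comb_value w' A"
          by (intro bexI[of _ "\<lambda>r. v' r + w' r"])
             (simp_all add: combs_add VD(1)[OF vw(1)] VD(1)[OF vw(2)] distrib_right)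
      qed
      show "(\<lambda>i. a * v i) \<in> V" if a: "a \<in> L" and v: "v \<in> V" for a v
      proof (rule VI[OF combs_scale(1)[OF a VD(1)[OF v]]])
        fix i j assume ij: "i < d" "j < d"
        obtain v' where "v' \<in> combs" "\<forall>A\<in>G. comb_value v A * rconst (\<sigma> A $$ (i, j)) = comb_value v' A"
          using VD(2)[OF v ij] by blast
        then show "\<exists>w\<in>combs. \<forall>A\<in>G. comb_value (\<lambda>i. a * v i) A * rconst (\<sigma> A $$ (i, j)) = comb_value w A"
          by (intro bexI[of _ "\<lambda>r. a * v' r"]) (simp_all add: combs_scale[OF a] VD(1)[OF v] mult.assoc)
      qed
      show "(\<lambda>i. \<gamma> (v i)) \<in> V" if \<gamma>: "\<gamma> \<in> \<Gamma>" and v: "v \<in> V" for \<gamma> v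
      proof -
        obtain \<pi> M M' where t: "intertwines d \<sigma> \<gamma> \<pi> M M'" using \<gamma> unfolding \<Gamma>_def by blast
        note r = ring_mapD[OF tw(1)[OF t]]
        show ?thesis
        proof (rule VI[OF val(1)[OF t VD(1)[OF v]]])
          fix i j assume ij: "i < d" "j < d"
          have "\<forall>k. \<exists>w. k < d \<longrightarrow> w \<in> combs \<and> (\<forall>A\<in>G. comb_value v A * rconst (\<sigma> A $$ (i, k)) = comb_value w A)"
            using VD(2)[OF v ij(1)] by blast
          then obtain w where w: "\<And>k. k < d \<Longrightarrow> w k \<in> combs"
            "\<And>k A. k < d \<Longrightarrow> A \<in> G \<Longrightarrow> comb_value v A * rconst (\<sigma> A $$ (i, k)) = comb_value (w k) A" by metis
          let ?w = "\<lambda>k r. M' k j * \<gamma> (w k r)"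
          have wc: "?w k \<in> combs" "comb_value (?w k) B = M' k j * comb_value (\<lambda>r. \<gamma> (w k r)) B" if "k < d" for k B
            using combs_scale[OF tw(4)[OF t, of k j] val(1)[OF t w(1)[OF that]]] .
          have "comb_value (\<lambda>r. \<gamma> (v r)) B * rconst (\<sigma> B $$ (i, j)) = comb_value (\<lambda>r. \<Sum>k<d. ?w k r) B" if B: "B \<in> G" for B
          proof -
            obtain A where A: "A \<in> G" "\<pi> A = B" using tw(6)[OF t B] by blast
            have "comb_value (\<lambda>r. \<gamma> (v r)) B * rconst (\<sigma> B $$ (i, j)) =
                (\<Sum>k<d. M' k j * \<gamma> (comb_value v A * rconst (\<sigma> A $$ (i, k))))"
              using val(2)[OF t VD(1)[OF v] A(1)] tw(9)[OF t A(1) ij] A(2) by (simp add: sum_distrib_left r(4) mult_ac)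
            also have "\<dots> = (\<Sum>k<d. comb_value (?w k) B)"
              using w(2)[OF _ A(1)] wc(2) val(2)[OF t w(1) A(1)] A(2) by (intro sum.cong) simp_all
            also have "\<dots> = comb_value (\<lambda>r. \<Sum>k<d. ?w k r) B"
              by (rule combs_sum(2)[symmetric]) (use wc(1) in simp)
            finally show ?thesis .
          qed
          moreover have "(\<lambda>r. \<Sum>k<d. ?w k r) \<in> combs" by (rule combs_sum(1)) (use wc(1) in simp)
          ultimately show "\<exists>w\<in>combs. \<forall>A\<in>G. comb_value (\<lambda>r. \<gamma> (v r)) A * rconst (\<sigma> A $$ (i, j)) = comb_value w A" by blast
        qed
      qed
      show "(\<lambda>i. 0) \<in> N" using combs_zero by (simp add: N_def)
      show "(\<lambda>i. v i + w i) \<in> N" if "v \<in> N" "w \<in> N" for v w using that by (simp add: N_def combs_add)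
      show "(\<lambda>i. a * v i) \<in> N" if "a \<in> L" "v \<in> N" for a v using that by (simp add: N_def combs_scale)
      show "v \<in> N" if "v \<in> V" "\<And>\<gamma> i. \<gamma> \<in> \<Gamma> \<Longrightarrow> \<gamma> (v i) = v i" for v
        using no that VD(1)[OF that(1)] unfolding N_def by blast
      show "q0 \<in> V" using q0(1,3) by (rule VI)
    qed
    then show False using q0(2) unfolding N_def by blast
  qed
  then obtain q A0 where q: "q \<in> V" "\<And>\<gamma> r. \<gamma> \<in> \<Gamma> \<Longrightarrow> \<gamma> (q r) = q r" and A0: "A0 \<in> G" "comb_value q A0 \<noteq> 0" by blast
  have qc: "q \<in> combs" by (rule VD(1)[OF q(1)])
  have qv: "comb_value q (\<pi> A) = \<gamma> (comb_value q A)" if "intertwines d \<sigma> \<gamma> \<pi> N N'" "A \<in> G" for \<gamma> \<pi> N N' A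
  proof -
    have "(\<lambda>r. \<gamma> (q r)) = q" using q(2) that(1) unfolding \<Gamma>_def by blast
    then show ?thesis using val(2)[OF that(1) qc that(2)] by simp
  qed
  let ?q1 = "comb_value q (1\<^sub>m n)"
  \<comment> \<open>A fixed denominator vanishes either nowhere or everywhere on \<open>G\<close>, because translations are transitive.\<close>
  have q1: "?q1 \<noteq> 0"
  proof
    assume z: "?q1 = 0"
    obtain \<pi> N where t: "intertwines d \<sigma> (act A0) \<pi> N (\<lambda>i j. rconst (\<sigma> A0 $$ (i, j)))"
      using intertwines_act[OF \<sigma> A0(1)] by blast
    have A0n: "A0 \<in> carrier_mat n n" by (rule G(1)[OF A0(1)])
    have "comb_value q A0 = (\<Sum>r | q r \<noteq> 0. act A0 (q r * act (1\<^sub>m n) r))"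
    proof -
      have "act A0 (q r) = q r" for r using q(2) t unfolding \<Gamma>_def by blast
      then show ?thesis
        using act_act[OF A0(1) G(3)] A0n by (simp add: comb_value_def ring_mapD(4)[OF act_props(1)[OF A0(1) A0(1)]])
    qed
    also have "\<dots> = act A0 ?q1" by (simp add: comb_value_def ring_mapD(9)[OF act_props(1)[OF A0(1) A0(1)]])
    finally show False using A0(2) z ring_mapD(2)[OF act_props(1)[OF A0(1) A0(1)]] by simp
  qed
  \<comment> \<open>The \<open>d\<close> formal sums of a family are stored as one vector, indexed by the component and by \<open>r\<close>.\<close>
  define Y where "Y = {y :: nat \<times> 'a alg_closure ratfun \<Rightarrow> 'a alg_closure ratfun.
    (\<forall>i<d. (\<lambda>r. y (i, r)) \<in> combs) \<and> (\<forall>i r. i \<ge> d \<longrightarrow> y (i, r) = 0) \<and>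
    (\<exists>u. (\<forall>i<d. u i \<in> L) \<and> (\<forall>A\<in>G. \<forall>i<d. comb_value (\<lambda>r. y (i, r)) A = comb_value q A * (\<Sum>k<d. rconst (\<sigma> A $$ (i, k)) * u k)))}"
  have YD: "i < d \<Longrightarrow> (\<lambda>r. y (i, r)) \<in> combs" "i \<ge> d \<Longrightarrow> y (i, r) = 0"
    "\<exists>u. (\<forall>i<d. u i \<in> L) \<and> (\<forall>A\<in>G. \<forall>i<d. comb_value (\<lambda>r. y (i, r)) A = comb_value q A * (\<Sum>k<d. rconst (\<sigma> A $$ (i, k)) * u k))"
    if "y \<in> Y" for y i r using that unfolding Y_def by blast+
  have YI: "y \<in> Y" if "\<And>i. i < d \<Longrightarrow> (\<lambda>r. y (i, r)) \<in> combs" "\<And>i r. i \<ge> d \<Longrightarrow> y (i, r) = 0" "\<And>i. i < d \<Longrightarrow> u i \<in> L"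
    "\<And>A i. A \<in> G \<Longrightarrow> i < d \<Longrightarrow> comb_value (\<lambda>r. y (i, r)) A = comb_value q A * (\<Sum>k<d. rconst (\<sigma> A $$ (i, k)) * u k)" for y u
    using that unfolding Y_def by blast
  have Yval: "comb_value (\<lambda>r. y (i, r)) (1\<^sub>m n) = ?q1 * u i"
    if "i < d" "\<forall>A\<in>G. \<forall>i<d. comb_value (\<lambda>r. y (i, r)) A = comb_value q A * (\<Sum>k<d. rconst (\<sigma> A $$ (i, k)) * u k)" for y u i
  proof -
    have "(\<Sum>k<d. rconst (\<sigma> (1\<^sub>m n) $$ (i, k)) * u k) = (\<Sum>k<d. if k = i then u k else 0)"
      using S.rho_entry_one[OF that(1)] by (intro sum.cong) auto
    then show ?thesis using that G(3) by simp
  qed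
  let ?\<Lambda> = "\<lambda>y. \<Sum>i<d. c i * comb_value (\<lambda>r. y (i, r)) (1\<^sub>m n)"
  have "\<exists>y\<in>Y. (\<forall>\<gamma>\<in>\<Gamma>. \<forall>i. \<gamma> (y i) = y i) \<and> ?\<Lambda> y \<noteq> 0"
  proof (rule ccontr)
    assume no: "\<not> ?thesis"
    define N where "N = {y \<in> Y. ?\<Lambda> y = 0}"
    have add: "(\<lambda>i. v i + w i) \<in> Y" "?\<Lambda> (\<lambda>i. v i + w i) = ?\<Lambda> v + ?\<Lambda> w" if vw: "v \<in> Y" "w \<in> Y" for v w
    proof -
      obtain u where u: "\<forall>i<d. u i \<in> L" "\<forall>A\<in>G. \<forall>i<d. comb_value (\<lambda>r. v (i, r)) A = comb_value q A * (\<Sum>k<d. rconst (\<sigma> A $$ (i, k)) * u k)"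
        using YD(3)[OF vw(1)] by blast
      obtain u' where u': "\<forall>i<d. u' i \<in> L" "\<forall>A\<in>G. \<forall>i<d. comb_value (\<lambda>r. w (i, r)) A = comb_value q A * (\<Sum>k<d. rconst (\<sigma> A $$ (i, k)) * u' k)"
        using YD(3)[OF vw(2)] by blast
      note cv = combs_add[OF YD(1)[OF vw(1)] YD(1)[OF vw(2)]]
      show "(\<lambda>i. v i + w i) \<in> Y"
        by (rule YI[of _ "\<lambda>i. u i + u' i"])
           (use cv YD(2)[OF vw(1)] YD(2)[OF vw(2)] u u' L_closed(3) in \<open>simp_all add: distrib_left sum.distrib\<close>)
      show "?\<Lambda> (\<lambda>i. v i + w i) = ?\<Lambda> v + ?\<Lambda> w"
        by (simp add: cv(2) distrib_left sum.distrib)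
    qed
    have scale: "(\<lambda>i. a * v i) \<in> Y" "?\<Lambda> (\<lambda>i. a * v i) = a * ?\<Lambda> v" if a: "a \<in> L" and v: "v \<in> Y" for a v
    proof -
      obtain u where u: "\<forall>i<d. u i \<in> L" "\<forall>A\<in>G. \<forall>i<d. comb_value (\<lambda>r. v (i, r)) A = comb_value q A * (\<Sum>k<d. rconst (\<sigma> A $$ (i, k)) * u k)"
        using YD(3)[OF v] by blast
      note cv = combs_scale[OF a YD(1)[OF v]]
      show "(\<lambda>i. a * v i) \<in> Y"
      proof (rule YI[of _ "\<lambda>i. a * u i"])
        show "(\<lambda>r. a * v (i, r)) \<in> combs" if "i < d" for i by (rule cv(1)[OF that])
        show "a * v (i, r) = 0" if "i \<ge> d" for i r using YD(2)[OF v that] by simp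
        show "a * u i \<in> L" if "i < d" for i using L_closed(4)[OF a] u(1) that by blast
        fix A i assume "A \<in> G" "i < d"
        then have "comb_value (\<lambda>r. a * v (i, r)) A = a * (comb_value q A * (\<Sum>k<d. rconst (\<sigma> A $$ (i, k)) * u k))"
          using cv(2) u(2) by simp
        then show "comb_value (\<lambda>r. a * v (i, r)) A = comb_value q A * (\<Sum>k<d. rconst (\<sigma> A $$ (i, k)) * (a * u k))"
          by (simp add: sum_distrib_left mult_ac)
      qed
      show "?\<Lambda> (\<lambda>i. a * v i) = a * ?\<Lambda> v"
        by (simp add: cv(2) sum_distrib_left mult_ac)
    qed
    have all: "y \<in> N" if y: "y \<in> Y" for y
    proof (rule descent_to_fixed_vectors[where K = L and V = Y and \<Gamma> = \<Gamma>])
      show "subfield_set L" by (rule L_subfield)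
      show "ring_map \<gamma>" if "\<gamma> \<in> \<Gamma>" for \<gamma> using that tw(1) unfolding \<Gamma>_def by blast
      show "finite {i. v i \<noteq> 0}" if v: "v \<in> Y" for v
      proof (rule finite_subset)
        show "{i. v i \<noteq> 0} \<subseteq> Sigma {..<d} (\<lambda>i. {r. v (i, r) \<noteq> 0})" using YD(2)[OF v] by (force simp: not_le[symmetric])
        show "finite (Sigma {..<d} (\<lambda>i. {r. v (i, r) \<noteq> 0}))" using combsD(1)[OF YD(1)[OF v]] by blast
      qed
      show "v i \<in> L" if v: "v \<in> Y" for v i
        using combsD(2)[OF YD(1)[OF v]] YD(2)[OF v] L_closed(2) by (cases i, cases "fst i < d") (auto simp: not_less)
      show "(\<lambda>i. v i + w i) \<in> Y" if "v \<in> Y" "w \<in> Y" for v w using add(1)[OF that] .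
      show "(\<lambda>i. a * v i) \<in> Y" if "a \<in> L" "v \<in> Y" for a v using scale(1)[OF that] .
      show "(\<lambda>i. \<gamma> (v i)) \<in> Y" if \<gamma>: "\<gamma> \<in> \<Gamma>" and v: "v \<in> Y" for \<gamma> v
      proof -
        obtain \<pi> M M' where t: "intertwines d \<sigma> \<gamma> \<pi> M M'" using \<gamma> unfolding \<Gamma>_def by blast
        note r = ring_mapD[OF tw(1)[OF t]]
        obtain u where u: "\<forall>i<d. u i \<in> L" "\<forall>A\<in>G. \<forall>i<d. comb_value (\<lambda>r. v (i, r)) A = comb_value q A * (\<Sum>k<d. rconst (\<sigma> A $$ (i, k)) * u k)"
          using YD(3)[OF v] by blast
        show ?thesis
        proof (rule YI[of _ "\<lambda>l. \<Sum>k<d. M l k * \<gamma> (u k)"])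
          show "(\<lambda>r. \<gamma> (v (i, r))) \<in> combs" if "i < d" for i using val(1)[OF t YD(1)[OF v that]] .
          show "\<gamma> (v (i, r)) = 0" if "i \<ge> d" for i r using YD(2)[OF v that] r(2) by simp
          show "(\<Sum>k<d. M i k * \<gamma> (u k)) \<in> L" for i
            using u(1) tw(2,3)[OF t] by (intro subring_set_sum[OF L_subring] L_closed(4)) auto
          fix B i assume B: "B \<in> G" and i: "i < d"
          obtain A where A: "A \<in> G" "\<pi> A = B" using tw(6)[OF t B] by blast
          have "comb_value (\<lambda>r. \<gamma> (v (i, r))) B = \<gamma> (comb_value q A * (\<Sum>k<d. rconst (\<sigma> A $$ (i, k)) * u k))"
            using val(2)[OF t YD(1)[OF v i] A(1)] A u(2) i by simp
          also have "\<dots> = comb_value q B * (\<Sum>k<d. (\<Sum>l<d. rconst (\<sigma> B $$ (i, l)) * M l k) * \<gamma> (u k))"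
            using qv[OF t A(1)] tw(8)[OF t A(1) i] A(2) by (simp add: r)
          also have "(\<Sum>k<d. (\<Sum>l<d. rconst (\<sigma> B $$ (i, l)) * M l k) * \<gamma> (u k)) =
              (\<Sum>l<d. rconst (\<sigma> B $$ (i, l)) * (\<Sum>k<d. M l k * \<gamma> (u k)))"
            by (simp add: sum_distrib_left sum_distrib_right mult.assoc) (rule sum.swap)
          finally show "comb_value (\<lambda>r. \<gamma> (v (i, r))) B = comb_value q B *
            (\<Sum>l<d. rconst (\<sigma> B $$ (i, l)) * (\<Sum>k<d. M l k * \<gamma> (u k)))" .
        qed
      qed
      have "(\<lambda>i. 0) \<in> Y" by (rule YI[of _ "\<lambda>i. 0"]) (use combs_zero L_closed(2) in simp_all)
      then show "(\<lambda>i. 0) \<in> N" using combs_zero by (simp add: N_def)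
      show "(\<lambda>i. v i + w i) \<in> N" if "v \<in> N" "w \<in> N" for v w using that add by (simp add: N_def)
      show "(\<lambda>i. a * v i) \<in> N" if "a \<in> L" "v \<in> N" for a v using that scale by (simp add: N_def)
      show "v \<in> N" if "v \<in> Y" "\<And>\<gamma> i. \<gamma> \<in> \<Gamma> \<Longrightarrow> \<gamma> (v i) = v i" for v
        using no that unfolding N_def by blast
      show "y \<in> Y" by (rule y)
    qed
    have "\<forall>i. \<exists>w. i < d \<longrightarrow> w \<in> combs \<and> (\<forall>A\<in>G. comb_value q A * rconst (\<sigma> A $$ (i, j0)) = comb_value w A)"
      using VD(2)[OF q(1) _ c(1)] by blast
    then obtain w where w: "\<And>i. i < d \<Longrightarrow> w i \<in> combs"
      "\<And>i A. i < d \<Longrightarrow> A \<in> G \<Longrightarrow> comb_value q A * rconst (\<sigma> A $$ (i, j0)) = comb_value (w i) A" by metis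
    define y where "y ir = (if fst ir < d then w (fst ir) (snd ir) else 0)" for ir
    have yw: "(\<lambda>r. y (i, r)) = w i" if "i < d" for i using that by (auto simp: y_def)
    have yY: "y \<in> Y"
      by (rule YI[of _ "\<lambda>i. if i = j0 then 1 else 0"])
         (use w yw L_closed(1,2) c(1) in \<open>auto simp: y_def if_distrib cong: if_cong\<close>)
    have "comb_value (\<lambda>r. y (i, r)) (1\<^sub>m n) = (if i = j0 then ?q1 else 0)" if "i < d" for i
      using w(2)[OF that G(3)] S.rho_entry_one[OF that c(1)] yw[OF that] by (auto split: if_splits)
    then have "?\<Lambda> y = (\<Sum>i<d. if i = j0 then c i * ?q1 else 0)" by (intro sum.cong) auto
    then have "?\<Lambda> y = c j0 * ?q1" using c(1) by simp
    then show False using all[OF yY] c(2) q1 by (simp add: N_def)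
  qed
  then obtain y where y: "y \<in> Y" "\<And>\<gamma> i. \<gamma> \<in> \<Gamma> \<Longrightarrow> \<gamma> (y i) = y i" "?\<Lambda> y \<noteq> 0" by blast
  obtain u where u: "\<forall>i<d. u i \<in> L" "\<forall>A\<in>G. \<forall>i<d. comb_value (\<lambda>r. y (i, r)) A = comb_value q A * (\<Sum>k<d. rconst (\<sigma> A $$ (i, k)) * u k)"
    using YD(3)[OF y(1)] by blast
  have y1: "comb_value (\<lambda>r. y (i, r)) (1\<^sub>m n) = ?q1 * u i" if "i < d" for i using Yval[OF that u(2)] .
  have equi: "\<gamma> (u i) = (\<Sum>j<d. N' i j * u j)" if t: "intertwines d \<sigma> \<gamma> \<pi> N N'" and i: "i < d" for \<gamma> \<pi> N N' i
  proof -
    note r = ring_mapD[OF tw(1)[OF t]]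
    obtain A where A: "A \<in> G" "\<pi> A = 1\<^sub>m n" using tw(6)[OF t G(3)] by blast
    have uN: "u l = (\<Sum>k<d. N l k * \<gamma> (u k))" if l: "l < d" for l
    proof -
      have "(\<lambda>r. \<gamma> (y (l, r))) = (\<lambda>r. y (l, r))" using y(2) t unfolding \<Gamma>_def by blast
      then have "?q1 * u l = \<gamma> (comb_value (\<lambda>r. y (l, r)) A)"
        using val(2)[OF t YD(1)[OF y(1) l] A(1)] A(2) y1[OF l] by simp
      also have "\<dots> = ?q1 * (\<Sum>k<d. (\<Sum>j<d. rconst (\<sigma> (1\<^sub>m n) $$ (l, j)) * N j k) * \<gamma> (u k))"
        using u(2) A l qv[OF t A(1)] tw(8)[OF t A(1) l] by (simp add: r)
      also have "(\<Sum>k<d. (\<Sum>j<d. rconst (\<sigma> (1\<^sub>m n) $$ (l, j)) * N j k) * \<gamma> (u k)) = (\<Sum>k<d. N l k * \<gamma> (u k))"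
      proof (rule sum.cong)
        fix k
        have "(\<Sum>j<d. rconst (\<sigma> (1\<^sub>m n) $$ (l, j)) * N j k) = (\<Sum>j<d. if j = l then N j k else 0)"
          using S.rho_entry_one[OF l] by (intro sum.cong) auto
        then show "(\<Sum>j<d. rconst (\<sigma> (1\<^sub>m n) $$ (l, j)) * N j k) * \<gamma> (u k) = N l k * \<gamma> (u k)" using l by simp
      qed simp
      finally show ?thesis using q1 by simp
    qed
    have "(\<Sum>j<d. N' i j * u j) = (\<Sum>j<d. \<Sum>k<d. N' i j * (N j k * \<gamma> (u k)))"
      by (intro sum.cong refl) (subst uN, auto simp: sum_distrib_left)
    also have "\<dots> = (\<Sum>k<d. \<Sum>j<d. N' i j * (N j k * \<gamma> (u k)))" by (rule sum.swap)
    also have "\<dots> = (\<Sum>k<d. (\<Sum>j<d. N' i j * N j k) * \<gamma> (u k))" by (simp add: sum_distrib_right mult.assoc)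
    also have "\<dots> = (\<Sum>k<d. if k = i then \<gamma> (u k) else 0)" using tw(10)[OF t i] by (intro sum.cong) auto
    finally show ?thesis using i by simp
  qed
  \<comment> \<open>Translations have \<open>N' = \<sigma>(h)\<close>, the Galois group has the identity matrix.\<close>
  have "act A (u i) = (\<Sum>k<d. rconst (\<sigma> A $$ (i, k)) * u k)" if A: "A \<in> G" and i: "i < d" for A i
    using intertwines_act[OF \<sigma> A] equi[OF _ i] by blast
  moreover have "galois_map \<tau> (u i) = u i" if \<tau>: "\<tau> \<in> galois_group" and i: "i < d" for \<tau> i
  proof -
    obtain \<pi> N where t: "intertwines d \<sigma> (galois_map \<tau>) \<pi> N (\<lambda>i j. if i = j then 1 else 0)"
      using intertwines_galois[OF \<sigma> \<tau>] by blast
    have "(\<Sum>j<d. (if i = j then 1 else 0) * u j) = (\<Sum>j<d. if j = i then u j else 0)" by (intro sum.cong) auto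
    then show ?thesis using equi[OF t i] i by simp
  qed
  moreover have "?\<Lambda> y = ?q1 * (\<Sum>i<d. c i * u i)"
    using y1 by (simp add: sum_distrib_left mult_ac)
  then have "(\<Sum>i<d. c i * u i) \<noteq> 0" using y(3) by auto
  ultimately show ?thesis using u(1) by blast
qed

text \<open>The columns of the identity matrix are replaced one after the other by equivariant vectors. The determinant is
  a nonzero linear form in the column to be replaced, with the cofactors as coefficients, so
  \<open>equivariant_vector\<close> provides a column that keeps it nonzero.\<close>
theorem (in almost_free_representation) equivariant_frame:
  fixes \<sigma> :: "'a alg_closure mat \<Rightarrow> 'a alg_closure mat"
  assumes \<sigma>: "representation n d G \<sigma>"
  obtains U where "U \<in> carrier_mat d d" "det U \<noteq> 0" "\<And>i j. i < d \<Longrightarrow> j < d \<Longrightarrow> U $$ (i, j) \<in> L"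
    "\<And>A i j. A \<in> G \<Longrightarrow> i < d \<Longrightarrow> j < d \<Longrightarrow> act A (U $$ (i, j)) = (\<Sum>k<d. rconst (\<sigma> A $$ (i, k)) * U $$ (k, j))"
    "\<And>\<tau> i j. \<tau> \<in> galois_group \<Longrightarrow> i < d \<Longrightarrow> j < d \<Longrightarrow> galois_map \<tau> (U $$ (i, j)) = U $$ (i, j)"
proof -
  define E where "E u \<longleftrightarrow> (\<forall>i<d. u i \<in> L) \<and> (\<forall>A\<in>G. \<forall>i<d. act A (u i) = (\<Sum>k<d. rconst (\<sigma> A $$ (i, k)) * u k)) \<and>
    (\<forall>\<tau>\<in>galois_group. \<forall>i<d. galois_map \<tau> (u i) = u i)" for u
  have "\<exists>M\<in>carrier_mat d d. det M \<noteq> 0 \<and> (\<forall>j<t. E (\<lambda>i. M $$ (i, j)))" if "t \<le> d" for t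
    using that
  proof (induction t)
    case 0
    then show ?case by (intro bexI[of _ "1\<^sub>m d"]) simp_all
  next
    case (Suc t)
    then obtain M where M: "M \<in> carrier_mat d d" "det M \<noteq> 0" "\<And>j. j < t \<Longrightarrow> E (\<lambda>i. M $$ (i, j))" by auto
    have t: "t < d" using Suc.prems by simp
    have "det M = (\<Sum>i<d. M $$ (i, t) * cofactor M i t)" by (rule laplace_expansion_column[OF M(1) t])
    then obtain j0 where j0: "j0 < d" "cofactor M j0 t \<noteq> 0" using M(2) by (metis (no_types, lifting) lessThan_iff mult_zero_right sum.neutral)
    obtain u where u: "E u" "(\<Sum>i<d. cofactor M i t * u i) \<noteq> 0"
      using equivariant_vector[OF \<sigma> j0(1), of "\<lambda>i. cofactor M i t"] j0(2) unfolding E_def by blast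
    define M' where "M' = mat d d (\<lambda>(i, j). if j = t then u i else M $$ (i, j))"
    have M': "M' \<in> carrier_mat d d" by (simp add: M'_def)
    have "mat_delete M' i t = mat_delete M i t" if "i < d" for i
      using M(1) t that by (intro eq_matI) (auto simp: mat_delete_def M'_def)
    then have "det M' = (\<Sum>i<d. u i * cofactor M i t)"
      unfolding laplace_expansion_column[OF M' t] using t by (intro sum.cong) (simp_all add: cofactor_def M'_def)
    then have "det M' \<noteq> 0" using u(2) by (simp add: mult.commute)
    moreover have "E (\<lambda>i. M' $$ (i, j))" if "j < Suc t" for j
    proof -
      define w where "w = (if j = t then u else (\<lambda>i. M $$ (i, j)))"
      have eq: "M' $$ (i, j) = w i" if "i < d" for i using that \<open>j < Suc t\<close> t by (simp add: M'_def w_def)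
      have "j < t" if "j \<noteq> t" using that \<open>j < Suc t\<close> by simp
      then have "E w" unfolding w_def using u(1) M(3)[of j] by (cases "j = t") simp_all
      then show ?thesis unfolding E_def using eq by simp
    qed
    ultimately show ?case using M' by blast
  qed
  then obtain M where M: "M \<in> carrier_mat d d" "det M \<noteq> 0" and E: "\<And>j. j < d \<Longrightarrow> E (\<lambda>i. M $$ (i, j))"
    using order.refl[of d] by blast
  note ED = E[unfolded E_def]
  show ?thesis
  proof (rule that[OF M])
    show "M $$ (i, j) \<in> L" if "i < d" "j < d" for i j using ED[OF that(2)] that(1) by blast
    show "act A (M $$ (i, j)) = (\<Sum>k<d. rconst (\<sigma> A $$ (i, k)) * M $$ (k, j))" if "A \<in> G" "i < d" "j < d" for A i j
      using ED[OF that(3)] that(1,2) by blast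
    show "galois_map \<tau> (M $$ (i, j)) = M $$ (i, j)" if "\<tau> \<in> galois_group" "i < d" "j < d" for \<tau> i j
      using ED[OF that(3)] that(1,2) by blast
  qed
qed

section \<open>Direct sums and the no-name lemma\<close>

definition block_sum :: "'c::field mat \<Rightarrow> 'c mat \<Rightarrow> 'c mat"
  where "block_sum A B = four_block_mat A (0\<^sub>m (dim_row A) (dim_col B)) (0\<^sub>m (dim_row B) (dim_col A)) B"

lemma block_sum_carrier:
  "A \<in> carrier_mat m m \<Longrightarrow> B \<in> carrier_mat d d \<Longrightarrow> block_sum A B \<in> carrier_mat (m + d) (m + d)"
  unfolding block_sum_def by auto

lemma block_sum_index:
  assumes "A \<in> carrier_mat m m" "B \<in> carrier_mat d d" "i < m + d" "j < m + d"
  shows "block_sum A B $$ (i, j) = (if i < m then (if j < m then A $$ (i, j) else 0)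
    else (if j < m then 0 else B $$ (i - m, j - m)))"
  using assms unfolding block_sum_def by auto

lemma block_sum_mult:
  assumes "A \<in> carrier_mat m m" "B \<in> carrier_mat d d" "A' \<in> carrier_mat m m" "B' \<in> carrier_mat d d"
  shows "block_sum A B * block_sum A' B' = block_sum (A * A') (B * B')"
  using assms unfolding block_sum_def
  by (subst mult_four_block_mat[of _ m m _ d _ d]) auto

lemma block_sum_det:
  assumes "A \<in> carrier_mat m m" "B \<in> carrier_mat d d"
  shows "det (block_sum A B) = det A * det B"
  using assms unfolding block_sum_def by (intro det_four_block_mat_lower_left_zero) auto

lemma (in representation) representation_block_sum:
  assumes \<sigma>: "representation n d G \<sigma>"
  shows "representation n (m + d) G (\<lambda>A. block_sum (\<rho> A) (\<sigma> A))"
proof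
  interpret S: representation n d G \<sigma> by (rule \<sigma>)
  show "linear_algebraic_group n G" by (rule group)
  have hom: "(\<lambda>A. block_sum (\<rho> A) (\<sigma> A)) \<in> hom ((GL n)\<lparr>carrier := G\<rparr>) (GL (m + d))"
    unfolding hom_def
  proof (intro CollectI conjI ballI Pi_I)
    fix A B assume "A \<in> carrier ((GL n)\<lparr>carrier := G\<rparr>)" "B \<in> carrier ((GL n)\<lparr>carrier := G\<rparr>)"
    then have AB: "A \<in> G" "B \<in> G" by simp_all
    show "block_sum (\<rho> (A \<otimes>\<^bsub>(GL n)\<lparr>carrier := G\<rparr>\<^esub> B)) (\<sigma> (A \<otimes>\<^bsub>(GL n)\<lparr>carrier := G\<rparr>\<^esub> B)) =
        block_sum (\<rho> A) (\<sigma> A) \<otimes>\<^bsub>GL (m + d)\<^esub> block_sum (\<rho> B) (\<sigma> B)"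
      using block_sum_mult[OF rho_carrier[OF AB(1)] S.rho_carrier[OF AB(1)] rho_carrier[OF AB(2)] S.rho_carrier[OF AB(2)]]
      by (simp add: GL_simps rho_mult[OF AB] S.rho_mult[OF AB])
  next
    fix A assume "A \<in> carrier ((GL n)\<lparr>carrier := G\<rparr>)"
    then have A: "A \<in> G" by simp
    show "block_sum (\<rho> A) (\<sigma> A) \<in> carrier (GL (m + d))"
      unfolding GL_iff
      using block_sum_carrier[OF rho_carrier[OF A] S.rho_carrier[OF A]]
        block_sum_det[OF rho_carrier[OF A] S.rho_carrier[OF A]] rho_det[OF A] S.rho_det[OF A] by simp
  qed
  have ent: "\<exists>p\<in>polys (range to_ac) ({..<n} \<times> {..<n}). \<exists>e. \<forall>A\<in>G. block_sum (\<rho> A) (\<sigma> A) $$ (i, j) = eval_mat p A / det A ^ e"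
    if ij: "i < m + d" "j < m + d" for i j
  proof -
    note bs = block_sum_index[OF rho_carrier S.rho_carrier ij]
    consider "i < m" "j < m" | "\<not> i < m" "\<not> j < m" | "(i < m) \<noteq> (j < m)" by blast
    then show ?thesis
    proof cases
      case 1
      then obtain p e where "p \<in> polys (range to_ac) ({..<n} \<times> {..<n})" "\<forall>A\<in>G. \<rho> A $$ (i, j) = eval_mat p A / det A ^ e"
        using action unfolding linear_action_def by blast
      then show ?thesis using bs 1 by (intro bexI[of _ p] exI[of _ e]) simp_all
    next
      case 2
      then have "i - m < d" "j - m < d" using ij by auto
      then obtain p e where "p \<in> polys (range to_ac) ({..<n} \<times> {..<n})" "\<forall>A\<in>G. \<sigma> A $$ (i - m, j - m) = eval_mat p A / det A ^ e"
        using S.action unfolding linear_action_def by blast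
      then show ?thesis using bs 2 by (intro bexI[of _ p] exI[of _ e]) simp_all
    next
      case 3
      have "eval_mat 0 A = 0" for A :: "'k alg_closure mat" by (simp add: eval_mat_def eval_mpoly_0[OF ring_map_id])
      moreover have "0 \<in> polys (range to_ac) ({..<n} \<times> {..<n})" by (rule polysI) simp_all
      ultimately show ?thesis using bs 3 by (intro bexI[of _ 0] exI[of _ 0]) auto
    qed
  qed
  show "linear_action n G (m + d) (\<lambda>A. block_sum (\<rho> A) (\<sigma> A))"
    unfolding linear_action_def using hom ent by blast
qed

definition shift_exponents :: "nat \<Rightarrow> (nat \<Rightarrow>\<^sub>0 nat) \<Rightarrow> (nat \<Rightarrow>\<^sub>0 nat)"
  where "shift_exponents m s = (\<Sum>j\<in>Poly_Mapping.keys s. Poly_Mapping.single (m + j) (Poly_Mapping.lookup s j))"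

lemma lookup_shift_exponents:
  "Poly_Mapping.lookup (shift_exponents m s) i = (if i < m then 0 else Poly_Mapping.lookup s (i - m))"
proof -
  have "Poly_Mapping.lookup (shift_exponents m s) i =
      (\<Sum>j\<in>Poly_Mapping.keys s. if j = i - m then (if i < m then 0 else Poly_Mapping.lookup s j) else 0)"
    unfolding shift_exponents_def lookup_sum by (intro sum.cong refl) (auto simp: lookup_single when_def)
  then show ?thesis by (simp add: in_keys_iff)
qed

lemma of_poly_monom: "of_poly (Poly_Mapping.single t 1) = monom_value rvar t"
proof -
  have "of_poly (Poly_Mapping.single t 1) = monom_value (\<lambda>i. of_poly (mvar i)) t"
    unfolding monom_as_product[of t 1] monom_value_def
    by (simp add: ring_mapD[OF ring_map_of_poly] ring_mapD(1)[OF ring_map_mconst])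
  then show ?thesis by (simp add: rvar_def[abs_def])
qed

lemma monom_value_shift:
  "monom_value (\<lambda>j. rvar (m + j) :: 'c::field ratfun) s = monom_value rvar (shift_exponents m s)"
proof -
  have "monom_value rvar (\<Sum>j\<in>F. Poly_Mapping.single (m + j) (Poly_Mapping.lookup s j)) =
      (\<Prod>j\<in>F. (rvar (m + j) :: 'c ratfun) ^ Poly_Mapping.lookup s j)" for F
    by (induction F rule: infinite_finite_induct) (simp_all add: monom_value_0 monom_value_add monom_value_single)
  then show ?thesis unfolding shift_exponents_def monom_value_def[of "\<lambda>j. rvar (m + j)"] by simp
qed

lemma common_denominator:
  fixes f :: "'s \<Rightarrow> 'c::field ratfun"
  assumes "finite F" "\<And>s. s \<in> F \<Longrightarrow> f s \<in> ratfuns UNIV m"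
  shows "\<exists>D. D \<noteq> 0 \<and> (\<exists>N. \<forall>s\<in>F. N s \<in> polys UNIV {..<m} \<and> f s * of_poly D = of_poly (N s)) \<and> D \<in> polys UNIV {..<m}"
  using assms
proof (induction F rule: finite_induct)
  case empty
  have "(1 :: (nat, 'c) mpoly) \<in> polys UNIV {..<m}" by (rule subring_setD(1)[OF subring_set_polys[OF subring_set_UNIV]])
  then show ?case by (intro exI[of _ 1]) simp
next
  case (insert x F)
  note P = subring_setD(4)[OF subring_set_polys[OF subring_set_UNIV]] and e = ring_mapD(4)[OF ring_map_of_poly]
  obtain D N where D: "D \<noteq> 0" "D \<in> polys UNIV {..<m}" "\<forall>s\<in>F. N s \<in> polys UNIV {..<m} \<and> f s * of_poly D = of_poly (N s)"
    using insert.IH insert.prems by blast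
  have fx: "f x \<in> ratfuns UNIV m" using insert.prems by simp
  obtain p q where pq: "p \<in> polys UNIV {..<m}" "q \<in> polys UNIV {..<m}" "q \<noteq> 0" "f x = of_poly p / of_poly q"
    using fx unfolding ratfuns_iff by blast
  have q0: "of_poly q \<noteq> 0" using pq(3) by (simp add: of_poly_eq_0_iff)
  define N' where "N' s = (if s = x then p * D else N s * q)" for s
  have "N' s \<in> polys UNIV {..<m} \<and> f s * of_poly (D * q) = of_poly (N' s)" if s: "s \<in> insert x F" for s
  proof (cases "s = x")
    case True
    then show ?thesis using P[OF pq(1) D(2)] q0 pq(4) by (simp add: N'_def e)
  next
    case False
    then have h: "N s \<in> polys UNIV {..<m}" "f s * of_poly D = of_poly (N s)" using s D(3) by auto
    have "f s * of_poly (D * q) = of_poly (N s) * of_poly q" unfolding e h(2)[symmetric] by (simp add: mult.assoc)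
    then show ?thesis using P[OF h(1) pq(2)] False by (simp add: N'_def e)
  qed
  moreover have "D * q \<noteq> 0" "D * q \<in> polys UNIV {..<m}" using D pq P by simp_all
  ultimately show ?case by blast
qed

text \<open>After clearing denominators, the coefficients involve only the first \<open>m\<close> variables, so products of their
  monomials with monomials in the later variables are all distinct and cannot cancel.\<close>
lemma later_variables_independent:
  fixes p :: "(nat, 'c::field ratfun) mpoly"
  assumes p: "p \<in> polys (ratfuns UNIV m) {..<d}" and z: "eval_mpoly (\<lambda>c. c) (\<lambda>j. rvar (m + j)) p = 0"
  shows "p = 0"
proof (rule ccontr)
  assume "p \<noteq> 0"
  then obtain s0 where s0: "s0 \<in> Poly_Mapping.keys p"
    by (metis lookup_zero not_in_keys_iff_lookup_eq_zero poly_mapping_eqI)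
  let ?l = "Poly_Mapping.lookup"
  have "\<exists>D. D \<noteq> 0 \<and> (\<exists>N. \<forall>s\<in>Poly_Mapping.keys p. N s \<in> polys UNIV {..<m} \<and> ?l p s * of_poly D = of_poly (N s)) \<and>
      D \<in> polys UNIV {..<m}"
    by (rule common_denominator) (use polysD(1)[OF p] in simp_all)
  then obtain D N where D: "D \<noteq> 0" and N: "\<And>s. s \<in> Poly_Mapping.keys p \<Longrightarrow> N s \<in> polys UNIV {..<m}"
    "\<And>s. s \<in> Poly_Mapping.keys p \<Longrightarrow> ?l p s * of_poly D = of_poly (N s)" by blast
  define W where "W = (\<Sum>s\<in>Poly_Mapping.keys p. N s * Poly_Mapping.single (shift_exponents m s) 1)"
  have "of_poly W = (\<Sum>s\<in>Poly_Mapping.keys p. (?l p s * of_poly D) * monom_value (\<lambda>j. rvar (m + j)) s)"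
    unfolding W_def by (simp add: ring_mapD[OF ring_map_of_poly] N(2) of_poly_monom monom_value_shift)
  also have "\<dots> = of_poly D * eval_mpoly (\<lambda>c. c) (\<lambda>j. rvar (m + j)) p"
    unfolding eval_mpoly_def monom_value_def[symmetric] by (simp add: sum_distrib_left mult_ac)
  finally have W0: "W = 0" using z by (simp add: of_poly_eq_0_iff)
  have "N s0 \<noteq> 0" using N(2)[OF s0] s0 D by (metis in_keys_iff mult_eq_0_iff of_poly_eq_0_iff)
  then obtain u0 where u0: "?l (N s0) u0 \<noteq> 0"
    by (metis lookup_zero poly_mapping_eqI)
  have small: "?l u i = 0" if "s \<in> Poly_Mapping.keys p" "u \<in> Poly_Mapping.keys (N s)" "i \<ge> m" for s u i
    using polysD(2)[OF N(1)[OF that(1)] that(2), of i] that(3) by (auto simp: in_keys_iff)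
  have u0k: "u0 \<in> Poly_Mapping.keys (N s0)" using u0 by (simp add: in_keys_iff)
  let ?v = "u0 + shift_exponents m s0"
  have eq: "s = s0 \<and> u = u0" if su: "s \<in> Poly_Mapping.keys p" "u \<in> Poly_Mapping.keys (N s)" "u + shift_exponents m s = ?v" for s u
  proof -
    have l: "?l u i + ?l (shift_exponents m s) i = ?l u0 i + ?l (shift_exponents m s0) i" for i
      using arg_cong[OF su(3), of "\<lambda>w. ?l w i"] by (simp add: lookup_add)
    have "?l s j = ?l s0 j" for j
      using l[of "m + j"] small[OF su(1,2), of "m + j"] small[OF s0 u0k, of "m + j"] by (simp add: lookup_shift_exponents)
    then have "s = s0" by (rule poly_mapping_eqI)
    then show ?thesis using su(3) by simp
  qed
  have "?l W ?v = (\<Sum>s\<in>Poly_Mapping.keys p. \<Sum>u\<in>Poly_Mapping.keys (N s). if s = s0 \<and> u = u0 then ?l (N s0) u0 else 0)"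
  proof -
    have "N s * Poly_Mapping.single (shift_exponents m s) 1 =
        (\<Sum>u\<in>Poly_Mapping.keys (N s). Poly_Mapping.single (u + shift_exponents m s) (?l (N s) u))" for s
      by (subst mpoly_as_sum[of "N s"]) (simp add: sum_distrib_right mult_single)
    then have "?l W ?v = (\<Sum>s\<in>Poly_Mapping.keys p. \<Sum>u\<in>Poly_Mapping.keys (N s).
        ?l (Poly_Mapping.single (u + shift_exponents m s) (?l (N s) u)) ?v)"
      unfolding W_def by (simp add: lookup_sum)
    also have "\<dots> = (\<Sum>s\<in>Poly_Mapping.keys p. \<Sum>u\<in>Poly_Mapping.keys (N s). if s = s0 \<and> u = u0 then ?l (N s0) u0 else 0)"
    proof (intro sum.cong refl)
      fix s u assume su: "s \<in> Poly_Mapping.keys p" "u \<in> Poly_Mapping.keys (N s)"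
      show "?l (Poly_Mapping.single (u + shift_exponents m s) (?l (N s) u)) ?v = (if s = s0 \<and> u = u0 then ?l (N s0) u0 else 0)"
        using eq[OF su] by (auto simp: lookup_single when_def)
    qed
    finally show ?thesis .
  qed
  also have "\<dots> = (\<Sum>s\<in>Poly_Mapping.keys p. if s = s0 then ?l (N s0) u0 else 0)"
    using u0k by (intro sum.cong refl) (auto simp: sum.delta)
  also have "\<dots> = ?l (N s0) u0" using s0 by simp
  finally show False using W0 u0 by simp
qed

lemma ring_iso_field_on_iff:
  "\<Phi> \<in> ring_iso (field_on K) (field_on K') \<longleftrightarrow> bij_betw \<Phi> K K' \<and> \<Phi> 1 = 1 \<and>
    (\<forall>a\<in>K. \<forall>b\<in>K. \<Phi> (a + b) = \<Phi> a + \<Phi> b \<and> \<Phi> (a * b) = \<Phi> a * \<Phi> b)"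
  unfolding ring_iso_def Ring.ring_hom_def field_on_def ring_of_type_algebra_def
  by (auto simp: bij_betw_def)

lemma det_in_subfield:
  assumes K: "subring_set (K :: 'f::field set)" and M: "M \<in> carrier_mat n n"
    and "\<And>i j. i < n \<Longrightarrow> j < n \<Longrightarrow> M $$ (i, j) \<in> K"
  shows "det M \<in> K"
  using specialisation_det(1)[OF ring_map_specialisation[OF ring_map_id] K M] assms(3) by blast

lemma inverse_matrix_in_subfield:
  assumes K: "subfield_set (K :: 'f::field set)" and U: "U \<in> carrier_mat n n" "det U \<noteq> 0"
    and ent: "\<And>i j. i < n \<Longrightarrow> j < n \<Longrightarrow> U $$ (i, j) \<in> K"
  obtains T where "T \<in> carrier_mat n n" "U * T = 1\<^sub>m n" "T * U = 1\<^sub>m n" "\<And>i j. i < n \<Longrightarrow> j < n \<Longrightarrow> T $$ (i, j) \<in> K"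
proof -
  note sK = subring_setD[OF subfield_setD(1)[OF K]]
  define T where "T = inverse (det U) \<cdot>\<^sub>m adj_mat U"
  note adj = adj_mat[OF U(1)]
  have T: "T \<in> carrier_mat n n" using adj(1) by (simp add: T_def)
  have one: "inverse (det U) \<cdot>\<^sub>m (det U \<cdot>\<^sub>m 1\<^sub>m n) = 1\<^sub>m n" using U(2) by (intro eq_matI) auto
  have UT: "U * T = 1\<^sub>m n" unfolding T_def mult_smult_distrib[OF U(1) adj(1)] adj(2) by (rule one)
  have TU: "T * U = 1\<^sub>m n" unfolding T_def mult_smult_assoc_mat[OF adj(1) U(1)] adj(3) by (rule one)
  have TK: "T $$ (i, j) \<in> K" if ij: "i < n" "j < n" for i j
  proof -
    have del: "mat_delete U j i \<in> carrier_mat (n - 1) (n - 1)" using U(1) by (auto simp: mat_delete_def)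
    have "det (mat_delete U j i) \<in> K"
      by (rule det_in_subfield[OF subfield_setD(1)[OF K] del])
         (use U(1) ij ent in \<open>auto simp: mat_delete_def\<close>)
    then have "cofactor U j i \<in> K" unfolding cofactor_def using sK by auto
    moreover have "inverse (det U) \<in> K" by (rule subfield_setD(2)[OF K det_in_subfield[OF subfield_setD(1)[OF K] U(1) ent]])
    moreover have "T $$ (i, j) = inverse (det U) * cofactor U j i"
      using U(1) ij by (simp add: T_def adj_mat_def)
    ultimately show ?thesis using sK(4) by simp
  qed
  show ?thesis by (rule that[OF T UT TU]) (rule TK)
qed

lemma eval_mpoly_map:
  assumes h: "ring_map h" and g: "ring_map g"
  shows "eval_mpoly h \<alpha> (Poly_Mapping.map g p) = eval_mpoly (\<lambda>c. h (g c)) \<alpha> p"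
  unfolding map_mpoly_eval[OF g]
  by (subst ring_map_eval[OF ring_map_eval_mpoly[OF h]]) (simp add: eval_mpoly_mconst[OF h] eval_mpoly_mvar[OF h])

lemma map_in_polys:
  assumes "p \<in> polys K Vs" "\<And>c. c \<in> K \<Longrightarrow> g c \<in> K" "g 0 = 0"
  shows "Poly_Mapping.map g p \<in> polys K Vs"
proof (rule polysI)
  fix t assume "t \<in> Poly_Mapping.keys (Poly_Mapping.map g p)"
  then have t: "t \<in> Poly_Mapping.keys p" using assms(3) by (auto simp: in_keys_iff Poly_Mapping.map.rep_eq when_def split: if_splits)
  show "Poly_Mapping.lookup (Poly_Mapping.map g p) t \<in> K"
    using assms(2)[OF polysD(1)[OF assms(1) t]] t by (simp add: Poly_Mapping.map.rep_eq in_keys_iff)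
  show "x \<in> Vs" if "x \<in> Poly_Mapping.keys t" for x using polysD(2)[OF assms(1) t that] .
qed

lemma subring_set_evaluations:
  assumes h: "ring_map h" and K: "subring_set K"
  shows "subring_set (eval_mpoly h \<alpha> ` polys K Vs)"
  unfolding subring_set_def
proof (intro conjI ballI)
  note P = subring_setD[OF subring_set_polys[OF K, of Vs]] and e = ring_mapD[OF ring_map_eval_mpoly[OF h, of \<alpha>]]
  show "1 \<in> eval_mpoly h \<alpha> ` polys K Vs" using P(1) e(1) by (metis imageI)
  fix a b assume "a \<in> eval_mpoly h \<alpha> ` polys K Vs" "b \<in> eval_mpoly h \<alpha> ` polys K Vs"
  then obtain p q where pq: "p \<in> polys K Vs" "q \<in> polys K Vs" "a = eval_mpoly h \<alpha> p" "b = eval_mpoly h \<alpha> q" by blast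
  show "a + b \<in> eval_mpoly h \<alpha> ` polys K Vs" unfolding pq e(3)[symmetric] by (intro imageI P pq)
  show "a * b \<in> eval_mpoly h \<alpha> ` polys K Vs" unfolding pq e(4)[symmetric] by (intro imageI P pq)
  show "- a \<in> eval_mpoly h \<alpha> ` polys K Vs" unfolding pq e(5)[symmetric] by (intro imageI P pq)
qed

lemma (in representation) subfield_invariant_field: "subfield_set (invariant_field G m \<rho>)"
proof -
  define \<Gamma> where "\<Gamma> = act ` G \<union> galois_map ` galois_group"
  have iff: "x \<in> invariant_field G m \<rho> \<longleftrightarrow> x \<in> L \<and> (\<forall>\<gamma>\<in>\<Gamma>. \<gamma> x = x)" for x
    unfolding invariant_field_iff \<Gamma>_def by auto
  have r: "ring_map \<gamma>" if "\<gamma> \<in> \<Gamma>" for \<gamma> using that act_props(1) galois_map_props(1) unfolding \<Gamma>_def by blast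
  show ?thesis
    unfolding subfield_set_def subring_set_def
  proof (intro conjI ballI)
    show "1 \<in> invariant_field G m \<rho>" unfolding iff using L_closed(1) ring_mapD(1)[OF r] by simp
    fix a b assume a: "a \<in> invariant_field G m \<rho>" and b: "b \<in> invariant_field G m \<rho>"
    have *: "\<gamma> (a + b) = a + b \<and> \<gamma> (a * b) = a * b \<and> \<gamma> (- a) = - a" if g: "\<gamma> \<in> \<Gamma>" for \<gamma>
    proof -
      have "\<gamma> a = a" "\<gamma> b = b" using a b g unfolding iff by blast+
      then show ?thesis by (simp add: ring_mapD[OF r[OF g]])
    qed
    have ab: "a \<in> L" "b \<in> L" using a b unfolding iff by blast+
    show "a + b \<in> invariant_field G m \<rho>" unfolding iff using * L_closed(3)[OF ab] by blast
    show "a * b \<in> invariant_field G m \<rho>" unfolding iff using * L_closed(4)[OF ab] by blast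
    show "- a \<in> invariant_field G m \<rho>" unfolding iff using * L_closed(5)[OF ab(1)] by blast
  next
    fix a assume a: "a \<in> invariant_field G m \<rho>"
    have "\<gamma> (inverse a) = inverse a" if g: "\<gamma> \<in> \<Gamma>" for \<gamma>
    proof -
      have "\<gamma> a = a" using a g unfolding iff by blast
      then show ?thesis
        using ring_map_divide[OF r[OF g], of 1 a] ring_mapD(1)[OF r[OF g]] by (simp add: inverse_eq_divide)
    qed
    moreover have "a \<in> L" using a unfolding iff by blast
    ultimately show "inverse a \<in> invariant_field G m \<rho>" unfolding iff using subfield_setD(2)[OF L_subfield] by blast
  qed
qed

lemma (in representation) base_embedding_invariant: "base_embedding c \<in> invariant_field G m \<rho>"
  unfolding invariant_field_iff base_embedding_def
  using rconst_in_ratfuns[OF subring_set_UNIV UNIV_I] act_props(2) galois_map_props(2) galois_groupD(2) by metis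

text \<open>The forms \<open>t = U\<^sup>-\<^sup>1 y\<close> built from an equivariant frame \<open>U\<close> are invariant and independent over \<open>L\<close>, and
  evaluation at \<open>t\<close> is the desired isomorphism. Its image is all of the invariant field by descent: the
  pairs \<open>(p, q)\<close> of polynomials over \<open>L\<close> with \<open>p(t) = g q(t)\<close>, for an invariant \<open>g\<close>, form a space that is stable under
  all symmetries, so it contains a fixed pair with \<open>q \<noteq> 0\<close>, that is, one with coefficients in the invariant
  field of \<open>V\<close>.\<close>
theorem (in almost_free_representation) no_name_lemma:
  fixes \<sigma> :: "'a alg_closure mat \<Rightarrow> 'a alg_closure mat"
  assumes \<sigma>: "representation n d G \<sigma>"
  shows "\<exists>\<Phi>\<in>ring_iso (field_on (ratfuns (invariant_field G m \<rho>) d))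
      (field_on (invariant_field G (m + d) (\<lambda>A. block_sum (\<rho> A) (\<sigma> A)))).
    \<forall>c. \<Phi> (rconst (base_embedding c)) = base_embedding c"
proof -
  interpret S: representation n d G \<sigma> by (rule \<sigma>)
  interpret D: representation n "m + d" G "\<lambda>A. block_sum (\<rho> A) (\<sigma> A)" by (rule representation_block_sum[OF \<sigma>])
  let ?F = "invariant_field G m \<rho>" and ?I = "invariant_field G (m + d) (\<lambda>A. block_sum (\<rho> A) (\<sigma> A))"
  note bs = block_sum_index[OF rho_carrier S.rho_carrier]
  obtain U where U: "U \<in> carrier_mat d d" "det U \<noteq> 0" "\<And>i j. i < d \<Longrightarrow> j < d \<Longrightarrow> U $$ (i, j) \<in> L"
    "\<And>A i j. A \<in> G \<Longrightarrow> i < d \<Longrightarrow> j < d \<Longrightarrow> act A (U $$ (i, j)) = (\<Sum>k<d. rconst (\<sigma> A $$ (i, k)) * U $$ (k, j))"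
    "\<And>\<tau> i j. \<tau> \<in> galois_group \<Longrightarrow> i < d \<Longrightarrow> j < d \<Longrightarrow> galois_map \<tau> (U $$ (i, j)) = U $$ (i, j)"
    apply (rule equivariant_frame[OF \<sigma>])
    subgoal premises prems for U by (rule prems(1)[OF prems(2,3)]) (rule prems(4,5,6); assumption)+
    done
  obtain T where T: "T \<in> carrier_mat d d" "U * T = 1\<^sub>m d" "T * U = 1\<^sub>m d" "\<And>i j. i < d \<Longrightarrow> j < d \<Longrightarrow> T $$ (i, j) \<in> L"
    apply (rule inverse_matrix_in_subfield[OF L_subfield U(1,2)])
    subgoal by (rule U(3))
    subgoal premises prems for T by (rule prems(1)[OF prems(2,3,4)]) (rule prems(5))
    done
  have UT: "(\<Sum>j<d. U $$ (i, j) * T $$ (j, k)) = (if i = k then 1 else 0)"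
    and TU: "(\<Sum>j<d. T $$ (i, j) * U $$ (j, k)) = (if i = k then 1 else 0)" if "i < d" "k < d" for i k
  proof -
    have "(U * T) $$ (i, k) = (\<Sum>j<d. U $$ (i, j) * T $$ (j, k))" "(T * U) $$ (i, k) = (\<Sum>j<d. T $$ (i, j) * U $$ (j, k))"
      using that U(1) T(1) by (simp_all add: scalar_prod_def lessThan_atLeast0)
    then show "(\<Sum>j<d. U $$ (i, j) * T $$ (j, k)) = (if i = k then 1 else 0)"
      "(\<Sum>j<d. T $$ (i, j) * U $$ (j, k)) = (if i = k then 1 else 0)" using T(2,3) that by simp_all
  qed
  let ?y = "\<lambda>i. rvar (m + i) :: 'a alg_closure ratfun"
  define t where "t j = (\<Sum>i<d. T $$ (j, i) * ?y i)" for j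
  have yt: "?y i = (\<Sum>j<d. U $$ (i, j) * t j)" if i: "i < d" for i
  proof -
    have "(\<Sum>j<d. U $$ (i, j) * t j) = (\<Sum>j<d. \<Sum>k<d. U $$ (i, j) * T $$ (j, k) * ?y k)"
      by (simp add: t_def sum_distrib_left mult.assoc)
    also have "\<dots> = (\<Sum>k<d. (\<Sum>j<d. U $$ (i, j) * T $$ (j, k)) * ?y k)" by (subst sum.swap) (simp add: sum_distrib_right)
    also have "\<dots> = (\<Sum>k<d. if k = i then ?y k else 0)" using UT[OF i] by (intro sum.cong) auto
    finally show ?thesis using i by simp
  qed
  have t_fixed: "\<gamma> (t l) = t l"
    if \<gamma>: "ring_map \<gamma>" and y: "\<And>i. i < d \<Longrightarrow> \<gamma> (?y i) = (\<Sum>j<d. \<gamma> (U $$ (i, j)) * t j)" and l: "l < d" for \<gamma> l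
  proof -
    note r = ring_mapD[OF \<gamma>]
    have "\<gamma> (t l) = (\<Sum>i<d. \<gamma> (T $$ (l, i)) * \<gamma> (?y i))" by (simp add: t_def r)
    also have "\<dots> = (\<Sum>i<d. \<Sum>j<d. \<gamma> (T $$ (l, i) * U $$ (i, j)) * t j)"
      using y by (intro sum.cong) (simp_all add: r sum_distrib_left mult.assoc)
    also have "\<dots> = (\<Sum>j<d. \<gamma> (\<Sum>i<d. T $$ (l, i) * U $$ (i, j)) * t j)"
      by (subst sum.swap) (simp add: r(9) sum_distrib_right)
    also have "\<dots> = (\<Sum>j<d. if j = l then t j else 0)" using TU[OF l] r by (intro sum.cong) auto
    finally show ?thesis using l by simp
  qed
  have D_act_L: "D.act A f = act A f" if A: "A \<in> G" and f: "f \<in> L" for A f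
  proof -
    note a = act_props[OF A A] and b = D.act_props[OF A A]
    have ev: "D.act A (of_poly p) = act A (of_poly p)" if p: "p \<in> polys UNIV {..<m}" for p
    proof -
      have v: "D.act A (rvar i) = act A (rvar i)" if i: "i < m" for i
      proof -
        have "D.act A (rvar i) = (\<Sum>j<m + d. rconst (block_sum (\<rho> A) (\<sigma> A) $$ (i, j)) * rvar j)" using b(3)[of i] i by simp
        also have "\<dots> = (\<Sum>j<m. rconst (block_sum (\<rho> A) (\<sigma> A) $$ (i, j)) * rvar j)"
          using bs[OF A A] i by (intro sum.mono_neutral_right) (auto simp: ring_mapD[OF ring_map_rconst])
        also have "\<dots> = act A (rvar i)" using a(3)[of i] i bs[OF A A] by simp
        finally show ?thesis .
      qed
      have "D.act A (of_poly p) = eval_mpoly (\<lambda>c. D.act A (rconst c)) (\<lambda>i. D.act A (rvar i)) p"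
        unfolding of_poly_eval by (rule ring_map_eval[OF b(1)])
      also have "\<dots> = eval_mpoly (\<lambda>c. act A (rconst c)) (\<lambda>i. act A (rvar i)) p"
        by (rule eval_mpoly_cong[OF p]) (simp_all only: a(2) b(2) v lessThan_iff)
      also have "\<dots> = act A (of_poly p)" unfolding of_poly_eval by (rule ring_map_eval[OF a(1), symmetric])
      finally show ?thesis .
    qed
    obtain p q where "p \<in> polys UNIV {..<m}" "q \<in> polys UNIV {..<m}" "f = of_poly p / of_poly q" using f unfolding ratfuns_iff by blast
    then show ?thesis using ev by (simp add: ring_map_divide[OF a(1)] ring_map_divide[OF b(1)])
  qed
  define \<Gamma> where "\<Gamma> = D.act ` G \<union> galois_map ` (galois_group :: ('a alg_closure \<Rightarrow> 'a alg_closure) set)"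
  have \<Gamma>: "ring_map \<gamma>" "x \<in> L \<Longrightarrow> \<gamma> x \<in> L" "l < d \<Longrightarrow> \<gamma> (t l) = t l" if g: "\<gamma> \<in> \<Gamma>" for \<gamma> x l
  proof -
    consider A where "A \<in> G" "\<gamma> = D.act A" | \<tau> where "\<tau> \<in> galois_group" "\<gamma> = galois_map \<tau>" using g unfolding \<Gamma>_def by blast
    then have "ring_map \<gamma> \<and> (\<forall>x\<in>L. \<gamma> x \<in> L) \<and> (\<forall>l<d. \<gamma> (t l) = t l)"
    proof cases
      case (1 A)
      note b = D.act_props[OF 1(1) 1(1)]
      have "D.act A (?y i) = (\<Sum>j<d. D.act A (U $$ (i, j)) * t j)" if i: "i < d" for i
      proof -
        have "D.act A (?y i) = (\<Sum>j<m + d. rconst (block_sum (\<rho> A) (\<sigma> A) $$ (m + i, j)) * rvar j)" using b(3)[of "m + i"] i by simp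
        also have "\<dots> = (\<Sum>j\<in>(\<lambda>k. m + k) ` {..<d}. rconst (block_sum (\<rho> A) (\<sigma> A) $$ (m + i, j)) * rvar j)"
        proof (rule sum.mono_neutral_right)
          show "\<forall>j\<in>{..<m + d} - (\<lambda>k. m + k) ` {..<d}. rconst (block_sum (\<rho> A) (\<sigma> A) $$ (m + i, j)) * rvar j = 0"
          proof
            fix j assume j: "j \<in> {..<m + d} - (\<lambda>k. m + k) ` {..<d}"
            have "j < m"
            proof (rule ccontr)
              assume "\<not> j < m"
              then have "j = m + (j - m)" "j - m < d" using j by auto
              then show False using j by blast
            qed
            then show "rconst (block_sum (\<rho> A) (\<sigma> A) $$ (m + i, j)) * rvar j = 0"
              using bs[OF 1(1) 1(1), of "m + i" j] i by (simp add: ring_mapD[OF ring_map_rconst])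
          qed
        qed auto
        also have "\<dots> = (\<Sum>k<d. rconst (\<sigma> A $$ (i, k)) * ?y k)"
          using bs[OF 1(1) 1(1), of "m + i"] i by (subst sum.reindex) (auto simp: inj_on_def)
        also have "\<dots> = (\<Sum>k<d. \<Sum>j<d. rconst (\<sigma> A $$ (i, k)) * U $$ (k, j) * t j)"
          using yt by (intro sum.cong) (simp_all add: sum_distrib_left mult.assoc)
        also have "\<dots> = (\<Sum>j<d. (\<Sum>k<d. rconst (\<sigma> A $$ (i, k)) * U $$ (k, j)) * t j)"
          by (subst sum.swap) (simp add: sum_distrib_right)
        also have "\<dots> = (\<Sum>j<d. D.act A (U $$ (i, j)) * t j)"
          using U(4)[OF 1(1) i] D_act_L[OF 1(1) U(3)[OF i]] by (intro sum.cong) simp_all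
        finally show ?thesis .
      qed
      from t_fixed[OF b(1) this] show ?thesis
        using b(1) D_act_L[OF 1(1)] act_props(4)[OF 1(1) 1(1)] unfolding 1(2) by simp
    next
      case (2 \<tau>)
      note g = galois_map_props[OF 2(1)]
      have "galois_map \<tau> (?y i) = (\<Sum>j<d. galois_map \<tau> (U $$ (i, j)) * t j)" if i: "i < d" for i
        using yt[OF i] U(5)[OF 2(1) i] g(3)[of "m + i"] by simp
      from t_fixed[OF g(1) this] show ?thesis using g(1,4) unfolding 2(2) by simp
    qed
    then show "ring_map \<gamma>" "x \<in> L \<Longrightarrow> \<gamma> x \<in> L" "l < d \<Longrightarrow> \<gamma> (t l) = t l" by blast+
  qed
  have F_iff: "x \<in> ?F \<longleftrightarrow> x \<in> L \<and> (\<forall>\<gamma>\<in>\<Gamma>. \<gamma> x = x)" for x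
  proof (cases "x \<in> L")
    case True
    then show ?thesis unfolding invariant_field_iff \<Gamma>_def ball_Un by (simp add: D_act_L)
  qed (simp add: invariant_field_iff)
  have I_iff: "x \<in> ?I \<longleftrightarrow> x \<in> D.L \<and> (\<forall>\<gamma>\<in>\<Gamma>. \<gamma> x = x)" for x
    unfolding D.invariant_field_iff \<Gamma>_def by auto
  note Ffield = subfield_invariant_field and Fring = subfield_setD(1)[OF subfield_invariant_field]
  have FL: "?F \<subseteq> L" using F_iff by blast
  define ev where "ev = eval_mpoly (\<lambda>c :: 'a alg_closure ratfun. c) t"
  have evr: "ring_map ev" unfolding ev_def by (rule ring_map_eval_mpoly[OF ring_map_id])
  note ev = ring_mapD[OF evr]
  have ev0: "p = 0" if p: "p \<in> polys L {..<d}" and z: "ev p = 0" for p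
  proof -
    have "eval_mpoly (\<lambda>c. c) ?y (lin_subst d T p) = eval_mpoly (\<lambda>c. c) (\<lambda>j. eval_mpoly (\<lambda>c. c) ?y
        (if j < d then \<Sum>k<d. mconst (T $$ (j, k)) * mvar k else mvar j)) p"
      unfolding lin_subst_def by (rule eval_mpoly_subst[OF ring_map_id])
    also have "\<dots> = ev p"
      unfolding ev_def
      by (rule eval_mpoly_cong[OF p]) (simp_all add: t_def ring_mapD[OF ring_map_eval_mpoly[OF ring_map_id]]
          eval_mpoly_mconst[OF ring_map_id] eval_mpoly_mvar[OF ring_map_id])
    finally have "eval_mpoly (\<lambda>c. c) ?y (lin_subst d T p) = 0" using z by simp
    moreover have "lin_subst d T p \<in> polys L {..<d}"
      unfolding lin_subst_def using subring_set_polys[OF L_subring] p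
    proof (rule eval_mpoly_in_subring)
      fix x assume "x \<in> {..<d}"
      then show "(if x < d then \<Sum>j<d. mconst (T $$ (x, j)) * mvar j else mvar x) \<in> polys L {..<d}"
        using T(4) L_closed(1) by (auto intro!: polys_sum polys_mult mconst_in_polys mvar_in_polys L_subring)
    qed (auto intro: mconst_in_polys)
    ultimately have z': "lin_subst d T p = 0" by (intro later_variables_independent)
    have "lin_subst d U (lin_subst d T p) = p" using lin_subst_lin_subst[OF U(1) T(1)] T(3) by (simp add: lin_subst_one)
    then have "p = lin_subst d U 0" unfolding z' by (rule sym)
    also have "\<dots> = 0" by (rule ring_mapD(2)[OF ring_map_lin_subst])
    finally show ?thesis .
  qed
  have polysFL: "p \<in> polys L {..<d}" if "p \<in> polys ?F {..<d}" for p using that FL order.refl by (rule polys_mono)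
  \<comment> \<open>The isomorphism evaluates the new variables at the invariants t.\<close>
  define \<Phi> where "\<Phi> f = (THE g. \<forall>p q. p \<in> polys ?F {..<d} \<longrightarrow> q \<in> polys ?F {..<d} \<longrightarrow> q \<noteq> 0 \<longrightarrow>
    f = of_poly p / of_poly q \<longrightarrow> g = ev p / ev q)" for f
  have \<Phi>: "\<Phi> (of_poly p / of_poly q) = ev p / ev q" if pq: "p \<in> polys ?F {..<d}" "q \<in> polys ?F {..<d}" "q \<noteq> 0" for p q
    unfolding \<Phi>_def
  proof (rule the_equality)
    show "\<forall>p' q'. p' \<in> polys ?F {..<d} \<longrightarrow> q' \<in> polys ?F {..<d} \<longrightarrow> q' \<noteq> 0 \<longrightarrow>
        of_poly p / of_poly q = of_poly p' / of_poly q' \<longrightarrow> ev p / ev q = ev p' / ev q'"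
    proof (intro allI impI)
      fix p' q' assume pq': "p' \<in> polys ?F {..<d}" "q' \<in> polys ?F {..<d}" "q' \<noteq> 0"
        and eq: "of_poly p / of_poly q = of_poly p' / of_poly q'"
      have "of_poly (p * q') = of_poly (p' * q)"
        using eq pq(3) pq'(3) by (simp add: ring_mapD[OF ring_map_of_poly] of_poly_eq_0_iff frac_eq_eq)
      then have "of_poly (p * q' - p' * q) = 0" by (simp add: ring_mapD[OF ring_map_of_poly])
      then have "p * q' = p' * q" by (simp add: of_poly_eq_0_iff)
      then have "ev p * ev q' = ev p' * ev q" by (metis ev(4))
      moreover have "ev q \<noteq> 0" "ev q' \<noteq> 0" using ev0[OF polysFL] pq pq' by blast+
      ultimately show "ev p / ev q = ev p' / ev q'" by (simp add: frac_eq_eq)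
    qed
  qed (use pq in blast)
  have Frep: "\<exists>p q. p \<in> polys ?F {..<d} \<and> q \<in> polys ?F {..<d} \<and> q \<noteq> 0 \<and> f = of_poly p / of_poly q \<and> ev q \<noteq> 0 \<and> \<Phi> f = ev p / ev q"
    if f: "f \<in> ratfuns ?F d" for f
  proof -
    obtain p q where pq: "p \<in> polys ?F {..<d}" "q \<in> polys ?F {..<d}" "q \<noteq> 0" "f = of_poly p / of_poly q"
      using f unfolding ratfuns_iff by blast
    moreover have "ev q \<noteq> 0" using ev0[OF polysFL] pq by blast
    ultimately show ?thesis using \<Phi>[OF pq(1-3)] by blast
  qed
  note P = subring_setD[OF subring_set_polys[OF Fring, of "{..<d}"]] and op = ring_mapD[OF ring_map_of_poly]
  have hom: "\<Phi> (f + g) = \<Phi> f + \<Phi> g \<and> \<Phi> (f * g) = \<Phi> f * \<Phi> g" if fg: "f \<in> ratfuns ?F d" "g \<in> ratfuns ?F d" for f g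
  proof -
    obtain p q where pq: "p \<in> polys ?F {..<d}" "q \<in> polys ?F {..<d}" "q \<noteq> 0" "f = of_poly p / of_poly q" "ev q \<noteq> 0" "\<Phi> f = ev p / ev q"
      using Frep[OF fg(1)] by blast
    obtain p' q' where pq': "p' \<in> polys ?F {..<d}" "q' \<in> polys ?F {..<d}" "q' \<noteq> 0" "g = of_poly p' / of_poly q'" "ev q' \<noteq> 0" "\<Phi> g = ev p' / ev q'"
      using Frep[OF fg(2)] by blast
    have nz: "of_poly q \<noteq> 0" "of_poly q' \<noteq> 0" "q * q' \<noteq> 0" using pq pq' by (simp_all add: of_poly_eq_0_iff)
    have "f + g = of_poly (p * q' + p' * q) / of_poly (q * q')" unfolding pq(4) pq'(4) using nz by (simp add: op field_simps)
    moreover have "f * g = of_poly (p * p') / of_poly (q * q')" unfolding pq(4) pq'(4) by (simp add: op)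
    moreover have "\<Phi> (of_poly (p * q' + p' * q) / of_poly (q * q')) = ev (p * q' + p' * q) / ev (q * q')"
      by (rule \<Phi>[OF P(3)[OF P(4)[OF pq(1) pq'(2)] P(4)[OF pq'(1) pq(2)]] P(4)[OF pq(2) pq'(2)] nz(3)])
    moreover have "\<Phi> (of_poly (p * p') / of_poly (q * q')) = ev (p * p') / ev (q * q')"
      by (rule \<Phi>[OF P(4)[OF pq(1) pq'(1)] P(4)[OF pq(2) pq'(2)] nz(3)])
    ultimately show ?thesis unfolding pq(6) pq'(6) using pq(5) pq'(5) by (simp add: ev field_simps)
  qed
  have const: "\<Phi> (rconst c) = c" if "c \<in> ?F" for c
    using \<Phi>[OF mconst_in_polys[OF that] P(1)] by (simp add: op of_poly_mconst ev) (simp add: ev_def eval_mpoly_mconst[OF ring_map_id])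
  have inI: "\<Phi> f \<in> ?I" if f: "f \<in> ratfuns ?F d" for f
  proof -
    have evI: "ev p \<in> ?I" if p: "p \<in> polys ?F {..<d}" for p
    proof -
      have LD: "x \<in> D.L" if "x \<in> L" for x
      proof -
        obtain p q where pq: "p \<in> polys UNIV {..<m}" "q \<in> polys UNIV {..<m}" "q \<noteq> 0" "x = of_poly p / of_poly q"
          using \<open>x \<in> L\<close> unfolding ratfuns_iff by blast
        have "{..<m} \<subseteq> {..<m + d}" by auto
        then have "p \<in> polys UNIV {..<m + d}" "q \<in> polys UNIV {..<m + d}"
          using polys_mono[OF pq(1) order.refl] polys_mono[OF pq(2) order.refl] by blast+
        then show ?thesis using pq(3,4) unfolding ratfuns_iff by blast
      qed
      have "t j \<in> D.L" if "j < d" for j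
        unfolding t_def using T(4)[OF that] LD
        by (intro subring_set_sum[OF D.L_subring] D.L_closed(4) rvar_in_ratfuns[OF subring_set_UNIV]) auto
      then have "ev p \<in> D.L" unfolding ev_def using LD FL by (intro eval_mpoly_in_subring[OF D.L_subring p]) auto
      moreover have "\<gamma> (ev p) = ev p" if g: "\<gamma> \<in> \<Gamma>" for \<gamma>
        unfolding ev_def ring_map_eval[OF \<Gamma>(1)[OF g]]
        by (rule eval_mpoly_cong[OF p]) (use F_iff g \<Gamma>(3)[OF g] in auto)
      ultimately show ?thesis unfolding I_iff by blast
    qed
    obtain p q where "p \<in> polys ?F {..<d}" "q \<in> polys ?F {..<d}" "\<Phi> f = ev p / ev q" using Frep[OF f] by blast
    then show ?thesis using subfield_setD(3)[OF D.subfield_invariant_field] evI by simp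
  qed
  have surj: "\<exists>f\<in>ratfuns ?F d. \<Phi> f = g" if g: "g \<in> ?I" for g
  proof -
    let ?R = "ev ` polys L {..<d}"
    have R: "subring_set ?R" unfolding ev_def by (rule subring_set_evaluations[OF ring_map_id L_subring])
    have LR: "x \<in> ?R" if "x \<in> L" for x
      by (rule image_eqI[OF _ mconst_in_polys[OF that]]) (simp add: ev_def eval_mpoly_mconst[OF ring_map_id])
    have tR: "t j \<in> ?R" if "j < d" for j
      by (rule image_eqI[OF _ mvar_in_polys[OF L_closed(1)]]) (use that in \<open>simp_all add: ev_def eval_mpoly_mvar[OF ring_map_id]\<close>)
    have varR: "rvar i \<in> ?R" if "i < m + d" for i
    proof (cases "i < m")
      case True
      then show ?thesis using LR rvar_in_ratfuns[OF subring_set_UNIV] by blast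
    next
      case False
      then have i: "i = m + (i - m)" "i - m < d" using that by auto
      have "(\<Sum>j<d. U $$ (i - m, j) * t j) \<in> ?R"
        using U(3)[OF i(2)] LR tR by (intro subring_set_sum[OF R] subring_setD(4)[OF R]) auto
      then show ?thesis using yt[OF i(2)] i(1) by simp
    qed
    have opR: "of_poly N \<in> ?R" if "N \<in> polys UNIV {..<m + d}" for N
      unfolding of_poly_eval
      by (rule eval_mpoly_in_subring[OF R that]) (use LR rconst_in_ratfuns[OF subring_set_UNIV UNIV_I] varR in auto)
    have "g \<in> D.L" using g I_iff by blast
    then obtain N M where NM: "N \<in> polys UNIV {..<m + d}" "M \<in> polys UNIV {..<m + d}" "M \<noteq> 0" "g = of_poly N / of_poly M"
      unfolding ratfuns_iff by blast
    obtain p0 q0 where pq0: "p0 \<in> polys L {..<d}" "q0 \<in> polys L {..<d}" "of_poly N = ev p0" "of_poly M = ev q0"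
      using opR[OF NM(1)] opR[OF NM(2)] by blast
    have M0: "of_poly M \<noteq> 0" using NM(3) by (simp add: of_poly_eq_0_iff)
    have q00: "q0 \<noteq> 0"
    proof
      assume "q0 = 0"
      then show False using pq0(4) M0 ev(2) by simp
    qed
    have g0: "ev p0 = g * ev q0" unfolding NM(4) pq0(3,4)[symmetric] using M0 by simp
    \<comment> \<open>A pair of polynomials as one vector: the Boolean selects the polynomial, the second index the coefficient.\<close>
    let ?vec = "\<lambda>p q (b, s). if b then Poly_Mapping.lookup p s else Poly_Mapping.lookup q s"
    define V where "V = {?vec p q | p q. p \<in> polys L {..<d} \<and> q \<in> polys L {..<d} \<and> ev p = g * ev q}"
    define Z where "Z = {y \<in> V. \<forall>s. y (False, s) = 0}"
    have VI: "y \<in> V" if "p \<in> polys L {..<d}" "q \<in> polys L {..<d}" "ev p = g * ev q"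
      "\<And>s. y (True, s) = Poly_Mapping.lookup p s" "\<And>s. y (False, s) = Poly_Mapping.lookup q s" for y p q
    proof -
      have "y = ?vec p q" using that(4,5) by (auto simp: fun_eq_iff)
      then show ?thesis unfolding V_def using that(1-3) by blast
    qed
    have VD: "\<exists>p q. p \<in> polys L {..<d} \<and> q \<in> polys L {..<d} \<and> ev p = g * ev q \<and>
        (\<forall>s. y (True, s) = Poly_Mapping.lookup p s) \<and> (\<forall>s. y (False, s) = Poly_Mapping.lookup q s)" if "y \<in> V" for y
    proof -
      obtain p q where "y = ?vec p q" "p \<in> polys L {..<d}" "q \<in> polys L {..<d}" "ev p = g * ev q"
        using \<open>y \<in> V\<close> unfolding V_def by blast
      then show ?thesis by (intro exI[of _ p] exI[of _ q]) simp
    qed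
    note PL = subring_setD[OF subring_set_polys[OF L_subring, of "{..<d}"]]
    have Vadd: "(\<lambda>i. v i + w i) \<in> V" if vw: "v \<in> V" "w \<in> V" for v w
    proof -
      obtain p q where 1: "p \<in> polys L {..<d}" "q \<in> polys L {..<d}" "ev p = g * ev q"
        "\<forall>s. v (True, s) = Poly_Mapping.lookup p s" "\<forall>s. v (False, s) = Poly_Mapping.lookup q s" using VD[OF vw(1)] by blast
      obtain p' q' where 2: "p' \<in> polys L {..<d}" "q' \<in> polys L {..<d}" "ev p' = g * ev q'"
        "\<forall>s. w (True, s) = Poly_Mapping.lookup p' s" "\<forall>s. w (False, s) = Poly_Mapping.lookup q' s" using VD[OF vw(2)] by blast
      show ?thesis
        by (rule VI[OF PL(3)[OF 1(1) 2(1)] PL(3)[OF 1(2) 2(2)]]) (use 1 2 in \<open>simp_all add: ev distrib_left lookup_add\<close>)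
    qed
    have lookup_scale: "Poly_Mapping.lookup (mconst a * p) s = a * Poly_Mapping.lookup p s" for a :: "'a alg_closure ratfun" and p :: "(nat, 'a alg_closure ratfun) mpoly" and s
    proof -
      have "mconst a * p = Poly_Mapping.map ((*) a) p" by (simp add: mult_map_scale_conv_mult mconst_def)
      then show ?thesis by (simp add: Poly_Mapping.map.rep_eq when_def)
    qed
    have Vscale: "(\<lambda>i. a * v i) \<in> V" if a: "a \<in> L" and v: "v \<in> V" for a v
    proof -
      obtain p q where 1: "p \<in> polys L {..<d}" "q \<in> polys L {..<d}" "ev p = g * ev q"
        "\<forall>s. v (True, s) = Poly_Mapping.lookup p s" "\<forall>s. v (False, s) = Poly_Mapping.lookup q s" using VD[OF v] by blast
      show ?thesis
        by (rule VI[OF PL(4)[OF mconst_in_polys[OF a] 1(1)] PL(4)[OF mconst_in_polys[OF a] 1(2)]])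
           (use 1 in \<open>simp_all add: ev lookup_scale mult.left_commute\<close>)
    qed
    have Vstable: "(\<lambda>i. \<gamma> (v i)) \<in> V" if \<gamma>: "\<gamma> \<in> \<Gamma>" and v: "v \<in> V" for \<gamma> v
    proof -
      note r = ring_mapD[OF \<Gamma>(1)[OF \<gamma>]]
      obtain p q where 1: "p \<in> polys L {..<d}" "q \<in> polys L {..<d}" "ev p = g * ev q"
        "\<forall>s. v (True, s) = Poly_Mapping.lookup p s" "\<forall>s. v (False, s) = Poly_Mapping.lookup q s" using VD[OF v] by blast
      have m: "ev (Poly_Mapping.map \<gamma> p) = \<gamma> (ev p)" if "p \<in> polys L {..<d}" for p
        unfolding ev_def eval_mpoly_map[OF ring_map_id \<Gamma>(1)[OF \<gamma>]] ring_map_eval[OF \<Gamma>(1)[OF \<gamma>]]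
        by (rule eval_mpoly_cong[OF that]) (simp_all add: \<Gamma>(3)[OF \<gamma>])
      have gg: "\<gamma> g = g" using g I_iff \<gamma> by blast
      have lk: "Poly_Mapping.lookup (Poly_Mapping.map \<gamma> p) s = \<gamma> (Poly_Mapping.lookup p s)" for p :: "(nat, 'a alg_closure ratfun) mpoly" and s
        using r(2) by (simp add: Poly_Mapping.map.rep_eq when_def)
      have mp: "Poly_Mapping.map \<gamma> p \<in> polys L {..<d}" if "p \<in> polys L {..<d}" for p
        by (rule map_in_polys[OF that]) (rule \<Gamma>(2)[OF \<gamma>], assumption, rule r(2))
      show ?thesis
        by (rule VI[OF mp[OF 1(1)] mp[OF 1(2)]])
           (use 1 gg in \<open>simp_all add: m lk r(4)\<close>)
    qed
    have fin: "finite {i. v i \<noteq> 0}" and VL: "v i \<in> L" if v: "v \<in> V" for v i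
    proof -
      obtain p q where 1: "p \<in> polys L {..<d}" "q \<in> polys L {..<d}"
        "\<forall>s. v (True, s) = Poly_Mapping.lookup p s" "\<forall>s. v (False, s) = Poly_Mapping.lookup q s" using VD[OF v] by blast
      have "{i. v i \<noteq> 0} \<subseteq> Pair True ` Poly_Mapping.keys p \<union> Pair False ` Poly_Mapping.keys q"
      proof
        fix i assume "i \<in> {i. v i \<noteq> 0}"
        then show "i \<in> Pair True ` Poly_Mapping.keys p \<union> Pair False ` Poly_Mapping.keys q"
          using 1(3,4) by (cases i; cases "fst i") (auto simp: in_keys_iff)
      qed
      then show "finite {i. v i \<noteq> 0}" by (rule finite_subset) simp
      show "v i \<in> L" using 1(3,4) polysD(3)[OF 1(1) L_closed(2)] polysD(3)[OF 1(2) L_closed(2)]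
        by (cases i; cases "fst i") auto
    qed
    define invariant where "invariant y \<longleftrightarrow> (\<forall>\<gamma>\<in>\<Gamma>. \<forall>i. \<gamma> (y i) = y i)" for y :: "bool \<times> (nat \<Rightarrow>\<^sub>0 nat) \<Rightarrow> 'a alg_closure ratfun"
    have "\<exists>y\<in>V. invariant y \<and> y \<notin> Z"
    proof (rule ccontr)
      assume no: "\<not> ?thesis"
      have y0: "?vec p0 q0 \<in> V" by (rule VI[OF pq0(1,2) g0]) simp_all
      have Z0: "(\<lambda>i. 0) \<in> Z"
      proof -
        have "(\<lambda>i. 0) \<in> V" by (rule VI[OF PL(2) PL(2)]) (simp_all add: ev)
        then show ?thesis by (simp add: Z_def)
      qed
      have "?vec p0 q0 \<in> Z"
      proof (rule descent_to_fixed_vectors[where K = L and V = V and \<Gamma> = \<Gamma>])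
        show "subfield_set L" by (rule L_subfield)
        show "ring_map \<gamma>" if "\<gamma> \<in> \<Gamma>" for \<gamma> by (rule \<Gamma>(1)[OF that])
        show "finite {i. v i \<noteq> 0}" "v i \<in> L" if "v \<in> V" for v i using fin[OF that] VL[OF that] .
        show "(\<lambda>i. v i + w i) \<in> V" if "v \<in> V" "w \<in> V" for v w by (rule Vadd[OF that])
        show "(\<lambda>i. a * v i) \<in> V" if "a \<in> L" "v \<in> V" for a v by (rule Vscale[OF that])
        show "(\<lambda>i. \<gamma> (v i)) \<in> V" if "\<gamma> \<in> \<Gamma>" "v \<in> V" for \<gamma> v by (rule Vstable[OF that])
        show "(\<lambda>i. 0) \<in> Z" by (rule Z0)
        show "(\<lambda>i. v i + w i) \<in> Z" if "v \<in> Z" "w \<in> Z" for v w using that Vadd by (simp add: Z_def)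
        show "(\<lambda>i. a * v i) \<in> Z" if "a \<in> L" "v \<in> Z" for a v using that Vscale by (simp add: Z_def)
        show "v \<in> Z" if v: "v \<in> V" "\<And>\<gamma> i. \<gamma> \<in> \<Gamma> \<Longrightarrow> \<gamma> (v i) = v i" for v
        proof (rule ccontr)
          assume "v \<notin> Z"
          moreover have "invariant v" unfolding invariant_def using v(2) by blast
          ultimately show False using no v(1) by blast
        qed
        show "?vec p0 q0 \<in> V" by (rule y0)
      qed
      then have l0: "Poly_Mapping.lookup q0 s = 0" for s by (simp add: Z_def)
      have "q0 = 0" by (rule poly_mapping_eqI) (simp add: l0)
      then show False using q00 by blast
    qed
    then obtain y where yV: "y \<in> V" and yinv: "invariant y" and yZ: "y \<notin> Z" by blast
    have yfix: "\<gamma> (y i) = y i" if "\<gamma> \<in> \<Gamma>" for \<gamma> i using yinv that unfolding invariant_def by blast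
    note y = yV yfix yZ
    obtain p q where pq: "p \<in> polys L {..<d}" "q \<in> polys L {..<d}" "ev p = g * ev q"
      "\<forall>s. y (True, s) = Poly_Mapping.lookup p s" "\<forall>s. y (False, s) = Poly_Mapping.lookup q s" using VD[OF y(1)] by blast
    have "Poly_Mapping.lookup p s \<in> ?F" "Poly_Mapping.lookup q s \<in> ?F" for s
      unfolding F_iff using polysD(3)[OF pq(1) L_closed(2)] polysD(3)[OF pq(2) L_closed(2)] y(2) pq(4,5) by metis+
    then have pqF: "p \<in> polys ?F {..<d}" "q \<in> polys ?F {..<d}"
      by (auto intro!: polysI dest: polysD(2)[OF pq(1)] polysD(2)[OF pq(2)])
    have "q \<noteq> 0"
    proof
      assume "q = 0"
      then have "y \<in> Z" unfolding Z_def using y(1) pq(5) by simp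
      then show False using y(3) by blast
    qed
    then have "ev q \<noteq> 0" using ev0[OF pq(2)] by blast
    then have "\<Phi> (of_poly p / of_poly q) = g" using \<Phi>[OF pqF \<open>q \<noteq> 0\<close>] pq(3) by simp
    moreover have "of_poly p / of_poly q \<in> ratfuns ?F d" unfolding ratfuns_iff using pqF \<open>q \<noteq> 0\<close> by blast
    ultimately show ?thesis by blast
  qed
  have inj: "inj_on \<Phi> (ratfuns ?F d)"
  proof (rule inj_onI)
    fix f g assume f: "f \<in> ratfuns ?F d" and g: "g \<in> ratfuns ?F d" and eq: "\<Phi> f = \<Phi> g"
    obtain p q where pq: "p \<in> polys ?F {..<d}" "q \<in> polys ?F {..<d}" "q \<noteq> 0" "f = of_poly p / of_poly q" "ev q \<noteq> 0" "\<Phi> f = ev p / ev q"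
      using Frep[OF f] by blast
    obtain p' q' where pq': "p' \<in> polys ?F {..<d}" "q' \<in> polys ?F {..<d}" "q' \<noteq> 0" "g = of_poly p' / of_poly q'" "ev q' \<noteq> 0" "\<Phi> g = ev p' / ev q'"
      using Frep[OF g] by blast
    have "ev p * ev q' = ev p' * ev q" using eq pq(5,6) pq'(5,6) by (simp add: frac_eq_eq)
    then have "ev (p * q' - p' * q) = 0" by (simp add: ev)
    moreover have "p * q' - p' * q \<in> polys L {..<d}"
      by (rule polysFL[OF P(6)[OF P(4)[OF pq(1) pq'(2)] P(4)[OF pq'(1) pq(2)]]])
    ultimately have "p * q' - p' * q = 0" by (intro ev0)
    then have "p * q' = p' * q" by simp
    then have "of_poly (p * q') = of_poly (p' * q)" by (rule arg_cong)
    then have "of_poly p * of_poly q' = of_poly p' * of_poly q" by (simp only: op(4))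
    then show "f = g" unfolding pq(4) pq'(4) using pq(3) pq'(3) by (simp add: frac_eq_eq of_poly_eq_0_iff)
  qed
  have "\<Phi> \<in> ring_iso (field_on (ratfuns ?F d)) (field_on ?I)"
    unfolding ring_iso_field_on_iff
  proof (intro conjI ballI)
    show "bij_betw \<Phi> (ratfuns ?F d) ?I" unfolding bij_betw_def using inj inI surj by blast
    show "\<Phi> 1 = 1" using const[OF subring_setD(1)[OF Fring]] by (simp add: ring_mapD(1)[OF ring_map_rconst])
    fix a b assume "a \<in> ratfuns ?F d" "b \<in> ratfuns ?F d"
    then show "\<Phi> (a + b) = \<Phi> a + \<Phi> b" "\<Phi> (a * b) = \<Phi> a * \<Phi> b" using hom by blast+
  qed
  moreover have "\<Phi> (rconst (base_embedding c)) = base_embedding c" for c by (rule const[OF base_embedding_invariant])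
  ultimately show ?thesis by blast
qed

section \<open>Exchanging the summands\<close>

definition swap_blocks :: "nat \<Rightarrow> nat \<Rightarrow> nat \<Rightarrow> nat"
  where "swap_blocks m d i = (if i < m then i + d else if i < m + d then i - m else i)"

lemma swap_blocks_swap_blocks: "swap_blocks d m (swap_blocks m d i) = i"
  by (auto simp: swap_blocks_def)

lemma swap_blocks_image: "swap_blocks m d ` {..<m + d} = {..<d + m}"
proof
  show "swap_blocks m d ` {..<m + d} \<subseteq> {..<d + m}" by (auto simp: swap_blocks_def)
  show "{..<d + m} \<subseteq> swap_blocks m d ` {..<m + d}"
  proof
    fix i assume "i \<in> {..<d + m}"
    then have "swap_blocks d m i \<in> {..<m + d}" by (auto simp: swap_blocks_def)
    moreover have "i = swap_blocks m d (swap_blocks d m i)" by (simp add: swap_blocks_swap_blocks)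
    ultimately show "i \<in> swap_blocks m d ` {..<m + d}" by blast
  qed
qed

lemma inj_swap_blocks: "inj (swap_blocks m d)"
  by (metis injI swap_blocks_swap_blocks)

definition rename_vars :: "(nat \<Rightarrow> nat) \<Rightarrow> 'c::field ratfun \<Rightarrow> 'c ratfun"
  where "rename_vars s = fract_map (eval_mpoly mconst (\<lambda>i. mvar (s i)))"

lemma rename_vars_props:
  fixes s :: "nat \<Rightarrow> nat" and c :: "'c::field" and f :: "'c ratfun"
  assumes s': "\<And>i. s' (s i) = i"
  shows "ring_map (rename_vars s :: 'c ratfun \<Rightarrow> _)" "rename_vars s (rconst c) = rconst c"
    "rename_vars s (rvar i) = (rvar (s i) :: 'c ratfun)"
    "s ` {..<r} \<subseteq> {..<r'} \<Longrightarrow> f \<in> ratfuns UNIV r \<Longrightarrow> rename_vars s f \<in> ratfuns UNIV r'"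
proof -
  let ?m = "eval_mpoly mconst (\<lambda>i. mvar (s i)) :: (nat, 'c) mpoly \<Rightarrow> _"
  have rm: "ring_map ?m" by (rule ring_map_eval_mpoly[OF ring_map_mconst])
  have inj: "p = 0" if "?m p = 0" for p
  proof -
    have "p = eval_mpoly mconst (\<lambda>i. mvar (s' i)) (?m p)"
      by (simp add: eval_mpoly_subst[OF ring_map_mconst] eval_mpoly_mvar[OF ring_map_mconst] s' eval_mpoly_mvar_id)
    then show ?thesis using that by (simp add: eval_mpoly_0[OF ring_map_mconst])
  qed
  have Fr: "rename_vars s (Fract p q) = Fract (?m p) (?m q)" if "q \<noteq> 0" for p q
    unfolding rename_vars_def by (rule fract_map_Fract[OF rm _ that]) (rule inj)
  have op: "rename_vars s (of_poly p) = of_poly (?m p)" for p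
    using Fr[of 1 p] by (simp add: of_poly_def ring_mapD[OF rm])
  show R: "ring_map (rename_vars s :: 'c ratfun \<Rightarrow> _)" unfolding rename_vars_def by (rule ring_map_fract_map[OF rm]) (rule inj)
  show "rename_vars s (rconst c) = rconst c"
    unfolding of_poly_mconst[symmetric] op by (simp add: eval_mpoly_mconst[OF ring_map_mconst])
  show "rename_vars s (rvar i) = (rvar (s i) :: 'c ratfun)" unfolding rvar_def op by (simp add: eval_mpoly_mvar[OF ring_map_mconst])
  assume sub: "s ` {..<r} \<subseteq> {..<r'}" and f: "f \<in> ratfuns UNIV r"
  have mp: "?m p \<in> polys UNIV {..<r'}" if "p \<in> polys UNIV {..<r}" for p
    using subring_set_polys[OF subring_set_UNIV] that
    by (rule eval_mpoly_in_subring) (use sub in \<open>auto intro!: mconst_in_polys mvar_in_polys\<close>)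
  obtain p q where pq: "p \<in> polys UNIV {..<r}" "q \<in> polys UNIV {..<r}" "q \<noteq> 0" "f = of_poly p / of_poly q"
    using f unfolding ratfuns_iff by blast
  have "?m q \<noteq> 0" using inj pq(3) by blast
  moreover have "rename_vars s f = of_poly (?m p) / of_poly (?m q)" unfolding pq(4) ring_map_divide[OF R] op ..
  ultimately show "rename_vars s f \<in> ratfuns UNIV r'" unfolding ratfuns_iff using mp[OF pq(1)] mp[OF pq(2)] by blast
qed

lemma swap_summands_invariant:
  assumes \<rho>: "representation n m G \<rho>" and \<sigma>: "representation n d G \<sigma>"
    and f: "f \<in> invariant_field G (m + d) (\<lambda>A. block_sum (\<rho> A) (\<sigma> A))"
  shows "rename_vars (swap_blocks m d) f \<in> invariant_field G (d + m) (\<lambda>A. block_sum (\<sigma> A) (\<rho> A))"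
proof -
  interpret R: representation n m G \<rho> by (rule \<rho>)
  interpret S: representation n d G \<sigma> by (rule \<sigma>)
  interpret D: representation n "m + d" G "\<lambda>A. block_sum (\<rho> A) (\<sigma> A)" by (rule R.representation_block_sum[OF \<sigma>])
  interpret E: representation n "d + m" G "\<lambda>A. block_sum (\<sigma> A) (\<rho> A)" by (rule S.representation_block_sum[OF \<rho>])
  let ?s = "swap_blocks m d"
  note p = rename_vars_props[of "swap_blocks d m" ?s, OF swap_blocks_swap_blocks]
  note pr = ring_mapD[OF p(1)]
  have act: "E.act A (rename_vars ?s f) = rename_vars ?s (D.act A f)" if A: "A \<in> G" for A f
  proof (rule ratfun_ring_map_eqI[of "\<lambda>f. E.act A (rename_vars ?s f)" "\<lambda>f. rename_vars ?s (D.act A f)"])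
    note a = D.act_props[OF A A] and b = E.act_props[OF A A]
    show "ring_map (\<lambda>f. E.act A (rename_vars ?s f))" by (rule ring_map_compose[OF b(1) p(1)])
    show "ring_map (\<lambda>f. rename_vars ?s (D.act A f))" by (rule ring_map_compose[OF p(1) a(1)])
    show "E.act A (rename_vars ?s (rconst c)) = rename_vars ?s (D.act A (rconst c))" for c by (simp add: a b p)
    fix i
    show "E.act A (rename_vars ?s (rvar i)) = rename_vars ?s (D.act A (rvar i))"
    proof (cases "i < m + d")
      case True
      then have si: "?s i < d + m" using swap_blocks_image[of m d] by blast
      have ent: "block_sum (\<sigma> A) (\<rho> A) $$ (?s i, ?s j) = block_sum (\<rho> A) (\<sigma> A) $$ (i, j)" if "j < m + d" for j
      proof -
        have sj: "?s j < d + m" using that swap_blocks_image[of m d] by blast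
        show ?thesis
          unfolding block_sum_index[OF R.rho_carrier[OF A] S.rho_carrier[OF A] True that]
            block_sum_index[OF S.rho_carrier[OF A] R.rho_carrier[OF A] si sj]
          using True that by (auto simp: swap_blocks_def)
      qed
      have "E.act A (rename_vars ?s (rvar i)) = (\<Sum>j\<in>?s ` {..<m + d}. rconst (block_sum (\<sigma> A) (\<rho> A) $$ (?s i, j)) * rvar j)"
        unfolding p(3) b(3) swap_blocks_image using si by simp
      also have "\<dots> = (\<Sum>j<m + d. rconst (block_sum (\<sigma> A) (\<rho> A) $$ (?s i, ?s j)) * rvar (?s j))"
        by (subst sum.reindex) (auto intro: inj_on_subset[OF inj_swap_blocks])
      also have "\<dots> = (\<Sum>j<m + d. rconst (block_sum (\<rho> A) (\<sigma> A) $$ (i, j)) * rvar (?s j))"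
        by (intro sum.cong) (simp_all add: ent)
      also have "\<dots> = rename_vars ?s (D.act A (rvar i))" using True by (simp add: a(3) pr p)
      finally show ?thesis .
    next
      case False
      then have "?s i = i" "\<not> i < d + m" by (auto simp: swap_blocks_def)
      then show ?thesis using False by (simp add: a(3) b(3) p(3))
    qed
  qed
  have gal: "galois_map \<tau> (rename_vars ?s f) = rename_vars ?s (galois_map \<tau> f)" if \<tau>: "\<tau> \<in> galois_group" for \<tau> and f :: "'a alg_closure ratfun"
  proof (rule ratfun_ring_map_eqI[of "\<lambda>f. galois_map \<tau> (rename_vars ?s f)" "\<lambda>f. rename_vars ?s (galois_map \<tau> f)"])
    note g = galois_map_props[OF \<tau>]
    show "ring_map (\<lambda>f. galois_map \<tau> (rename_vars ?s f))" by (rule ring_map_compose[OF g(1) p(1)])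
    show "ring_map (\<lambda>f. rename_vars ?s (galois_map \<tau> f))" by (rule ring_map_compose[OF p(1) g(1)])
  qed (simp_all add: galois_map_props[OF \<tau>] p)
  have sub: "?s ` {..<m + d} \<subseteq> {..<d + m}" by (simp only: swap_blocks_image order.refl)
  have "rename_vars ?s f \<in> E.L" using p(4)[OF sub] f unfolding D.invariant_field_iff by blast
  moreover have "E.act A (rename_vars ?s f) = rename_vars ?s f" if "A \<in> G" for A
    using act[OF that] f that unfolding D.invariant_field_iff by simp
  moreover have "galois_map \<tau> (rename_vars ?s f) = rename_vars ?s f" if "\<tau> \<in> galois_group" for \<tau>
    using gal[OF that] f that unfolding D.invariant_field_iff by simp
  ultimately show ?thesis unfolding E.invariant_field_iff by blast
qed

lemma swap_summands_iso:
  assumes \<rho>: "representation n m G \<rho>" and \<sigma>: "representation n d G \<sigma>"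
  shows "rename_vars (swap_blocks m d) \<in> ring_iso
    (field_on (invariant_field G (m + d) (\<lambda>A. block_sum (\<rho> A) (\<sigma> A))))
    (field_on (invariant_field G (d + m) (\<lambda>A. block_sum (\<sigma> A) (\<rho> A))))"
proof -
  note p = rename_vars_props[of "swap_blocks d m" "swap_blocks m d", OF swap_blocks_swap_blocks]
  have inv: "rename_vars (swap_blocks d m) (rename_vars (swap_blocks m d) f) = f" for d m and f :: "'a alg_closure ratfun"
  proof (rule ratfun_ring_map_eqI[of "\<lambda>f. rename_vars (swap_blocks d m) (rename_vars (swap_blocks m d) f)" "\<lambda>f. f"])
    note q = rename_vars_props[of "swap_blocks d m" "swap_blocks m d", OF swap_blocks_swap_blocks]
    note q' = rename_vars_props[of "swap_blocks m d" "swap_blocks d m", OF swap_blocks_swap_blocks]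
    show "ring_map (\<lambda>f :: 'a alg_closure ratfun. rename_vars (swap_blocks d m) (rename_vars (swap_blocks m d) f))"
      by (rule ring_map_compose[OF q'(1) q(1)])
    show "ring_map (\<lambda>f :: 'a alg_closure ratfun. f)" by (rule ring_map_id)
    show "rename_vars (swap_blocks d m) (rename_vars (swap_blocks m d) (rconst c)) = rconst c" for c :: "'a alg_closure" by (simp add: q q')
    show "rename_vars (swap_blocks d m) (rename_vars (swap_blocks m d) (rvar i)) = (rvar i :: 'a alg_closure ratfun)" for i
      by (simp add: q q' swap_blocks_swap_blocks)
  qed
  show ?thesis
    unfolding ring_iso_field_on_iff
  proof (intro conjI ballI)
    show "bij_betw (rename_vars (swap_blocks m d)) (invariant_field G (m + d) (\<lambda>A. block_sum (\<rho> A) (\<sigma> A)))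
      (invariant_field G (d + m) (\<lambda>A. block_sum (\<sigma> A) (\<rho> A)))"
      by (rule bij_betwI[where g = "rename_vars (swap_blocks d m)"])
         (use swap_summands_invariant[OF \<rho> \<sigma>] swap_summands_invariant[OF \<sigma> \<rho>] inv in auto)
  qed (simp_all add: ring_mapD[OF p(1)])
qed

section \<open>Purely transcendental extensions\<close>

lemma generate_field_subfield: "subfield_set (generate_field ring_of_type_algebra (H :: 'f::field set))"
proof -
  have fld: "Ring.field (ring_of_type_algebra :: 'f ring)" by (rule field_from_type_algebra)
  interpret R: Ring.field "ring_of_type_algebra :: 'f ring" by (rule fld)
  note rt = ring_of_type_algebra_def[where 'a = 'f]
  have simps: "\<one>\<^bsub>ring_of_type_algebra\<^esub> = (1 :: 'f)" "\<zero>\<^bsub>ring_of_type_algebra\<^esub> = (0 :: 'f)"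
    "a \<oplus>\<^bsub>ring_of_type_algebra\<^esub> b = a + b" "a \<otimes>\<^bsub>ring_of_type_algebra\<^esub> b = a * b" "a \<in> carrier ring_of_type_algebra" for a b :: 'f
    by (simp_all add: rt)
  have neg: "\<ominus>\<^bsub>ring_of_type_algebra\<^esub> a = - a" for a :: 'f
    using R.minus_equality[of "- a" a] by (simp add: simps)
  have inv: "inv\<^bsub>ring_of_type_algebra\<^esub> a = inverse a" if "a \<noteq> 0" for a :: 'f
    using R.comm_inv_char[of a "inverse a"] that by (simp add: simps)
  let ?S = "generate_field ring_of_type_algebra H"
  have one: "1 \<in> ?S" using generate_field.one[of ring_of_type_algebra H] by (simp add: simps)
  have ng: "- a \<in> ?S" if "a \<in> ?S" for a using generate_field.a_inv[OF that] by (simp add: neg)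
  have ad: "a + b \<in> ?S" if "a \<in> ?S" "b \<in> ?S" for a b using generate_field.eng_add[OF that] by (simp add: simps)
  have mu: "a * b \<in> ?S" if "a \<in> ?S" "b \<in> ?S" for a b using generate_field.eng_mult[OF that] by (simp add: simps)
  have iv: "inverse a \<in> ?S" if "a \<in> ?S" for a
  proof (cases "a = 0")
    case True
    have "0 \<in> ?S" using ad[OF one ng[OF one]] by simp
    then show ?thesis using True by simp
  next
    case False
    then show ?thesis using generate_field.m_inv[OF that] inv[OF False] by (simp add: simps)
  qed
  show ?thesis unfolding subfield_set_def subring_set_def by (intro conjI ballI one ng ad mu iv; assumption)
qed

lemma generate_field_least:
  assumes K: "subfield_set (K :: 'f::field set)" and "H \<subseteq> K"
  shows "generate_field ring_of_type_algebra H \<subseteq> K"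
proof
  have fld: "Ring.field (ring_of_type_algebra :: 'f ring)" by (rule field_from_type_algebra)
  interpret R: Ring.field "ring_of_type_algebra :: 'f ring" by (rule fld)
  note rt = ring_of_type_algebra_def[where 'a = 'f]
  have simps: "\<one>\<^bsub>ring_of_type_algebra\<^esub> = (1 :: 'f)" "\<zero>\<^bsub>ring_of_type_algebra\<^esub> = (0 :: 'f)"
    "a \<oplus>\<^bsub>ring_of_type_algebra\<^esub> b = a + b" "a \<otimes>\<^bsub>ring_of_type_algebra\<^esub> b = a * b" "a \<in> carrier ring_of_type_algebra" for a b :: 'f
    by (simp_all add: rt)
  have neg: "\<ominus>\<^bsub>ring_of_type_algebra\<^esub> a = - a" for a :: 'f
    using R.minus_equality[of "- a" a] by (simp add: simps)
  have inv: "inv\<^bsub>ring_of_type_algebra\<^esub> a = inverse a" if "a \<noteq> 0" for a :: 'f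
    using R.comm_inv_char[of a "inverse a"] that by (simp add: simps)
  note k = subring_setD[OF subfield_setD(1)[OF K]]
  fix x assume "x \<in> generate_field ring_of_type_algebra H"
  then show "x \<in> K"
  proof (induction rule: generate_field.induct)
    case one
    then show ?case using k(1) by (simp add: simps)
  next
    case (incl h)
    then show ?case using assms(2) by blast
  next
    case (a_inv h)
    then show ?case using k(5) by (simp add: neg)
  next
    case (m_inv h)
    then have "h \<noteq> 0" by (simp add: simps)
    then show ?case using subfield_setD(2)[OF K m_inv.IH] by (simp add: inv)
  next
    case (eng_add h1 h2)
    then show ?case using k(3) by (simp add: simps)
  next
    case (eng_mult h1 h2)
    then show ?case using k(4) by (simp add: simps)
  qed
qed

lemma generate_field_generators: "H \<subseteq> generate_field R H"
  by (auto intro: generate_field.incl)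

text \<open>An isomorphism over the base field carries independent generators to independent generators. A relation among
  the images is pulled back by a section \<open>\<psi>\<close> of the map between the generators.\<close>
lemma pure_transport:
  fixes \<iota> :: "'k::field \<Rightarrow> 'f::field" and \<kappa> :: "'k \<Rightarrow> 'g::field"
  assumes \<iota>: "ring_map \<iota>" and \<kappa>: "ring_map \<kappa>" and pure: "pure \<iota> K" and K': "subfield_set K'"
    and \<Phi>: "\<Phi> \<in> ring_iso (field_on K) (field_on K')" and base: "\<And>c. \<Phi> (\<iota> c) = \<kappa> c"
  shows "pure \<kappa> K'"
proof -
  obtain S where S: "alg_independent \<iota> S" and Kgen: "K = generate_field ring_of_type_algebra (range \<iota> \<union> S)"
    using pure unfolding pure_def by blast
  have K: "subfield_set K" unfolding Kgen by (rule generate_field_subfield)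
  have gens: "range \<iota> \<subseteq> K" "S \<subseteq> K" unfolding Kgen using generate_field_generators[of "range \<iota> \<union> S"] by blast+
  have bij: "bij_betw \<Phi> K K'" and hom: "\<Phi> 1 = 1" "\<And>a b. a \<in> K \<Longrightarrow> b \<in> K \<Longrightarrow> \<Phi> (a + b) = \<Phi> a + \<Phi> b \<and> \<Phi> (a * b) = \<Phi> a * \<Phi> b"
    using \<Phi> unfolding ring_iso_field_on_iff by blast+
  note Kr = subfield_setD(1)[OF K]
  note k = subring_setD[OF Kr]
  have "\<Phi> 0 + 0 = \<Phi> 0 + \<Phi> 0" using conjunct1[OF hom(2)[OF k(2) k(2)]] by (simp only: add_0_left add_0_right)
  then have z: "\<Phi> 0 = 0" unfolding add_left_cancel by (rule sym)
  have sp: "specialisation K {0} \<Phi>" unfolding specialisation_def using hom z by blast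
  have inj: "a = b" if "a \<in> K" "b \<in> K" "\<Phi> a = \<Phi> b" for a b
    using bij that unfolding bij_betw_def inj_on_def by blast
  define \<psi> where "\<psi> = inv_into S \<Phi>"
  have \<psi>: "\<psi> y \<in> S" "\<Phi> (\<psi> y) = y" if "y \<in> \<Phi> ` S" for y
    unfolding \<psi>_def using inv_into_into[OF that] f_inv_into_f[OF that] .
  have "alg_independent \<kappa> (\<Phi> ` S)"
    unfolding alg_independent_def
  proof (intro ballI impI)
    fix p assume p: "p \<in> polys UNIV (\<Phi> ` S)" and e: "eval_mpoly \<kappa> (\<lambda>x. x) p = 0"
    define p' where "p' = (eval_mpoly mconst (\<lambda>x. mvar (\<psi> x)) p :: ('f, 'k) mpoly)"
    have p': "p' \<in> polys UNIV S"
      unfolding p'_def using subring_set_polys[OF subring_set_UNIV] p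
      by (rule eval_mpoly_in_subring) (use \<psi> in \<open>auto intro!: mconst_in_polys mvar_in_polys\<close>)
    have ep': "eval_mpoly \<iota> (\<lambda>x. x) p' = eval_mpoly \<iota> \<psi> p"
      unfolding p'_def by (simp add: eval_mpoly_subst[OF \<iota>] eval_mpoly_mvar[OF \<iota>])
    have inK: "eval_mpoly \<iota> \<psi> p \<in> K"
      by (rule eval_mpoly_in_subring[OF Kr p]) (use gens \<psi> in auto)
    have "\<Phi> (eval_mpoly \<iota> \<psi> p) = eval_mpoly (\<lambda>c. \<Phi> (\<iota> c)) (\<lambda>x. \<Phi> (\<psi> x)) p"
      by (rule specialisation_eval_mpoly[OF sp Kr p]) (use gens \<psi> in auto)
    also have "\<dots> = eval_mpoly \<kappa> (\<lambda>x. x) p" by (rule eval_mpoly_cong[OF p]) (simp_all add: base \<psi>)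
    finally have "eval_mpoly \<iota> \<psi> p = 0" using e z inj[OF inK k(2)] by simp
    then have "p' = 0" using S p' ep' unfolding alg_independent_def by simp
    then have "eval_mpoly mconst (\<lambda>s. mvar (\<Phi> s)) p' = (0 :: ('g, 'k) mpoly)" by (simp add: eval_mpoly_0[OF ring_map_mconst])
    moreover have "eval_mpoly mconst (\<lambda>s. mvar (\<Phi> s)) p' = eval_mpoly mconst (\<lambda>x. mvar (\<Phi> (\<psi> x)) :: ('g, 'k) mpoly) p"
      unfolding p'_def by (simp add: eval_mpoly_subst[OF ring_map_mconst] eval_mpoly_mvar[OF ring_map_mconst])
    moreover have "\<dots> = eval_mpoly mconst mvar p" by (rule eval_mpoly_cong[OF p]) (simp_all add: \<psi>)
    ultimately show "p = 0" by (simp add: eval_mpoly_mvar_id)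
  qed
  moreover have "K' = generate_field ring_of_type_algebra (range \<kappa> \<union> \<Phi> ` S)" (is "_ = ?L")
  proof
    have img: "\<Phi> ` K = K'" using bij by (rule bij_betw_imp_surj_on)
    have "range \<kappa> \<subseteq> K'" unfolding base[symmetric] img[symmetric] using gens(1) by fast
    moreover have "\<Phi> ` S \<subseteq> K'" unfolding img[symmetric] using gens(2) by (rule image_mono)
    ultimately have "range \<kappa> \<union> \<Phi> ` S \<subseteq> K'" by (rule Un_least)
    then show "?L \<subseteq> K'" by (rule generate_field_least[OF K'])
    have L: "subfield_set ?L" by (rule generate_field_subfield)
    note l = subring_setD[OF subfield_setD(1)[OF L]]
    let ?M = "{x \<in> K. \<Phi> x \<in> ?L}"
    have "\<Phi> (- a) = - \<Phi> a \<and> \<Phi> (inverse a) = inverse (\<Phi> a)" if a: "a \<in> K" for a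
    proof (cases "a = 0")
      case False
      have "\<Phi> a * \<Phi> (inverse a) = 1" using hom(2)[OF a subfield_setD(2)[OF K a]] hom(1) False by simp
      then show ?thesis using specialisationD(6)[OF sp Kr a] by (simp add: inverse_unique)
    qed (use specialisationD(6)[OF sp Kr a] z in simp)
    then have M: "subfield_set ?M"
      unfolding subfield_set_def subring_set_def
      using k l hom subfield_setD(2)[OF K] subfield_setD(2)[OF L] by simp
    have "range \<iota> \<union> S \<subseteq> ?M"
      using gens base generate_field_generators[of "range \<kappa> \<union> \<Phi> ` S" ring_of_type_algebra] by auto
    from generate_field_least[OF M this] have "K \<subseteq> ?M" by (simp only: Kgen[symmetric])
    show "K' \<subseteq> ?L"
    proof
      fix y assume "y \<in> K'"
      then obtain x where "x \<in> K" "y = \<Phi> x" unfolding img[symmetric] by (rule imageE)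
      then show "y \<in> ?L" using subsetD[OF \<open>K \<subseteq> ?M\<close>, of x] by simp
    qed
  qed
  ultimately show ?thesis unfolding pure_def by blast
qed

text \<open>A relation \<open>p\<close> is sorted into a polynomial \<open>N\<close> in the variables whose coefficients are polynomials in \<open>S\<close>. Since the
  variables are independent over the field, every coefficient vanishes at \<open>S\<close>, hence is zero. Substituting back
  recovers \<open>p\<close> from \<open>N\<close>.\<close>
lemma alg_independent_adjoin_variables:
  fixes \<iota> :: "'k::field \<Rightarrow> 'f::field"
  assumes \<iota>: "ring_map \<iota>" and S: "alg_independent \<iota> S"
  shows "alg_independent (\<lambda>c. rconst (\<iota> c)) (rconst ` S \<union> rvar ` {..<r})"
  unfolding alg_independent_def
proof (intro ballI impI)
  let ?T = "rconst ` S \<union> rvar ` {..<r} :: 'f ratfun set"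
  fix p :: "('f ratfun, 'k) mpoly"
  assume p: "p \<in> polys UNIV ?T" and e: "eval_mpoly (\<lambda>c. rconst (\<iota> c)) (\<lambda>x. x) p = 0"
  define \<epsilon> where "\<epsilon> = eval_mpoly \<iota> (\<lambda>x. x)"
  have \<epsilon>: "ring_map \<epsilon>" unfolding \<epsilon>_def by (rule ring_map_eval_mpoly[OF \<iota>])
  have \<epsilon>c: "\<epsilon> (mconst c) = \<iota> c" and \<epsilon>v: "\<epsilon> (mvar x) = x" for c x
    unfolding \<epsilon>_def by (rule eval_mpoly_mconst[OF \<iota>], rule eval_mpoly_mvar[OF \<iota>])
  have rc: "ring_map (\<lambda>q. rconst (\<epsilon> q))" by (rule ring_map_compose[OF ring_map_rconst \<epsilon>])
  have mm: "ring_map (\<lambda>c. mconst (mconst c) :: (nat, ('f, 'k) mpoly) mpoly)"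
    by (rule ring_map_compose[OF ring_map_mconst ring_map_mconst])
  define \<theta> where "\<theta> u = (if u \<in> rconst ` S then mconst (mvar (inv_into S rconst u))
    else mvar (inv_into {..<r} rvar u) :: (nat, ('f, 'k) mpoly) mpoly)" for u
  define N where "N = eval_mpoly (\<lambda>c. mconst (mconst c)) \<theta> p"
  have th: "(u \<in> rconst ` S \<and> inv_into S rconst u \<in> S \<and> rconst (inv_into S rconst u) = u) \<or>
    (u \<notin> rconst ` S \<and> inv_into {..<r} rvar u < r \<and> rvar (inv_into {..<r} rvar u) = u)" if "u \<in> ?T" for u
  proof (cases "u \<in> rconst ` S")
    case True
    then show ?thesis using inv_into_into[OF True] f_inv_into_f[OF True] by simp
  next
    case False
    then have v: "u \<in> rvar ` {..<r}" using that by simp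
    then show ?thesis using inv_into_into[OF v] f_inv_into_f[OF v] False by simp
  qed
  have N: "N \<in> polys (polys UNIV S) {..<r}"
    unfolding N_def using subring_set_polys[OF subring_set_polys[OF subring_set_UNIV]] p
  proof (rule eval_mpoly_in_subring)
    show "mconst (mconst c) \<in> polys (polys UNIV S) {..<r}" for c by (intro mconst_in_polys UNIV_I)
    fix u assume "u \<in> ?T"
    from th[OF this] show "\<theta> u \<in> polys (polys UNIV S) {..<r}"
      unfolding \<theta>_def using subring_setD(1)[OF subring_set_polys[OF subring_set_UNIV, of S]]
      by (auto intro!: mconst_in_polys mvar_in_polys)
  qed
  have "of_poly (Poly_Mapping.map \<epsilon> N) = eval_mpoly (\<lambda>q. rconst (\<epsilon> q)) rvar N"
    unfolding map_mpoly_eval[OF \<epsilon>]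
    by (subst ring_map_eval[OF ring_map_of_poly]) (simp add: of_poly_mconst rvar_def[abs_def])
  also have "\<dots> = eval_mpoly (\<lambda>c. rconst (\<iota> c)) (\<lambda>u. eval_mpoly (\<lambda>q. rconst (\<epsilon> q)) rvar (\<theta> u)) p"
    unfolding N_def
    by (subst ring_map_eval[OF ring_map_eval_mpoly[OF rc]]) (simp add: eval_mpoly_mconst[OF rc] \<epsilon>c)
  also have "\<dots> = eval_mpoly (\<lambda>c. rconst (\<iota> c)) (\<lambda>u. u) p"
  proof (rule eval_mpoly_cong[OF p refl])
    fix u assume "u \<in> ?T"
    from th[OF this] show "eval_mpoly (\<lambda>q. rconst (\<epsilon> q)) rvar (\<theta> u) = u"
      unfolding \<theta>_def by (auto simp: eval_mpoly_mconst[OF rc] eval_mpoly_mvar[OF rc] \<epsilon>v)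
  qed
  finally have mz: "Poly_Mapping.map \<epsilon> N = 0" using e by (simp add: of_poly_eq_0_iff)
  have z: "\<epsilon> (Poly_Mapping.lookup N t) = 0" for t
  proof (cases "Poly_Mapping.lookup N t = 0")
    case True
    then show ?thesis by (simp add: ring_mapD(2)[OF \<epsilon>])
  next
    case False
    have "Poly_Mapping.lookup (Poly_Mapping.map \<epsilon> N) t = 0" unfolding mz by simp
    then show ?thesis using False by (simp add: Poly_Mapping.map.rep_eq)
  qed
  have "Poly_Mapping.keys N = {}"
  proof (rule equals0I)
    fix t assume t: "t \<in> Poly_Mapping.keys N"
    have "Poly_Mapping.lookup N t = 0"
      using S polysD(1)[OF N t] z[of t] unfolding alg_independent_def \<epsilon>_def by simp
    then show False using t by (simp add: in_keys_iff)
  qed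
  then have "N = 0" by simp
  define recov where "recov = eval_mpoly (eval_mpoly mconst (\<lambda>s. mvar (rconst s))) (\<lambda>i. mvar (rvar i)) N"
  have b: "ring_map (eval_mpoly mconst (\<lambda>s. mvar (rconst s)) :: ('f, 'k) mpoly \<Rightarrow> ('f ratfun, 'k) mpoly)"
    by (rule ring_map_eval_mpoly[OF ring_map_mconst])
  have "recov = eval_mpoly mconst mvar p"
    unfolding recov_def N_def
  proof (subst ring_map_eval[OF ring_map_eval_mpoly[OF b]], rule eval_mpoly_cong[OF p])
    show "eval_mpoly (eval_mpoly mconst (\<lambda>s. mvar (rconst s))) (\<lambda>i. mvar (rvar i)) (mconst (mconst c)) =
      (mconst c :: ('f ratfun, 'k) mpoly)" for c
      by (simp add: eval_mpoly_mconst[OF b] eval_mpoly_mconst[OF ring_map_mconst])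
    fix u assume "u \<in> ?T"
    from th[OF this] show "eval_mpoly (eval_mpoly mconst (\<lambda>s. mvar (rconst s))) (\<lambda>i. mvar (rvar i)) (\<theta> u) =
      (mvar u :: ('f ratfun, 'k) mpoly)"
      unfolding \<theta>_def by (auto simp: eval_mpoly_mconst[OF b] eval_mpoly_mvar[OF b] eval_mpoly_mvar[OF ring_map_mconst])
  qed
  moreover have "recov = 0" unfolding recov_def \<open>N = 0\<close> by (rule eval_mpoly_0[OF b])
  ultimately show "p = 0" by (simp add: eval_mpoly_mvar_id)
qed

lemma ratfuns_generated:
  fixes \<iota> :: "'k::field \<Rightarrow> 'f::field"
  assumes Kgen: "K = generate_field ring_of_type_algebra (range \<iota> \<union> S)"
  shows "ratfuns K r = generate_field ring_of_type_algebra (range (\<lambda>c. rconst (\<iota> c)) \<union> (rconst ` S \<union> rvar ` {..<r}))"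
    (is "_ = generate_field _ ?H")
proof
  have K: "subfield_set K" unfolding Kgen by (rule generate_field_subfield)
  note Kr = subfield_setD(1)[OF K]
  have gens: "range \<iota> \<union> S \<subseteq> K" unfolding Kgen by (rule generate_field_generators)
  have "?H \<subseteq> ratfuns K r"
  proof
    fix x assume "x \<in> ?H"
    then consider c where "x = rconst (\<iota> c)" | s where "s \<in> S" "x = rconst s" | i where "i < r" "x = rvar i" by auto
    then show "x \<in> ratfuns K r"
    proof cases
      case 1
      have "\<iota> c \<in> K" using gens by (rule subsetD) simp
      then show ?thesis unfolding 1 by (rule rconst_in_ratfuns[OF Kr])
    next
      case 2
      have "s \<in> K" using gens by (rule subsetD) (simp add: 2)
      then show ?thesis unfolding 2 by (rule rconst_in_ratfuns[OF Kr])
    next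
      case 3
      then show ?thesis using rvar_in_ratfuns[OF Kr] by simp
    qed
  qed
  then show "generate_field ring_of_type_algebra ?H \<subseteq> ratfuns K r"
    by (rule generate_field_least[OF subfield_set_ratfuns[OF Kr]])
  let ?L = "generate_field ring_of_type_algebra ?H"
  have L: "subfield_set ?L" by (rule generate_field_subfield)
  note Lr = subfield_setD(1)[OF L]
  have HL: "h \<in> ?L" if "h \<in> ?H" for h using generate_field_generators that by (rule subsetD)
  have inv: "rconst (inverse x) = inverse (rconst x)" for x :: 'f
    using ring_map_divide[OF ring_map_rconst, of 1 x] by (simp add: ring_mapD[OF ring_map_rconst] inverse_eq_divide)
  have M: "subfield_set {x. rconst x \<in> ?L}"
    unfolding subfield_set_def subring_set_def
    using subring_setD[OF Lr] subfield_setD(2)[OF L]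
    by (simp add: ring_mapD[OF ring_map_rconst] inv)
  have "range \<iota> \<union> S \<subseteq> {x. rconst x \<in> ?L}" using HL by auto
  from generate_field_least[OF M this] have KL: "K \<subseteq> {x. rconst x \<in> ?L}" by (simp only: Kgen[symmetric])
  have pL: "of_poly p \<in> ?L" if "p \<in> polys K {..<r}" for p
    unfolding of_poly_eval using Lr that
  proof (rule eval_mpoly_in_subring)
    show "c \<in> K \<Longrightarrow> rconst c \<in> ?L" for c using KL by auto
    show "i \<in> {..<r} \<Longrightarrow> rvar i \<in> ?L" for i by (rule HL) simp
  qed
  show "ratfuns K r \<subseteq> ?L"
  proof
    fix f assume "f \<in> ratfuns K r"
    then show "f \<in> ?L"
      unfolding ratfuns_iff
    proof (elim bexE conjE)
      fix p q assume "p \<in> polys K {..<r}" "q \<in> polys K {..<r}" "f = of_poly p / of_poly q"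
      then show "f \<in> ?L" using subfield_setD(3)[OF L pL pL] by simp
    qed
  qed
qed

lemma pure_ratfuns:
  fixes \<iota> :: "'k::field \<Rightarrow> 'f::field"
  assumes "ring_map \<iota>" and "pure \<iota> K"
  shows "pure (\<lambda>c. rconst (\<iota> c)) (ratfuns K r)"
proof -
  obtain S where S: "alg_independent \<iota> S" and K: "K = generate_field ring_of_type_algebra (range \<iota> \<union> S)"
    using assms(2) unfolding pure_def by blast
  show ?thesis
    unfolding pure_def
    by (intro exI conjI) (rule alg_independent_adjoin_variables[OF assms(1) S], rule ratfuns_generated[OF K])
qed

section \<open>Stable equivalence of invariant fields\<close>

lemma ring_iso_field_on_compose:
  assumes "\<Phi> \<in> ring_iso (field_on K) (field_on L)" "\<Psi> \<in> ring_iso (field_on L) (field_on M)"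
  shows "(\<lambda>x. \<Psi> (\<Phi> x)) \<in> ring_iso (field_on K) (field_on M)"
proof -
  note a = assms[unfolded ring_iso_field_on_iff]
  have b: "bij_betw \<Phi> K L" "bij_betw \<Psi> L M" using a by blast+
  have L: "\<Phi> x \<in> L" if "x \<in> K" for x using b(1) that by (rule bij_betwE[rule_format])
  have "bij_betw (\<lambda>x. \<Psi> (\<Phi> x)) K M" using bij_betw_trans[OF b] by (simp add: o_def)
  then show ?thesis unfolding ring_iso_field_on_iff using a L by simp
qed

lemma ring_iso_field_on_inverse:
  assumes "\<Phi> \<in> ring_iso (field_on K) (field_on L)" and K: "subfield_set K"
  shows "inv_into K \<Phi> \<in> ring_iso (field_on L) (field_on K)"
proof -
  note a = assms(1)[unfolded ring_iso_field_on_iff] and k = subring_setD[OF subfield_setD(1)[OF K]]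
  have b: "bij_betw \<Phi> K L" using a by blast
  note i = bij_betw_inv_into_left[OF b] and j = bij_betw_inv_into_right[OF b]
  have m: "inv_into K \<Phi> y \<in> K" if "y \<in> L" for y using bij_betw_inv_into[OF b] that by (rule bij_betwE[rule_format])
  have "inv_into K \<Phi> 1 = 1" using i[OF k(1)] a by simp
  moreover have "inv_into K \<Phi> (x + y) = inv_into K \<Phi> x + inv_into K \<Phi> y \<and> inv_into K \<Phi> (x * y) = inv_into K \<Phi> x * inv_into K \<Phi> y"
    if "x \<in> L" "y \<in> L" for x y
    using i[OF k(3)[OF m[OF that(1)] m[OF that(2)]]] i[OF k(4)[OF m[OF that(1)] m[OF that(2)]]] a m that j by simp
  ultimately show ?thesis unfolding ring_iso_field_on_iff using bij_betw_inv_into[OF b] by simp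
qed

lemma ring_map_base_embedding: "ring_map base_embedding"
  unfolding base_embedding_def[abs_def]
  by (rule ring_map_compose[OF ring_map_rconst]) (simp add: ring_map_def to_ac_add to_ac_mult)

text \<open>The no-name lemma for \<open>V\<close> with \<open>W\<close> and for \<open>W\<close> with \<open>V\<close>, joined by the exchange of the summands.\<close>
lemma stably_isomorphic_invariant_fields:
  fixes \<rho> \<sigma> :: "'k::field_char_0 alg_closure mat \<Rightarrow> 'k alg_closure mat"
  assumes \<rho>: "almost_free_representation n m G \<rho>" and \<sigma>: "almost_free_representation n d G \<sigma>"
  shows "\<exists>\<Phi>\<in>ring_iso (field_on (ratfuns (invariant_field G m \<rho>) d)) (field_on (ratfuns (invariant_field G d \<sigma>) m)).
    \<forall>c. \<Phi> (rconst (base_embedding c)) = rconst (base_embedding c)"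
proof -
  interpret R: almost_free_representation n m G \<rho> by (rule \<rho>)
  interpret S: almost_free_representation n d G \<sigma> by (rule \<sigma>)
  note r = R.representation_axioms and s = S.representation_axioms
  obtain \<Phi> where \<Phi>: "\<Phi> \<in> ring_iso (field_on (ratfuns (invariant_field G m \<rho>) d))
      (field_on (invariant_field G (m + d) (\<lambda>A. block_sum (\<rho> A) (\<sigma> A))))"
    and \<Phi>b: "\<And>c. \<Phi> (rconst (base_embedding c)) = base_embedding c"
    using R.no_name_lemma[OF s] by (elim bexE) blast
  obtain \<Psi> where \<Psi>: "\<Psi> \<in> ring_iso (field_on (ratfuns (invariant_field G d \<sigma>) m))
      (field_on (invariant_field G (d + m) (\<lambda>A. block_sum (\<sigma> A) (\<rho> A))))"
    and \<Psi>b: "\<And>c. \<Psi> (rconst (base_embedding c)) = base_embedding c"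
    using S.no_name_lemma[OF r] by (elim bexE) blast
  let ?L = "ratfuns (invariant_field G d \<sigma>) m"
  have Kr: "subring_set (invariant_field G d \<sigma>)" by (rule subfield_setD(1)[OF S.subfield_invariant_field])
  have L: "subfield_set ?L" by (rule subfield_set_ratfuns[OF Kr])
  note sw = swap_summands_iso[OF r s]
  let ?\<Theta> = "\<lambda>x. inv_into ?L \<Psi> (rename_vars (swap_blocks m d) (\<Phi> x))"
  have iso: "?\<Theta> \<in> ring_iso (field_on (ratfuns (invariant_field G m \<rho>) d)) (field_on ?L)"
    by (rule ring_iso_field_on_compose[OF ring_iso_field_on_compose[OF \<Phi> sw] ring_iso_field_on_inverse[OF \<Psi> L]])
  have base: "?\<Theta> (rconst (base_embedding c)) = rconst (base_embedding c)" for c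
  proof -
    have "rename_vars (swap_blocks m d) (base_embedding c) = (base_embedding c :: 'k alg_closure ratfun)"
      unfolding base_embedding_def by (rule rename_vars_props(2)[of "swap_blocks d m", OF swap_blocks_swap_blocks])
    moreover have "rconst (base_embedding c) \<in> ?L" by (rule rconst_in_ratfuns[OF Kr S.base_embedding_invariant])
    moreover have "inj_on \<Psi> ?L" using \<Psi> unfolding ring_iso_field_on_iff bij_betw_def by blast
    ultimately show ?thesis using inv_into_f_f[of \<Psi> ?L "rconst (base_embedding c)"] by (simp add: \<Phi>b \<Psi>b)
  qed
  show ?thesis by (rule bexI[OF _ iso]) (intro allI base)
qed

lemma stably_pure_if_stably_isomorphic:
  fixes \<iota> :: "'k::field \<Rightarrow> 'f::field" and \<kappa> :: "'k \<Rightarrow> 'g::field"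
  assumes \<iota>: "ring_map \<iota>" and \<kappa>: "ring_map \<kappa>" and L: "subfield_set L"
    and \<Phi>: "\<Phi> \<in> ring_iso (field_on (ratfuns K r)) (field_on (ratfuns L s))"
    and base: "\<And>c. \<Phi> (rconst (\<iota> c)) = rconst (\<kappa> c)"
    and pure: "pure \<iota> K"
  shows "stably_pure \<kappa> L"
  unfolding stably_pure_def
  by (intro exI, rule pure_transport[OF ring_map_compose[OF ring_map_rconst \<iota>] ring_map_compose[OF ring_map_rconst \<kappa>]
    pure_ratfuns[OF \<iota> pure] subfield_set_ratfuns[OF subfield_setD(1)[OF L]] \<Phi>]) (rule base)

theorem corollary3p9:
  fixes G :: "'k::field_char_0 alg_closure mat set"
    and \<rho> \<sigma> :: "'k alg_closure mat \<Rightarrow> 'k alg_closure mat"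
    and n dV dW :: nat
  assumes "reductive_group n G"
    and "linear_action n G dV \<rho>" and "almost_free n G dV \<rho>"
    and "linear_action n G dW \<sigma>" and "almost_free n G dW \<sigma>"
  shows "stably_equivalent
           base_embedding (invariant_field G dV \<rho>) base_embedding (invariant_field G dW \<sigma>)
       \<and> (pure base_embedding (invariant_field G dV \<rho>) \<longrightarrow>
            stably_pure base_embedding (invariant_field G dW \<sigma>))
       \<and> (pure base_embedding (invariant_field G dW \<sigma>) \<longrightarrow>
            stably_pure base_embedding (invariant_field G dV \<rho>))"
proof -
  have G: "linear_algebraic_group n G" using assms(1) unfolding reductive_group_def by (rule conjunct1)
  have \<rho>: "almost_free_representation n dV G \<rho>" by unfold_locales (rule G assms)+
  have \<sigma>: "almost_free_representation n dW G \<sigma>" by unfold_locales (rule G assms)+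
  interpret R: almost_free_representation n dV G \<rho> by (rule \<rho>)
  interpret S: almost_free_representation n dW G \<sigma> by (rule \<sigma>)
  obtain \<Phi> where \<Phi>: "\<Phi> \<in> ring_iso (field_on (ratfuns (invariant_field G dV \<rho>) dW)) (field_on (ratfuns (invariant_field G dW \<sigma>) dV))"
    and \<Phi>b: "\<And>c. \<Phi> (rconst (base_embedding c)) = rconst (base_embedding c)"
    using stably_isomorphic_invariant_fields[OF \<rho> \<sigma>] by (elim bexE) blast
  obtain \<Psi> where \<Psi>: "\<Psi> \<in> ring_iso (field_on (ratfuns (invariant_field G dW \<sigma>) dV)) (field_on (ratfuns (invariant_field G dV \<rho>) dW))"
    and \<Psi>b: "\<And>c. \<Psi> (rconst (base_embedding c)) = rconst (base_embedding c)"
    using stably_isomorphic_invariant_fields[OF \<sigma> \<rho>] by (elim bexE) blast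
  note b = ring_map_base_embedding
  show ?thesis
  proof (intro conjI impI)
    show "stably_equivalent base_embedding (invariant_field G dV \<rho>) base_embedding (invariant_field G dW \<sigma>)"
      unfolding stably_equivalent_def
      by (rule exI[of _ dW], rule exI[of _ dV], rule bexI[OF _ \<Phi>]) (rule allI, rule \<Phi>b)
  next
    assume "pure base_embedding (invariant_field G dV \<rho>)"
    then show "stably_pure base_embedding (invariant_field G dW \<sigma>)"
      by (rule stably_pure_if_stably_isomorphic[OF b b S.subfield_invariant_field \<Phi> \<Phi>b])
  next
    assume "pure base_embedding (invariant_field G dW \<sigma>)"
    then show "stably_pure base_embedding (invariant_field G dV \<rho>)"
      by (rule stably_pure_if_stably_isomorphic[OF b b R.subfield_invariant_field \<Psi> \<Psi>b])
  qed
qed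

end
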